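(* Let $m\ge n$ and let $X$ be a local isometric immersion of a flat $n$-dimensional submanifold in $S^{n+m-1}\subset\mathbb R^{n+m}$ with flat, non-degenerate normal bundle. Let $e_{n+1}=X$, and fix a local parallel normal frame $e_{n+2},\dots,e_{n+m}$. Then: (i) There exist spherical line of curvature coordinates $(x_1,\dots,x_n)$ and a smooth $\mathcal M_{m\times n}$-valued map $A_1=(a_{ij})$ such that $A_1^tA_1=I$ and the first and second fundamental forms of $X$ are given by $$I=\sum_{i=1}^n a_{1i}^2\,dx_i^2,\qquad II=\sum_{i=1}^n\sum_{j=2}^m a_{1i}a_{ji}\,dx_i^2\,e_{n+j}.$$ (ii) Let $f_{ij}=(a_{1i})_{x_j}/a_{1j}$ for $i\ne j$, $f_{ii}=0$ for all $1\le i,j\le n$, and $F=(f_{ij})\in gl_*(n)$. Then the Gauss, Codazzi and Ricci equations for the immersion $X$ are the $G_{m,n}$-system I for $(A_1,F)$. In other words, $(A_1,F)$ is a solution of the $G_{m,n}$-system I. (iii) Let $e_i=\frac1{a_{1i}}X_{x_i}$ and $g=(e_{n+1},\dots,e_{m+n},e_1,\dots,e_n)\in O(m+n)$. Then $$g^{-1}dg=\sum_{i=1}^n\begin{pmatrix}0&-A_1C_i\\ C_iA_1^t&-F^tC_i+C_iF\end{pmatrix}dx_i,\qquad(\ast)$$ which is the Lax connection $\theta^I_\lambda$ of the $G_{m,n}$-system I at $\lambda=1$. (iv) Conversely, if $(A_1,F)$ is a solution of the $G_{m,n}$-system I, then system $(\ast)$ is solvable. Let $g$ be a solution of $(\ast)$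 and $X$ the first column of $g$. If all entries of the first row of $A_1$ are non-zero, then $X$ is an isometric immersion of a flat $n$-dimensional submanifold in $S^{n+m-1}$ with flat and non-degenerate normal bundle such that the two fundamental forms are as in (i), where $A_1=(a_{ij})$.
   Context: $\mathcal M_{m\times n}$ is the space of real $m\times n$ matrices, $\mathcal M^0_{m\times n}=\{A_1\in\mathcal M_{m\times n}:A_1^tA_1=I\}$, $gl_*(n)$ is the space of real $n\times n$ matrices with zero diagonal, and $C_i$ is the $n\times n$ diagonal matrix whose only non-zero entry is a $1$ at position $(i,i)$. Subscripts $x_j$ denote partial derivatives. The $G_{m,n}$-system I is the PDE for $(A_1,F)=((a_{ij}),(f_{ij})):\mathbb R^n\to\mathcal M^0_{m\times n}\times gl_*(n)$: $(a_{ij})_{x_k}=f_{jk}a_{ik}$ if $k\ne j$; $(f_{ij})_{x_j}+(f_{ji})_{x_i}+\sum_kf_{ik}f_{jk}=0$ if $i\ne j$; $(f_{ij})_{x_k}=f_{ik}f_{kj}$ if $i,j,k$ are distinct. Its Lax connection is $\theta^I_\lambda=\sum_i\begin{pmatrix}0&-A_1C_i\lambda\\ C_iA_1^t\lambda&-F^tC_i+C_iF\end{pmatrix}dx_i$; the system is equivalent to flatness ($d\theta+\theta\wedge\theta=0$) of $\theta^I_\lambda$ for all $\lambda\in\mathbb C$. Solutions $g$ of $(\ast)$ are understood to be $O(m+n)$-valued. Conventions: for a local orthonormal tangent frame $e_i$ and normal frame $e_\alpha$, put $\omega_i=\langle dX,e_i\rangle$ and $\omega_{i\alpha}=\langle e_i,de_\alpha\rangle$;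 then $I=\sum_i\omega_i^2$ and $II=\sum_{i,\alpha}\omega_{i\alpha}\omega_ie_\alpha$. For a normal vector $v$ the shape operator $A_v$ is defined by $\langle II(v_1,v_2),v\rangle=\langle A_v(v_1),v_2\rangle$. The normal bundle of an $n$-dimensional submanifold $M$ of a Riemannian manifold is non-degenerate if for every $p\in M$ the space of shape operators $\{A_v: v\in\nu(M)_p\}$ has dimension $n$. A normal field is parallel if it is parallel for the induced normal connection. Local coordinates $x_1,\dots,x_n$ are line of curvature coordinates with respect to an orthonormal parallel normal frame $\{e_\alpha\}$ if $I=\sum_ia_i^2dx_i^2$ and $II=\sum_{i,j}b_{ji}dx_i^2e_{n+j}$ for some smooth functions $a_i,b_{ji}$; they are called spherical if in addition $a_1^2+\dots+a_n^2=1$.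
   Formalization: "Spherical" in (i) fails for m>n (small circle in S²), so it is asserted only for m=n and otherwise proved equivalent to the shape operators in the sphere spanning fewer than n dimensions; non-degeneracy is taken in R^{n+m}, with X among the normals, since (iv) fails otherwise for m=n. *)

theory Defs
  imports "HOL-Analysis.Analysis"
begin

section \<open>Smooth maps on open subsets of Euclidean space\<close>

text \<open>The value at \<open>u\<close> of the one-form \<open>df\<close> at \<open>p\<close>.\<close>

definition D :: "('a::real_normed_vector \<Rightarrow> 'b::real_normed_vector) \<Rightarrow> 'a \<Rightarrow> 'a \<Rightarrow> 'b" where
  "D f p u = frechet_derivative f (at p) u"

definition partial :: "'n::finite \<Rightarrow> (real^'n \<Rightarrow> 'b::real_normed_vector) \<Rightarrow> real^'n \<Rightarrow> 'b" where
  "partial i f p = D f p (axis i 1)"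

primrec C_on :: "nat \<Rightarrow> (real^'n::finite) set \<Rightarrow> (real^'n \<Rightarrow> 'b::real_normed_vector) \<Rightarrow> bool" where
  "C_on 0 U f \<longleftrightarrow> continuous_on U f"
| "C_on (Suc k) U f \<longleftrightarrow> (\<forall>p\<in>U. f differentiable (at p)) \<and> (\<forall>i. C_on k U (partial i f))"

text \<open>Only meaningful for open \<open>U\<close>, as all derivatives are two-sided.\<close>

definition smooth_on :: "(real^'n::finite) set \<Rightarrow> (real^'n \<Rightarrow> 'b::real_normed_vector) \<Rightarrow> bool" where
  "smooth_on U f \<longleftrightarrow> (\<forall>k. C_on k U f)"

definition diffeomorphism_on ::
  "(real^'n::finite) set \<Rightarrow> (real^'n) set \<Rightarrow> (real^'n \<Rightarrow> real^'n) \<Rightarrow> (real^'n \<Rightarrow> real^'n) \<Rightarrow> bool" where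
  "diffeomorphism_on V W \<phi> \<psi> \<longleftrightarrow> open V \<and> open W \<and> homeomorphism V W \<phi> \<psi> \<and>
     smooth_on V \<phi> \<and> smooth_on W \<psi>"


section \<open>Induced connections\<close>

text \<open>A vector bundle over \<open>U\<close> is a family \<open>E\<close> of subspaces of a fixed Euclidean space, with the
  connection given by differentiating and projecting back orthogonally onto the fibre. For the
  tangent bundle of an immersion this is the Levi-Civita connection of the induced metric. For
  the normal bundle (in Euclidean space or in a sphere) it is the induced normal connection.\<close>

definition orth_proj :: "('d::euclidean_space) set \<Rightarrow> 'd \<Rightarrow> 'd" where
  "orth_proj S v = (THE w. w \<in> S \<and> (\<forall>s\<in>S. (v - w) \<bullet> s = 0))"

definition smooth_section ::
  "(real^'n::finite) set \<Rightarrow> (real^'n \<Rightarrow> ('d::euclidean_space) set) \<Rightarrow> (real^'n \<Rightarrow> 'd) \<Rightarrow> bool" where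
  "smooth_section U E s \<longleftrightarrow> smooth_on U s \<and> (\<forall>p\<in>U. s p \<in> E p)"

definition nabla ::
  "(real^'n::finite \<Rightarrow> ('d::euclidean_space) set) \<Rightarrow> 'n \<Rightarrow> (real^'n \<Rightarrow> 'd) \<Rightarrow> real^'n \<Rightarrow> 'd" where
  "nabla E i s p = orth_proj (E p) (partial i s p)"

definition parallel_section ::
  "(real^'n::finite) set \<Rightarrow> (real^'n \<Rightarrow> ('d::euclidean_space) set) \<Rightarrow> (real^'n \<Rightarrow> 'd) \<Rightarrow> bool" where
  "parallel_section U E s \<longleftrightarrow> smooth_section U E s \<and> (\<forall>p\<in>U. \<forall>i. nabla E i s p = 0)"

text \<open>Vanishing curvature. The term with the Lie bracket is absent, since coordinate vector fields
  commute.\<close>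

definition flat_bundle ::
  "(real^'n::finite) set \<Rightarrow> (real^'n \<Rightarrow> ('d::euclidean_space) set) \<Rightarrow> bool" where
  "flat_bundle U E \<longleftrightarrow> (\<forall>s. smooth_section U E s \<longrightarrow>
     (\<forall>p\<in>U. \<forall>i j. nabla E i (nabla E j s) p = nabla E j (nabla E i s) p))"


section \<open>Immersions into the unit sphere\<close>

definition tangent_space :: "(real^'n::finite \<Rightarrow> 'd::euclidean_space) \<Rightarrow> real^'n \<Rightarrow> 'd set" where
  "tangent_space X p = range (D X p)"

definition normal_space :: "(real^'n::finite \<Rightarrow> 'd::euclidean_space) \<Rightarrow> real^'n \<Rightarrow> 'd set" where
  "normal_space X p = {v. \<forall>t\<in>tangent_space X p. v \<bullet> t = 0}"

definition sphere_normal_space ::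
  "(real^'n::finite \<Rightarrow> 'd::euclidean_space) \<Rightarrow> real^'n \<Rightarrow> 'd set" where
  "sphere_normal_space X p = {v \<in> normal_space X p. v \<bullet> X p = 0}"

definition sphere_immersion ::
  "(real^'n::finite) set \<Rightarrow> (real^'n \<Rightarrow> 'd::euclidean_space) \<Rightarrow> bool" where
  "sphere_immersion U X \<longleftrightarrow> open U \<and> smooth_on U X \<and>
     (\<forall>p\<in>U. inj (D X p) \<and> X p \<in> sphere 0 1)"

definition first_form ::
  "(real^'n::finite \<Rightarrow> 'd::euclidean_space) \<Rightarrow> real^'n \<Rightarrow> real^'n \<Rightarrow> real^'n \<Rightarrow> real" where
  "first_form X p u w = D X p u \<bullet> D X p w"

text \<open>An orthonormal normal frame is a family \<open>N\<close> indexed by a finite type \<open>'m\<close>; the form is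
  taken over the members with index in \<open>J\<close>. For an orthonormal tangent frame \<open>e\<^sub>i\<close> the coefficient
  is \<open>(\<Sum>\<^sub>i \<omega>\<^sub>i\<^sub>\<alpha> \<omega>\<^sub>i)(u,w) = (\<Sum>\<^sub>i \<langle>e\<^sub>i, de\<^sub>\<alpha>(u)\<rangle> \<langle>dX(w), e\<^sub>i\<rangle>) = \<langle>de\<^sub>\<alpha>(u), dX(w)\<rangle>\<close>. With this sign
  convention \<open>II\<close> is minus the normal part of the second derivative of \<open>X\<close>.\<close>

definition second_form ::
  "'m set \<Rightarrow> (real^'n::finite \<Rightarrow> 'd::euclidean_space) \<Rightarrow> ('m::finite \<Rightarrow> real^'n \<Rightarrow> 'd) \<Rightarrow>
   real^'n \<Rightarrow> real^'n \<Rightarrow> real^'n \<Rightarrow> 'd" where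
  "second_form J X N p u w = (\<Sum>j\<in>J. (D (N j) p u \<bullet> D X p w) *\<^sub>R N j p)"

text \<open>The shape operators \<open>A\<^sub>v\<close>, for \<open>v\<close> in a normal space \<open>\<nu>\<close>, determined by
  \<open>\<langle>A\<^sub>v(v\<^sub>1), v\<^sub>2\<rangle> = \<langle>II(v\<^sub>1,v\<^sub>2), v\<rangle>\<close>. They are recorded as matrices \<open>S\<close> by means of the isomorphism
  \<open>dX\<close> of the parameter space with the tangent space.\<close>

definition shape_operators ::
  "'d set \<Rightarrow> 'm set \<Rightarrow> (real^'n::finite \<Rightarrow> 'd::euclidean_space) \<Rightarrow>
   ('m::finite \<Rightarrow> real^'n \<Rightarrow> 'd) \<Rightarrow> real^'n \<Rightarrow> (real^'n^'n) set" where
  "shape_operators \<nu> J X N p =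
     {S. \<exists>v\<in>\<nu>. \<forall>u w. D X p (S *v u) \<bullet> D X p w = second_form J X N p u w \<bullet> v}"

text \<open>The frame with \<open>e\<^bsub>n+1\<^esub> = X\<close>: the row indices \<open>1,\<dots>,m\<close> are the elements of \<open>'m\<close>, the
  index \<open>1\<close> being the distinguished element \<open>j1\<close>, and \<open>N j\<close> is \<open>e\<^bsub>n+j\<^esub>\<close>.\<close>

definition parallel_frame ::
  "'m \<Rightarrow> (real^'n::finite) set \<Rightarrow> (real^'n \<Rightarrow> real^('m + 'n)) \<Rightarrow>
   ('m::finite \<Rightarrow> real^'n \<Rightarrow> real^('m + 'n)) \<Rightarrow> bool" where
  "parallel_frame j1 U X N \<longleftrightarrow>
     (\<forall>p\<in>U. N j1 p = X p) \<and>
     (\<forall>p\<in>U. \<forall>j k. N j p \<bullet> N k p = (if j = k then 1 else 0)) \<and>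
     (\<forall>j. j \<noteq> j1 \<longrightarrow> parallel_section U (sphere_normal_space X) (N j))"

text \<open>Flatness of the normal bundle refers to the sphere. Non-degeneracy refers to the submanifold
  of Euclidean space, with \<open>X\<close> among its normal fields: the normal spaces in the sphere have
  dimension \<open>m - 1\<close>, so that for \<open>m = n\<close> their shape operators never span \<open>n\<close> dimensions.\<close>

definition nondegenerate_normal_bundle ::
  "(real^'n::finite) set \<Rightarrow> (real^'n \<Rightarrow> real^('m + 'n)) \<Rightarrow>
   ('m::finite \<Rightarrow> real^'n \<Rightarrow> real^('m + 'n)) \<Rightarrow> bool" where
  "nondegenerate_normal_bundle U X N \<longleftrightarrow>
     (\<forall>p\<in>U. dim (shape_operators (normal_space X p) UNIV X N p) = CARD('n))"

definition flat_sphere_immersion ::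
  "'m \<Rightarrow> (real^'n::finite) set \<Rightarrow> (real^'n \<Rightarrow> real^('m + 'n)) \<Rightarrow>
   ('m::finite \<Rightarrow> real^'n \<Rightarrow> real^('m + 'n)) \<Rightarrow> bool" where
  "flat_sphere_immersion j1 U X N \<longleftrightarrow>
     sphere_immersion U X \<and> parallel_frame j1 U X N \<and>
     flat_bundle U (tangent_space X) \<and>
     flat_bundle U (sphere_normal_space X) \<and>
     nondegenerate_normal_bundle U X N"


section \<open>Line of curvature coordinates\<close>

text \<open>The following predicates concern an immersion \<open>Y\<close> of \<open>W\<close> that is already expressed in the
  coordinates in question, with normal frame \<open>N j\<close>, \<open>j \<in> J\<close>; \<open>dx\<^sub>i\<^sup>2\<close> is the bilinear
  form \<open>u\<^sub>i w\<^sub>i\<close>.\<close>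

definition curvature_form_data ::
  "'m set \<Rightarrow> (real^'n::finite) set \<Rightarrow> (real^'n \<Rightarrow> 'd::euclidean_space) \<Rightarrow>
   ('m::finite \<Rightarrow> real^'n \<Rightarrow> 'd) \<Rightarrow> ('n \<Rightarrow> real^'n \<Rightarrow> real) \<Rightarrow> ('m \<Rightarrow> 'n \<Rightarrow> real^'n \<Rightarrow> real) \<Rightarrow> bool" where
  "curvature_form_data J W Y N a b \<longleftrightarrow>
     (\<forall>i. smooth_on W (a i)) \<and> (\<forall>j\<in>J. \<forall>i. smooth_on W (b j i)) \<and>
     (\<forall>x\<in>W. \<forall>u w. first_form Y x u w = (\<Sum>i\<in>UNIV. (a i x)\<^sup>2 * (u $ i * w $ i))) \<and>
     (\<forall>x\<in>W. \<forall>u w. second_form J Y N x u w =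
        (\<Sum>i\<in>UNIV. \<Sum>j\<in>J. (b j i x * (u $ i * w $ i)) *\<^sub>R N j x))"

definition line_of_curvature_coords ::
  "'m set \<Rightarrow> (real^'n::finite) set \<Rightarrow> (real^'n \<Rightarrow> 'd::euclidean_space) \<Rightarrow>
   ('m::finite \<Rightarrow> real^'n \<Rightarrow> 'd) \<Rightarrow> bool" where
  "line_of_curvature_coords J W Y N \<longleftrightarrow> (\<exists>a b. curvature_form_data J W Y N a b)"

definition spherical_line_of_curvature_coords ::
  "'m set \<Rightarrow> (real^'n::finite) set \<Rightarrow> (real^'n \<Rightarrow> 'd::euclidean_space) \<Rightarrow>
   ('m::finite \<Rightarrow> real^'n \<Rightarrow> 'd) \<Rightarrow> bool" where
  "spherical_line_of_curvature_coords J W Y N \<longleftrightarrow>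
     (\<exists>a b. curvature_form_data J W Y N a b \<and> (\<forall>x\<in>W. (\<Sum>i\<in>UNIV. (a i x)\<^sup>2) = 1))"

text \<open>\<open>I = \<Sum>\<^sub>i a\<^sub>1\<^sub>i\<^sup>2 dx\<^sub>i\<^sup>2\<close> and \<open>II = \<Sum>\<^sub>i \<Sum>\<^bsub>j\<ge>2\<^esub> a\<^sub>1\<^sub>i a\<^sub>j\<^sub>i dx\<^sub>i\<^sup>2 e\<^bsub>n+j\<^esub>\<close> with \<open>A\<^sup>tA = I\<close>.

  Such coordinates are spherical exactly where the shape operators of the submanifold of the
  sphere span fewer than \<open>n\<close> dimensions. Indeed, if \<open>r\<close> is the first row of \<open>A\<close> and \<open>B\<close> consists
  of the other rows, then \<open>B\<^sup>tB = 1 - r\<^sup>tr\<close> is singular if and only if \<open>|r| = 1\<close>. This is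
  automatic for \<open>m = n\<close>, but fails, for instance, for a circle in the 2-sphere that is not a
  great circle (\<open>n = 1\<close>, \<open>m = 2\<close>).\<close>

definition fundamental_forms ::
  "'m \<Rightarrow> (real^'n::finite) set \<Rightarrow> (real^'n \<Rightarrow> real^('m + 'n)) \<Rightarrow>
   ('m::finite \<Rightarrow> real^'n \<Rightarrow> real^('m + 'n)) \<Rightarrow> (real^'n \<Rightarrow> real^'n^'m) \<Rightarrow> bool" where
  "fundamental_forms j1 W Y N A \<longleftrightarrow>
     smooth_on W A \<and>
     (\<forall>x\<in>W. transpose (A x) ** A x = mat 1) \<and>
     (\<forall>x\<in>W. \<forall>u w. first_form Y x u w =
        (\<Sum>i\<in>UNIV. (A x $ j1 $ i)\<^sup>2 * (u $ i * w $ i))) \<and>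
     (\<forall>x\<in>W. \<forall>u w. second_form (- {j1}) Y N x u w =
        (\<Sum>i\<in>UNIV. \<Sum>j\<in>- {j1}. (A x $ j1 $ i * A x $ j $ i * (u $ i * w $ i)) *\<^sub>R N j x))"


section \<open>The \<open>G\<^bsub>m,n\<^esub>\<close>-system I and its Lax connection\<close>

definition G_system_I ::
  "(real^'n::finite) set \<Rightarrow> (real^'n \<Rightarrow> real^'n^'m::finite) \<Rightarrow> (real^'n \<Rightarrow> real^'n^'n) \<Rightarrow> bool" where
  "G_system_I W A F \<longleftrightarrow>
     smooth_on W A \<and> smooth_on W F \<and>
     (\<forall>x\<in>W.
        transpose (A x) ** A x = mat 1 \<and>
        (\<forall>i. F x $ i $ i = 0) \<and>
        (\<forall>i j k. k \<noteq> j \<longrightarrow> partial k (\<lambda>y. A y $ i $ j) x = F x $ j $ k * A x $ i $ k) \<and>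
        (\<forall>i j. i \<noteq> j \<longrightarrow>
           partial j (\<lambda>y. F y $ i $ j) x + partial i (\<lambda>y. F y $ j $ i) x
             + (\<Sum>k\<in>UNIV. F x $ i $ k * F x $ j $ k) = 0) \<and>
        (\<forall>i j k. i \<noteq> j \<and> j \<noteq> k \<and> i \<noteq> k \<longrightarrow>
           partial k (\<lambda>y. F y $ i $ j) x = F x $ i $ k * F x $ k $ j))"

definition C_mat :: "'n \<Rightarrow> 'k::zero_neq_one^'n::finite^'n" where
  "C_mat i = (\<chi> k l. if k = i \<and> l = i then 1 else 0)"

definition block_matrix ::
  "'k^'m^'m \<Rightarrow> 'k^'n^'m \<Rightarrow> 'k^'m^'n \<Rightarrow> 'k^'n^'n \<Rightarrow> 'k^('m::finite + 'n::finite)^('m + 'n)" where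
  "block_matrix P Q R S = (\<chi> r c. case r of
       Inl j \<Rightarrow> (case c of Inl k \<Rightarrow> P $ j $ k | Inr l \<Rightarrow> Q $ j $ l)
     | Inr i \<Rightarrow> (case c of Inl k \<Rightarrow> R $ i $ k | Inr l \<Rightarrow> S $ i $ l))"

definition cmatrix :: "real^'c::finite^'r::finite \<Rightarrow> complex^'c^'r" where
  "cmatrix M = (\<chi> i j. complex_of_real (M $ i $ j))"

text \<open>The coefficient of \<open>dx\<^sub>i\<close> in \<open>\<theta>\<^sup>I\<^sub>\<lambda>\<close>, for the values \<open>A\<close>, \<open>F\<close> of the two maps at a point.\<close>

definition lax_connection ::
  "complex \<Rightarrow> real^'n::finite^'m::finite \<Rightarrow> real^'n^'n \<Rightarrow> 'n \<Rightarrow> complex^('m + 'n)^('m + 'n)" where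
  "lax_connection l A F i = block_matrix
     0                                          (- ((cmatrix A ** C_mat i) ** mat l))
     ((C_mat i ** transpose (cmatrix A)) ** mat l)
                              (- (transpose (cmatrix F) ** C_mat i) + C_mat i ** cmatrix F)"

text \<open>The coefficient of \<open>dx\<^sub>i\<close> prescribed for \<open>g\<^sup>-\<^sup>1dg\<close>.\<close>

definition frame_connection ::
  "real^'n::finite^'m::finite \<Rightarrow> real^'n^'n \<Rightarrow> 'n \<Rightarrow> real^('m + 'n)^('m + 'n)" where
  "frame_connection A F i = block_matrix
     0                            (- (A ** C_mat i))
     (C_mat i ** transpose A)     (- (transpose F ** C_mat i) + C_mat i ** F)"

definition frame_solution ::
  "(real^'n::finite) set \<Rightarrow> (real^'n \<Rightarrow> real^'n^'m::finite) \<Rightarrow> (real^'n \<Rightarrow> real^'n^'n) \<Rightarrow>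
   (real^'n \<Rightarrow> real^('m + 'n)^('m + 'n)) \<Rightarrow> bool" where
  "frame_solution W A F g \<longleftrightarrow>
     smooth_on W g \<and>
     (\<forall>x\<in>W. orthogonal_matrix (g x)) \<and>
     (\<forall>x\<in>W. \<forall>u. matrix_inv (g x) ** D g x u =
        (\<Sum>i\<in>UNIV. (u $ i) *\<^sub>R frame_connection (A x) (F x) i))"

text \<open>\<open>f\<^sub>i\<^sub>j = (a\<^sub>1\<^sub>i)\<^bsub>x\<^sub>j\<^esub> / a\<^sub>1\<^sub>j\<close> off the diagonal.\<close>

definition rotation_coeffs :: "'m \<Rightarrow> (real^'n::finite \<Rightarrow> real^'n^'m::finite) \<Rightarrow> real^'n \<Rightarrow> real^'n^'n" where
  "rotation_coeffs j1 A x =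
     (\<chi> i j. if i = j then 0 else partial j (\<lambda>y. A y $ j1 $ i) x / A x $ j1 $ j)"

text \<open>The matrix with columns \<open>e\<^bsub>n+1\<^esub>,\<dots>,e\<^bsub>n+m\<^esub>,e\<^sub>1,\<dots>,e\<^sub>n\<close>, where \<open>e\<^sub>i = X\<^bsub>x\<^sub>i\<^esub> / a\<^sub>1\<^sub>i\<close>.\<close>

definition frame_matrix ::
  "'m \<Rightarrow> (real^'n::finite \<Rightarrow> real^('m + 'n)) \<Rightarrow> ('m::finite \<Rightarrow> real^'n \<Rightarrow> real^('m + 'n)) \<Rightarrow>
   (real^'n \<Rightarrow> real^'n^'m) \<Rightarrow> real^'n \<Rightarrow> real^('m + 'n)^('m + 'n)" where
  "frame_matrix j1 Y N A x = (\<chi> r c. case c of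
       Inl j \<Rightarrow> N j x $ r
     | Inr i \<Rightarrow> ((1 / A x $ j1 $ i) *\<^sub>R partial i Y x) $ r)"

end

theory Submission
  imports Defs
begin

text \<open>Let \<open>N\<^sub>1 = X, N\<^sub>2, \<dots>, N\<^sub>m\<close> be the given normal frame. Since it is parallel, all \<open>dN\<^sub>j\<close> are tangent to the
  immersion, and by the Ricci equation they commute as operators on the tangent spaces. Non-degeneracy makes
  the common eigendirections unique, so there is a smooth orthonormal frame with
  \<open>dN\<^sub>j = \<Sum>\<^sub>i \<mu>\<^sub>j\<^sub>i \<omega>\<^sub>i e\<^sub>i\<close> and \<open>\<mu>\<^sub>1\<^sub>i = 1\<close>. The Gauss equation for a flat tangent bundle says that the columns of \<open>\<mu>\<close>
  are orthogonal. Normalizing them gives \<open>A\<close> with \<open>A\<^sup>tA = 1\<close> and \<open>dN\<^sub>j = \<Sum>\<^sub>i a\<^sub>j\<^sub>i \<eta>\<^sub>i e\<^sub>i\<close>. Taking the exterior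
  derivative and contracting with \<open>A\<close> yields \<open>d\<eta>\<^sub>i = 0\<close>, and \<open>\<eta>\<^sub>i = dx\<^sub>i\<close> are the coordinates.

  In such coordinates the derivatives of \<open>N\<^sub>j\<close> and \<open>e\<^sub>i\<close> are forced by the symmetry of the second derivatives of
  the \<open>N\<^sub>j\<close> to be those prescribed by the Lax connection at \<open>\<lambda> = 1\<close>, and the \<open>G\<^bsub>m,n\<^esub>\<close>-system is the symmetry
  of the second derivatives of the \<open>e\<^sub>i\<close>. Conversely, the system makes the connection flat, and a flat linear
  system is solved on a convex set by integrating it along the rays from a base point. Flatness turns the
  comparison of neighbouring rays by Gronwall's inequality into the differentiability of the solution. The same
  theorem, applied to nilpotent coefficients, is the Poincare lemma that integrates \<open>\<eta>\<^sub>i\<close>.\<close>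

section \<open>Smooth maps\<close>

text \<open>The position vector X belongs to the family of normals, and its operator is the
  identity. Pairing with X therefore turns one symmetry, that of the second derivatives of the
  normals, into self-adjointness of each operator; for two other normals the same symmetry says that
  their operators commute. The row of ones that X contributes also keeps the columns of eigenvalues
  away from zero, so that they can be normalized.

  The obstacle is smoothness: common eigenvectors exist at every point, but need not vary smoothly
  where eigenvalues cross. Non-degeneracy makes the columns of eigenvalues pairwise distinct, so
  some combination with constant coefficients has simple spectrum at the base point, and the
  implicit function theorem continues its eigenvectors. Hence the coordinates are local.

  Sphericity is not decided by the differential equations. It is linear algebra: with r the row of A
  belonging to X, the vector obtained by subtracting A r from the corresponding unit vector is
  killed by the transpose of A, and it decides whether the shape operators inside the sphere still
  span n dimensions.\<close>

lemma D_eq: "(f has_derivative f') (at p) \<Longrightarrow> D f p u = f' u"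
  unfolding D_def by (metis frechet_derivative_at)

lemma partial_eq: "(f has_derivative f') (at p) \<Longrightarrow> partial i f p = f' (axis i 1)"
  unfolding partial_def by (rule D_eq)

lemma has_derivative_D: "f differentiable (at p) \<Longrightarrow> (f has_derivative D f p) (at p)"
  unfolding D_def by (simp add: frechet_derivative_works)

lemma linear_D: "f differentiable (at p) \<Longrightarrow> linear (D f p)"
  using has_derivative_D has_derivative_linear by blast

lemma D_partials:
  fixes f :: "real^'n::finite \<Rightarrow> 'b::real_normed_vector"
  assumes "f differentiable (at p)"
  shows "D f p u = (\<Sum>i\<in>UNIV. u $ i *\<^sub>R partial i f p)"
proof -
  interpret linear "D f p" using linear_D[OF assms] .
  have "u = (\<Sum>i\<in>UNIV. u $ i *\<^sub>R axis i 1)"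
    using basis_expansion[of u] by (simp add: scalar_mult_eq_scaleR)
  then have "D f p u = D f p (\<Sum>i\<in>UNIV. u $ i *\<^sub>R axis i 1)" by simp
  also have "\<dots> = (\<Sum>i\<in>UNIV. u $ i *\<^sub>R partial i f p)"
    by (simp add: sum scaleR partial_def)
  finally show ?thesis .
qed

text \<open>\<open>frechet_derivative\<close> chooses from the set of all derivatives at a point.
  Maps that agree near \<open>p\<close> have the same set, hence the same chosen map, so the values
  coincide even where neither map is differentiable.\<close>

lemma D_cong:
  assumes "open U" "p \<in> U" "\<And>x. x \<in> U \<Longrightarrow> f x = g x"
  shows "D f p u = D g p u"
proof -
  have "(f has_derivative f') (at p) \<longleftrightarrow> (g has_derivative f') (at p)" for f'
    using assms has_derivative_transform_within_open by metis
  then show ?thesis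
    unfolding D_def frechet_derivative_def by simp
qed

lemma partial_cong:
  assumes "open U" "p \<in> U" "\<And>x. x \<in> U \<Longrightarrow> f x = g x"
  shows "partial i f p = partial i g p"
  unfolding partial_def using assms by (rule D_cong)

lemma partial_const [simp]: "partial i (\<lambda>_. c) p = 0"
  by (rule partial_eq[where f' = "\<lambda>_. 0"]) (rule has_derivative_const)

lemma partial_linear:
  assumes "bounded_linear L" "f differentiable (at p)"
  shows "partial i (\<lambda>x. L (f x)) p = L (partial i f p)"
proof -
  have "((\<lambda>x. L (f x)) has_derivative (\<lambda>u. L (D f p u))) (at p)"
    using bounded_linear.has_derivative[OF assms(1) has_derivative_D[OF assms(2)]] .
  from partial_eq[OF this] show ?thesis by (simp add: partial_def)
qed

lemma partial_bilinear:
  assumes "bounded_bilinear B" "f differentiable (at p)" "g differentiable (at p)"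
  shows "partial i (\<lambda>x. B (f x) (g x)) p = B (f p) (partial i g p) + B (partial i f p) (g p)"
proof -
  have "((\<lambda>x. B (f x) (g x)) has_derivative (\<lambda>u. B (f p) (D g p u) + B (D f p u) (g p))) (at p)"
    using bounded_bilinear.FDERIV[OF assms(1) has_derivative_D[OF assms(2)] has_derivative_D[OF assms(3)]] .
  from partial_eq[OF this] show ?thesis by (simp add: partial_def)
qed

lemma partial_add:
  assumes "f differentiable (at p)" "g differentiable (at p)"
  shows "partial i (\<lambda>x. f x + g x) p = partial i f p + partial i g p"
proof -
  have "((\<lambda>x. f x + g x) has_derivative (\<lambda>u. D f p u + D g p u)) (at p)"
    using assms by (intro has_derivative_add has_derivative_D)
  from partial_eq[OF this] show ?thesis by (simp add: partial_def)
qed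

lemma partial_sum:
  assumes "\<And>s. s \<in> S \<Longrightarrow> f s differentiable (at p)"
  shows "partial i (\<lambda>x. \<Sum>s\<in>S. f s x) p = (\<Sum>s\<in>S. partial i (f s) p)"
proof -
  have "((\<lambda>x. \<Sum>s\<in>S. f s x) has_derivative (\<lambda>u. \<Sum>s\<in>S. D (f s) p u)) (at p)"
    using assms by (intro has_derivative_sum has_derivative_D)
  from partial_eq[OF this] show ?thesis by (simp add: partial_def)
qed

lemma partial_compose:
  fixes f :: "real^'b::finite \<Rightarrow> 'c::real_normed_vector" and \<psi> :: "real^'a::finite \<Rightarrow> real^'b"
  assumes "\<psi> differentiable (at p)" "f differentiable (at (\<psi> p))"
  shows "partial i (\<lambda>x. f (\<psi> x)) p = (\<Sum>k\<in>UNIV. (partial i \<psi> p $ k) *\<^sub>R partial k f (\<psi> p))"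
proof -
  have "((\<lambda>x. f (\<psi> x)) has_derivative (\<lambda>u. D f (\<psi> p) (D \<psi> p u))) (at p)"
    using has_derivative_compose[OF has_derivative_D[OF assms(1)] has_derivative_D[OF assms(2)]] .
  from partial_eq[OF this] have "partial i (\<lambda>x. f (\<psi> x)) p = D f (\<psi> p) (partial i \<psi> p)"
    by (simp add: partial_def)
  then show ?thesis using D_partials[OF assms(2)] by metis
qed

section \<open>Calculus of maps of finite differentiability order\<close>

lemma C_on_cong:
  assumes "open U" "C_on k U f" "\<And>x. x \<in> U \<Longrightarrow> f x = g x"
  shows "C_on k U g"
  using assms(2,3)
proof (induction k arbitrary: f g)
  case 0
  then show ?case using continuous_on_cong by fastforce
next
  case (Suc k)
  have "g differentiable (at p)" if "p \<in> U" for p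
    using Suc.prems that assms(1) unfolding C_on.simps differentiable_def
    by (metis has_derivative_transform_within_open)
  moreover have "C_on k U (partial i g)" for i
  proof (rule Suc.IH)
    show "C_on k U (partial i f)" using Suc.prems by simp
    show "partial i f x = partial i g x" if "x \<in> U" for x
      using partial_cong[OF assms(1) that] Suc.prems(2) by blast
  qed
  ultimately show ?case by simp
qed

lemma C_on_subset: "C_on k U f \<Longrightarrow> V \<subseteq> U \<Longrightarrow> C_on k V f"
  by (induction k arbitrary: f) (auto intro: continuous_on_subset)

lemma C_on_SucD: "C_on (Suc k) U f \<Longrightarrow> C_on k U f"
proof (induction k arbitrary: f)
  case 0
  then show ?case
    by (auto intro!: continuous_at_imp_continuous_on differentiable_imp_continuous_within)
next
  case (Suc k)
  then show ?case by (metis C_on.simps(2))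
qed

lemma C_on_differentiable: "C_on (Suc k) U f \<Longrightarrow> p \<in> U \<Longrightarrow> f differentiable (at p)"
  by simp

lemma C_on_partial: "C_on (Suc k) U f \<Longrightarrow> C_on k U (partial i f)"
  by simp

lemma C_on_continuous: "C_on k U f \<Longrightarrow> continuous_on U f"
  by (induction k) (auto dest: C_on_SucD simp del: C_on.simps(2))

text \<open>A formula \<open>f'\<close> for the partials is usually known only on \<open>U\<close>,
  while \<open>C_on\<close> refers to the total function \<open>partial i f\<close>, which is
  uncontrolled off \<open>U\<close>. The inductions on the order pass through this rule, where
  \<open>C_on_cong\<close> bridges the two.\<close>

lemma C_on_SucI:
  assumes "open U" "\<And>p. p \<in> U \<Longrightarrow> f differentiable (at p)"
    "\<And>i p. p \<in> U \<Longrightarrow> partial i f p = f' i p" "\<And>i. C_on k U (f' i)"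
  shows "C_on (Suc k) U f"
  using assms by (auto intro: C_on_cong[OF assms(1,4)])

lemma C_on_const: "C_on k U (\<lambda>_. c)"
proof (induction k arbitrary: c)
  case (Suc k)
  have "partial i (\<lambda>_. c) = (\<lambda>_. 0)" for i :: 'a and c :: 'b by (auto simp: fun_eq_iff)
  then show ?case using Suc by (simp add: differentiable_const)
qed simp

lemma C_on_linear:
  assumes L: "bounded_linear L" and "open U" "C_on k U f"
  shows "C_on k U (\<lambda>x. L (f x))"
  using assms(3)
proof (induction k arbitrary: f)
  case 0
  then show ?case using bounded_linear.continuous_on[OF L] by simp
next
  case (Suc k)
  show ?case
  proof (rule C_on_SucI[OF assms(2), where f' = "\<lambda>i x. L (partial i f x)"])
    fix p assume p: "p \<in> U"
    show "(\<lambda>x. L (f x)) differentiable (at p)"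
      using Suc.prems p L bounded_linear.has_derivative unfolding C_on.simps differentiable_def by blast
    show "partial i (\<lambda>x. L (f x)) p = L (partial i f p)" for i
      using Suc.prems p L by (simp add: partial_linear)
  qed (use Suc in simp)
qed

lemma C_on_add:
  assumes "open U" "C_on k U f" "C_on k U g"
  shows "C_on k U (\<lambda>x. f x + g x)"
  using assms(2,3)
proof (induction k arbitrary: f g)
  case 0
  then show ?case by (simp add: continuous_on_add)
next
  case (Suc k)
  show ?case
    by (rule C_on_SucI[OF assms(1), where f' = "\<lambda>i x. partial i f x + partial i g x"])
      (use Suc in \<open>auto simp: partial_add\<close>)
qed

lemma C_on_sum:
  assumes "open U" "\<And>s. s \<in> S \<Longrightarrow> C_on k U (f s)"
  shows "C_on k U (\<lambda>x. \<Sum>s\<in>S. f s x)"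
  using assms(2)
proof (induction S rule: infinite_finite_induct)
  case (insert s S)
  then show ?case by (simp add: C_on_add[OF assms(1)])
qed (auto simp: C_on_const)

lemma C_on_bilinear:
  assumes B: "bounded_bilinear B" and U: "open U" and "C_on k U f" "C_on k U g"
  shows "C_on k U (\<lambda>x. B (f x) (g x))"
  using assms(3,4)
proof (induction k arbitrary: f g)
  case 0
  then show ?case using bounded_bilinear.continuous_on[OF B] by simp
next
  case (Suc k)
  show ?case
  proof (rule C_on_SucI[OF U, where f' = "\<lambda>i x. B (f x) (partial i g x) + B (partial i f x) (g x)"])
    fix p assume p: "p \<in> U"
    show "(\<lambda>x. B (f x) (g x)) differentiable (at p)"
      using Suc.prems p bounded_bilinear.FDERIV[OF B] unfolding C_on.simps differentiable_def by blast
    show "partial i (\<lambda>x. B (f x) (g x)) p = B (f p) (partial i g p) + B (partial i f p) (g p)" for i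
      using Suc.prems p B by (simp add: partial_bilinear)
  next
    show "C_on k U (\<lambda>x. B (f x) (partial i g x) + B (partial i f x) (g x))" for i
      using Suc.prems by (intro C_on_add[OF U] Suc.IH) (auto dest: C_on_SucD simp del: C_on.simps(2) intro: C_on_partial)
  qed
qed

text \<open>The partials of the inverse are products of \<open>partial i f\<close> and the inverse
  itself, so order \<open>k\<close> for the inverse yields order \<open>k + 1\<close>. The same
  bootstrapping serves for square roots, inverse functions and solutions of total systems.\<close>

lemma C_on_inverse:
  fixes f :: "real^'n::finite \<Rightarrow> real"
  assumes U: "open U" and "C_on k U f" and nz: "\<And>x. x \<in> U \<Longrightarrow> f x \<noteq> 0"
  shows "C_on k U (\<lambda>x. inverse (f x))"
  using assms(2)
proof (induction k)
  case 0
  then show ?case using nz by (auto intro: continuous_on_inverse)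
next
  case (Suc k)
  show ?case
  proof (rule C_on_SucI[OF U, where f' = "\<lambda>i x. - (inverse (f x) * partial i f x * inverse (f x))"])
    fix p assume p: "p \<in> U"
    have der: "((\<lambda>x. inverse (f x)) has_derivative (\<lambda>u. - (inverse (f p) * D f p u * inverse (f p)))) (at p)"
      by (rule Deriv.has_derivative_inverse[OF nz[OF p] has_derivative_D[OF C_on_differentiable[OF Suc.prems p]]])
    then show "(\<lambda>x. inverse (f x)) differentiable (at p)" unfolding differentiable_def by blast
    show "partial i (\<lambda>x. inverse (f x)) p = - (inverse (f p) * partial i f p * inverse (f p))" for i
      using partial_eq[OF der] by (simp add: partial_def)
  next
    have "C_on k U (\<lambda>x. inverse (f x) * partial i f x * inverse (f x))" for i
      using Suc by (intro C_on_bilinear[OF bounded_bilinear_mult U] Suc.IH) (auto dest: C_on_SucD simp del: C_on.simps(2) intro: C_on_partial)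
    then show "C_on k U (\<lambda>x. - (inverse (f x) * partial i f x * inverse (f x)))" for i
      by (rule C_on_linear[OF bounded_linear_minus[OF bounded_linear_ident] U])
  qed
qed

lemma C_on_sqrt:
  fixes f :: "real^'n::finite \<Rightarrow> real"
  assumes U: "open U" and "C_on k U f" and pos: "\<And>x. x \<in> U \<Longrightarrow> f x > 0"
  shows "C_on k U (\<lambda>x. sqrt (f x))"
  using assms(2)
proof (induction k)
  case 0
  then show ?case by (auto intro: continuous_on_real_sqrt)
next
  case (Suc k)
  show ?case
  proof (rule C_on_SucI[OF U, where f' = "\<lambda>i x. (1/2) * (partial i f x * inverse (sqrt (f x)))"])
    fix p assume p: "p \<in> U"
    have der: "((\<lambda>x. sqrt (f x)) has_derivative (\<lambda>u. (1/2) * (D f p u * inverse (sqrt (f p))))) (at p)"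
      using pos[OF p] 
      by (auto intro!: derivative_eq_intros has_derivative_D[OF C_on_differentiable[OF Suc.prems p]] simp: field_simps)
    then show "(\<lambda>x. sqrt (f x)) differentiable (at p)" unfolding differentiable_def by blast
    show "partial i (\<lambda>x. sqrt (f x)) p = (1/2) * (partial i f p * inverse (sqrt (f p)))" for i
      using partial_eq[OF der] by (simp add: partial_def)
  next
    have nz: "sqrt (f x) \<noteq> 0" if "x \<in> U" for x using pos[OF that] by simp
    show "C_on k U (\<lambda>x. (1/2) * (partial i f x * inverse (sqrt (f x))))" for i
      by (intro C_on_bilinear[OF bounded_bilinear_mult U] C_on_const C_on_inverse[OF U] Suc.IH nz C_on_partial C_on_SucD[OF Suc.prems] Suc.prems)
  qed
qed

lemma bounded_linear_axis: "bounded_linear (axis i :: 'b::real_normed_vector \<Rightarrow> 'b^'n::finite)"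
proof (rule bounded_linear_intro[where K = 1])
  show "axis i (x + y) = axis i x + axis i y" for x y :: 'b by (vector axis_def)
  show "axis i (r *\<^sub>R x) = r *\<^sub>R axis i x" for r and x :: 'b by (simp add: vec_eq_iff axis_def)
  show "norm (axis i x :: 'b^'n) \<le> norm x * 1" for x
    by (simp add: norm_vec_def L2_set_def axis_def if_distrib[of norm] if_distrib[of "\<lambda>t. t\<^sup>2"] cong: if_cong)
qed

lemma C_on_vec:
  fixes f :: "real^'n::finite \<Rightarrow> 'b::real_normed_vector^'m::finite"
  assumes "open U" "\<And>i. C_on k U (\<lambda>x. f x $ i)"
  shows "C_on k U f"
proof -
  have "C_on k U (\<lambda>x. \<Sum>i\<in>UNIV. axis i (f x $ i))"
    by (intro C_on_sum C_on_linear[OF bounded_linear_axis] assms)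
  moreover have "(\<Sum>i\<in>UNIV. axis i (f x $ i)) = f x" for x
    by (simp add: vec_eq_iff axis_def if_distrib cong: if_cong)
  ultimately show ?thesis by simp
qed

lemma C_on_vec_nth:
  fixes f :: "real^'n::finite \<Rightarrow> 'b::real_normed_vector^'m::finite"
  shows "open U \<Longrightarrow> C_on k U f \<Longrightarrow> C_on k U (\<lambda>x. f x $ i)"
  by (rule C_on_linear[OF bounded_linear_vec_nth])

text \<open>The induction varies \<open>f\<close> and keeps \<open>\<psi>\<close> fixed, because the
  chain rule produces \<open>partial k f\<close> composed with the same
  \<open>\<psi>\<close>.\<close>

lemma C_on_compose:
  fixes f :: "real^'b::finite \<Rightarrow> 'c::real_normed_vector" and \<psi> :: "real^'a::finite \<Rightarrow> real^'b"
  assumes W: "open W" and "open V" and "C_on k W \<psi>" "C_on k V f" and im: "\<And>x. x \<in> W \<Longrightarrow> \<psi> x \<in> V"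
  shows "C_on k W (\<lambda>x. f (\<psi> x))"
  using assms(3,4)
proof (induction k arbitrary: f)
  case 0
  then show ?case using im continuous_on_compose2[of V f W \<psi>] by auto
next
  case (Suc k)
  show ?case
  proof (rule C_on_SucI[OF W, where f' = "\<lambda>i x. \<Sum>k\<in>UNIV. (partial i \<psi> x $ k) *\<^sub>R partial k f (\<psi> x)"])
    fix p assume p: "p \<in> W"
    have d: "\<psi> differentiable (at p)" "f differentiable (at (\<psi> p))" using Suc.prems p im by auto
    then show "(\<lambda>x. f (\<psi> x)) differentiable (at p)"
      using differentiable_chain_at[of \<psi> p f] by (simp add: o_def)
    show "partial i (\<lambda>x. f (\<psi> x)) p = (\<Sum>k\<in>UNIV. (partial i \<psi> p $ k) *\<^sub>R partial k f (\<psi> p))" for i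
      using partial_compose[OF d] .
  next
    show "C_on k W (\<lambda>x. \<Sum>k\<in>UNIV. (partial i \<psi> x $ k) *\<^sub>R partial k f (\<psi> x))" for i
      by (intro C_on_sum[OF W] C_on_bilinear[OF bounded_bilinear_scaleR W] C_on_vec_nth[OF W] Suc.IH
          C_on_partial C_on_SucD[OF Suc.prems(1)] Suc.prems)
  qed
qed

lemma C_on_ident: "C_on k U (\<lambda>x :: real^'n::finite. x)"
proof (cases k)
  case (Suc l)
  have "partial i (\<lambda>x. x) = (\<lambda>_. axis i 1)" for i :: 'n
    using partial_eq[OF has_derivative_ident] by (auto simp: fun_eq_iff)
  then show ?thesis using Suc by (simp add: C_on_const)
qed simp

section \<open>Closure properties of smooth maps\<close>

named_theorems smooth_intros

lemma smooth_on_cong: "open U \<Longrightarrow> smooth_on U f \<Longrightarrow> (\<And>x. x \<in> U \<Longrightarrow> f x = g x) \<Longrightarrow> smooth_on U g"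
  unfolding smooth_on_def using C_on_cong by blast

lemma smooth_on_subset: "smooth_on U f \<Longrightarrow> V \<subseteq> U \<Longrightarrow> smooth_on V f"
  unfolding smooth_on_def using C_on_subset by blast

lemma smooth_on_differentiable: "smooth_on U f \<Longrightarrow> p \<in> U \<Longrightarrow> f differentiable (at p)"
  unfolding smooth_on_def using C_on_differentiable by blast

lemma smooth_on_partial [smooth_intros]: "smooth_on U f \<Longrightarrow> smooth_on U (partial i f)"
  unfolding smooth_on_def using C_on_partial by blast

lemma smooth_on_continuous: "smooth_on U f \<Longrightarrow> continuous_on U f"
  unfolding smooth_on_def using C_on_continuous by blast

lemma smooth_on_const [smooth_intros]: "smooth_on U (\<lambda>_. c)"
  unfolding smooth_on_def using C_on_const by blast

lemma smooth_on_ident [smooth_intros]: "smooth_on U (\<lambda>x. x)"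
  unfolding smooth_on_def using C_on_ident by blast

lemma smooth_on_linear: "bounded_linear L \<Longrightarrow> open U \<Longrightarrow> smooth_on U f \<Longrightarrow> smooth_on U (\<lambda>x. L (f x))"
  unfolding smooth_on_def using C_on_linear[of L U _ f] by blast

lemma smooth_on_bilinear:
  "bounded_bilinear B \<Longrightarrow> open U \<Longrightarrow> smooth_on U f \<Longrightarrow> smooth_on U g \<Longrightarrow> smooth_on U (\<lambda>x. B (f x) (g x))"
  unfolding smooth_on_def using C_on_bilinear[of B U _ f g] by blast

lemma smooth_on_add [smooth_intros]:
  "open U \<Longrightarrow> smooth_on U f \<Longrightarrow> smooth_on U g \<Longrightarrow> smooth_on U (\<lambda>x. f x + g x)"
  unfolding smooth_on_def using C_on_add[of U _ f g] by blast

lemma smooth_on_minus [smooth_intros]: "open U \<Longrightarrow> smooth_on U f \<Longrightarrow> smooth_on U (\<lambda>x. - f x)"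
  by (rule smooth_on_linear[OF bounded_linear_minus[OF bounded_linear_ident]])

lemma smooth_on_diff [smooth_intros]:
  assumes "open U" "smooth_on U f" "smooth_on U g" shows "smooth_on U (\<lambda>x. f x - g x)"
  using smooth_on_add[OF assms(1,2) smooth_on_minus[OF assms(1,3)]] by simp

lemma smooth_on_sum [smooth_intros]:
  "open U \<Longrightarrow> (\<And>s. s \<in> S \<Longrightarrow> smooth_on U (f s)) \<Longrightarrow> smooth_on U (\<lambda>x. \<Sum>s\<in>S. f s x)"
  unfolding smooth_on_def using C_on_sum[of U S _ f] by blast

lemma smooth_on_inner [smooth_intros]:
  "open U \<Longrightarrow> smooth_on U f \<Longrightarrow> smooth_on U g \<Longrightarrow> smooth_on U (\<lambda>x. f x \<bullet> g x)"
  by (rule smooth_on_bilinear[OF bounded_bilinear_inner])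

lemma smooth_on_scaleR [smooth_intros]:
  "open U \<Longrightarrow> smooth_on U f \<Longrightarrow> smooth_on U g \<Longrightarrow> smooth_on U (\<lambda>x. f x *\<^sub>R g x)"
  by (rule smooth_on_bilinear[OF bounded_bilinear_scaleR])

lemma smooth_on_mult [smooth_intros]:
  fixes f g :: "real^'n::finite \<Rightarrow> real"
  shows "open U \<Longrightarrow> smooth_on U f \<Longrightarrow> smooth_on U g \<Longrightarrow> smooth_on U (\<lambda>x. f x * g x)"
  by (rule smooth_on_bilinear[OF bounded_bilinear_mult])

lemma smooth_on_inverse:
  fixes f :: "real^'n::finite \<Rightarrow> real"
  shows "open U \<Longrightarrow> smooth_on U f \<Longrightarrow> (\<And>x. x \<in> U \<Longrightarrow> f x \<noteq> 0) \<Longrightarrow> smooth_on U (\<lambda>x. inverse (f x))"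
  unfolding smooth_on_def using C_on_inverse[of U _ f] by blast

lemma smooth_on_divide:
  fixes f g :: "real^'n::finite \<Rightarrow> real"
  assumes "open U" "smooth_on U f" "smooth_on U g" "\<And>x. x \<in> U \<Longrightarrow> g x \<noteq> 0"
  shows "smooth_on U (\<lambda>x. f x / g x)"
  using smooth_on_mult[OF assms(1,2) smooth_on_inverse[OF assms(1,3,4)]] by (simp add: divide_inverse)

lemma smooth_on_sqrt:
  fixes f :: "real^'n::finite \<Rightarrow> real"
  shows "open U \<Longrightarrow> smooth_on U f \<Longrightarrow> (\<And>x. x \<in> U \<Longrightarrow> f x > 0) \<Longrightarrow> smooth_on U (\<lambda>x. sqrt (f x))"
  unfolding smooth_on_def using C_on_sqrt[of U _ f] by blast

lemma smooth_on_vec: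
  fixes f :: "real^'n::finite \<Rightarrow> 'b::real_normed_vector^'m::finite"
  shows "open U \<Longrightarrow> (\<And>i. smooth_on U (\<lambda>x. f x $ i)) \<Longrightarrow> smooth_on U f"
  unfolding smooth_on_def using C_on_vec by blast

lemma smooth_on_vec_lambda [smooth_intros]:
  fixes f :: "'m::finite \<Rightarrow> real^'n::finite \<Rightarrow> 'b::real_normed_vector"
  assumes "open U" "\<And>i. smooth_on U (\<lambda>x. f i x)"
  shows "smooth_on U (\<lambda>x. \<chi> i. f i x)"
  by (rule smooth_on_vec[OF assms(1)]) (simp add: assms)

lemma smooth_on_vec_nth [smooth_intros]:
  fixes f :: "real^'n::finite \<Rightarrow> 'b::real_normed_vector^'m::finite"
  shows "open U \<Longrightarrow> smooth_on U f \<Longrightarrow> smooth_on U (\<lambda>x. f x $ i)"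
  by (rule smooth_on_linear[OF bounded_linear_vec_nth])

lemma smooth_on_compose:
  fixes f :: "real^'b::finite \<Rightarrow> 'c::real_normed_vector" and \<psi> :: "real^'a::finite \<Rightarrow> real^'b"
  shows "open W \<Longrightarrow> open V \<Longrightarrow> smooth_on W \<psi> \<Longrightarrow> smooth_on V f \<Longrightarrow> (\<And>x. x \<in> W \<Longrightarrow> \<psi> x \<in> V)
    \<Longrightarrow> smooth_on W (\<lambda>x. f (\<psi> x))"
  unfolding smooth_on_def using C_on_compose[of W V _ \<psi> f] by blast

section \<open>Mixed partial derivatives and inverse functions\<close>

lemma line_derivative:
  fixes f :: "real^'n::finite \<Rightarrow> real"
  assumes "f differentiable (at (q + s *\<^sub>R axis i 1))"
  shows "((\<lambda>s. f (q + s *\<^sub>R axis i 1)) has_real_derivative partial i f (q + s *\<^sub>R axis i 1)) (at s)"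
proof -
  let ?p = "q + s *\<^sub>R axis i 1"
  have 1: "((\<lambda>s. q + s *\<^sub>R axis i 1) has_derivative (\<lambda>u. u *\<^sub>R axis i 1)) (at s)"
    by (auto intro!: derivative_eq_intros)
  have "((\<lambda>s. f (q + s *\<^sub>R axis i 1)) has_derivative (\<lambda>u. D f ?p (u *\<^sub>R axis i 1))) (at s)"
    using has_derivative_compose[OF 1 has_derivative_D[OF assms]] .
  moreover have "D f ?p (u *\<^sub>R axis i 1) = partial i f ?p * u" for u
    using linear_scale[OF linear_D[OF assms]] by (simp add: partial_def)
  ultimately show ?thesis by (simp add: has_field_derivative_def)
qed

text \<open>The second difference is the increment in direction \<open>i\<close> of a function that
  is itself a difference in direction \<open>j\<close>. The mean value theorem is applied to the
  former, then to \<open>partial i f\<close> in direction \<open>j\<close>. Exchanging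
  \<open>i\<close> and \<open>j\<close> leaves the second difference unchanged, which is what yields
  Schwarz's theorem.\<close>

lemma second_difference:
  fixes f :: "real^'n::finite \<Rightarrow> real"
  assumes "C_on 2 U f" and ball: "ball p e \<subseteq> U" and h: "0 < h" "2 * h < e"
  shows "\<exists>q. norm (q - p) \<le> 2 * h \<and>
    f (p + h *\<^sub>R axis i 1 + h *\<^sub>R axis j 1) - f (p + h *\<^sub>R axis i 1) - f (p + h *\<^sub>R axis j 1) + f p
      = h * h * partial j (partial i f) q"
proof -
  have d1: "f differentiable (at q)" and d2: "partial i f differentiable (at q)"
    if "norm (q - p) \<le> 2 * h" for q
    using assms(1) subsetD[OF ball, of q] that h by (auto simp: numeral_2_eq_2 dist_norm norm_minus_commute)
  have near: "norm (p + s *\<^sub>R axis i 1 + t *\<^sub>R axis j 1 - p) \<le> 2 * h"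
    if "0 \<le> s" "s \<le> h" "0 \<le> t" "t \<le> h" for s t
  proof -
    have "norm (s *\<^sub>R axis i (1::real) + t *\<^sub>R axis j 1) \<le> norm (s *\<^sub>R axis i (1::real)) + norm (t *\<^sub>R (axis j 1 :: real^'n))"
      by (rule norm_triangle_ineq)
    also have "\<dots> \<le> 2 * h" using that by (simp add: norm_axis_1)
    finally show ?thesis by (simp add: algebra_simps)
  qed
  let ?\<phi> = "\<lambda>s. f (p + s *\<^sub>R axis i 1 + h *\<^sub>R axis j 1) - f (p + s *\<^sub>R axis i 1)"
  let ?\<phi>' = "\<lambda>s. partial i f (p + s *\<^sub>R axis i 1 + h *\<^sub>R axis j 1) - partial i f (p + s *\<^sub>R axis i 1)"
  have "\<exists>z. 0 < z \<and> z < h \<and> ?\<phi> h - ?\<phi> 0 = (h - 0) * ?\<phi>' z"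
  proof (rule MVT2[OF h(1)])
    fix s assume s: "0 \<le> s" "s \<le> h"
    have eq: "p + s *\<^sub>R axis i 1 + h *\<^sub>R axis j 1 = (p + h *\<^sub>R axis j 1) + s *\<^sub>R axis i 1" for s
      by (simp add: algebra_simps)
    show "(?\<phi> has_real_derivative ?\<phi>' s) (at s)"
      unfolding eq
      by (intro DERIV_diff line_derivative d1) (use near[OF s, of h] near[OF s, of 0] h in \<open>auto simp: algebra_simps\<close>)
  qed
  then obtain z where z: "0 < z" "z < h" "?\<phi> h - ?\<phi> 0 = h * ?\<phi>' z" by auto
  let ?\<chi> = "\<lambda>t. partial i f ((p + z *\<^sub>R axis i 1) + t *\<^sub>R axis j 1)"
  have "\<exists>y. 0 < y \<and> y < h \<and> ?\<chi> h - ?\<chi> 0 = (h - 0) * partial j (partial i f) ((p + z *\<^sub>R axis i 1) + y *\<^sub>R axis j 1)"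
    by (intro MVT2[OF h(1)] line_derivative d2 near) (use z in auto)
  then obtain y where y: "0 < y" "y < h"
      "?\<chi> h - ?\<chi> 0 = h * partial j (partial i f) (p + z *\<^sub>R axis i 1 + y *\<^sub>R axis j 1)" by auto
  show ?thesis
  proof (intro exI conjI)
    show "norm (p + z *\<^sub>R axis i 1 + y *\<^sub>R axis j 1 - p) \<le> 2 * h" using near z y by simp
    have "f (p + h *\<^sub>R axis i 1 + h *\<^sub>R axis j 1) - f (p + h *\<^sub>R axis i 1) - f (p + h *\<^sub>R axis j 1) + f p = ?\<phi> h - ?\<phi> 0"
      by simp
    also have "\<dots> = h * (?\<chi> h - ?\<chi> 0)" unfolding z(3) by simp
    finally show "f (p + h *\<^sub>R axis i 1 + h *\<^sub>R axis j 1) - f (p + h *\<^sub>R axis i 1) - f (p + h *\<^sub>R axis j 1) + f p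
      = h * h * partial j (partial i f) (p + z *\<^sub>R axis i 1 + y *\<^sub>R axis j 1)"
      unfolding y(3) by simp
  qed
qed

lemma partial_commute_real:
  fixes f :: "real^'n::finite \<Rightarrow> real"
  assumes U: "open U" and f: "C_on 2 U f" and p: "p \<in> U"
  shows "partial i (partial j f) p = partial j (partial i f) p"
proof (rule ccontr)
  let ?A = "partial i (partial j f)" and ?B = "partial j (partial i f)"
  assume ne: "?A p \<noteq> ?B p"
  \<comment> \<open>Half the gap: two errors below \<open>d\<close> cannot bridge a distance of
    \<open>2 * d\<close>.\<close>
  define d where "d = dist (?A p) (?B p) / 2"
  have d: "d > 0" using ne by (simp add: d_def)
  have "continuous_on U ?A" "continuous_on U ?B" using f by (auto simp: numeral_2_eq_2)
  then have "continuous (at p) ?A" "continuous (at p) ?B"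
    using p U continuous_on_eq_continuous_at by blast+
  then obtain e1 e2 where e: "e1 > 0" "\<And>q. dist q p < e1 \<Longrightarrow> dist (?A q) (?A p) < d"
      "e2 > 0" "\<And>q. dist q p < e2 \<Longrightarrow> dist (?B q) (?B p) < d"
    using d unfolding continuous_at_eps_delta by metis
  obtain e0 where e0: "e0 > 0" "ball p e0 \<subseteq> U" using U p open_contains_ball by blast
  define h where "h = min e0 (min e1 e2) / 3"
  have h: "0 < h" "2 * h < e0" "2 * h < e1" "2 * h < e2" using e e0 by (auto simp: h_def)
  obtain q where q: "norm (q - p) \<le> 2 * h"
    "f (p + h *\<^sub>R axis i 1 + h *\<^sub>R axis j 1) - f (p + h *\<^sub>R axis i 1) - f (p + h *\<^sub>R axis j 1) + f p
      = h * h * ?B q"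
    using second_difference[OF f e0(2) h(1,2)] by blast
  obtain r where r: "norm (r - p) \<le> 2 * h"
    "f (p + h *\<^sub>R axis j 1 + h *\<^sub>R axis i 1) - f (p + h *\<^sub>R axis j 1) - f (p + h *\<^sub>R axis i 1) + f p
      = h * h * ?A r"
    using second_difference[OF f e0(2) h(1,2)] by blast
  have eq: "p + h *\<^sub>R axis j 1 + h *\<^sub>R axis i 1 = p + h *\<^sub>R axis i 1 + h *\<^sub>R axis j 1"
    by (simp only: add.assoc add.commute[of "h *\<^sub>R axis j 1"])
  have swap: "a = b" if "x - y - z + w = b" "x - z - y + w = a" for x y z w a b :: real
    using that by linarith
  have "h * h * ?A r = h * h * ?B q"
    by (rule swap[OF q(2) r(2)[unfolded eq]])
  then have AB: "?A r = ?B q" using h by simp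
  have "dist (?A r) (?A p) < d" "dist (?B q) (?B p) < d"
    using e(2,4) q(1) r(1) h by (auto simp: dist_norm)
  then have "dist (?A p) (?B p) < 2 * d"
    unfolding AB dist_real_def by arith
  then show False by (simp add: d_def)
qed

lemma partial_commute:
  fixes f :: "real^'n::finite \<Rightarrow> 'b::euclidean_space"
  assumes U: "open U" and f: "smooth_on U f" and p: "p \<in> U"
  shows "partial i (partial j f) p = partial j (partial i f) p"
proof (rule euclidean_eqI)
  fix b :: 'b
  have bl: "bounded_linear (\<lambda>v. v \<bullet> b)" by (rule bounded_linear_inner_left)
  have 1: "partial k (\<lambda>x. g x \<bullet> b) x = partial k g x \<bullet> b" if "smooth_on U g" "x \<in> U" for k g x
    using partial_linear[OF bl smooth_on_differentiable[OF that]] .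
  have 2: "partial k (partial l (\<lambda>x. f x \<bullet> b)) p = partial k (partial l f) p \<bullet> b" for k l
    using partial_cong[OF U p, of "partial l (\<lambda>x. f x \<bullet> b)" "\<lambda>x. partial l f x \<bullet> b"] 1[OF f] 1[OF smooth_on_partial[OF f] p]
    by simp
  have "C_on 2 U (\<lambda>x. f x \<bullet> b)" using smooth_on_linear[OF bl U f] unfolding smooth_on_def by blast
  from partial_commute_real[OF U this p, of i j]
  show "partial i (partial j f) p \<bullet> b = partial j (partial i f) p \<bullet> b" unfolding 2 .
qed

section \<open>Cramer's rule and the inverse function theorem\<close>

lemma C_on_prod:
  fixes f :: "'s \<Rightarrow> real^'n::finite \<Rightarrow> real"
  assumes "open U" "\<And>s. s \<in> S \<Longrightarrow> C_on k U (f s)"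
  shows "C_on k U (\<lambda>x. \<Prod>s\<in>S. f s x)"
  using assms(2)
proof (induction S rule: infinite_finite_induct)
  case (insert s S)
  then show ?case by (simp add: C_on_bilinear[OF bounded_bilinear_mult assms(1)])
qed (auto simp: C_on_const)

lemma C_on_det:
  fixes M :: "real^'n::finite \<Rightarrow> real^'k^'k::finite"
  assumes "open U" "\<And>i j. C_on k U (\<lambda>x. M x $ i $ j)"
  shows "C_on k U (\<lambda>x. det (M x))"
  unfolding det_def
  by (intro C_on_sum[OF assms(1)] C_on_bilinear[OF bounded_bilinear_mult assms(1)] C_on_const C_on_prod assms)

text \<open>By Cramer's rule \<open>y\<close> is a quotient of polynomials in the entries of
  \<open>M\<close> and \<open>b\<close>, so its regularity is inherited from the data.\<close>

lemma C_on_linear_solution: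
  fixes M :: "real^'n::finite \<Rightarrow> real^'k^'k::finite" and b y :: "real^'n \<Rightarrow> real^'k"
  assumes U: "open U" and M: "\<And>i j. C_on k U (\<lambda>x. M x $ i $ j)" and b: "\<And>i. C_on k U (\<lambda>x. b x $ i)"
    and nz: "\<And>x. x \<in> U \<Longrightarrow> det (M x) \<noteq> 0" and eq: "\<And>x. x \<in> U \<Longrightarrow> M x *v y x = b x"
  shows "C_on k U y"
proof -
  have "C_on k U (\<lambda>x. \<chi> l. det (\<chi> i j. if j = l then b x $ i else M x $ i $ j) * inverse (det (M x)))"
  proof (rule C_on_vec[OF U], simp, intro C_on_bilinear[OF bounded_bilinear_mult U] C_on_det[OF U] C_on_inverse[OF U] M nz)
    show "C_on k U (\<lambda>x. (\<chi> i j. if j = l then b x $ i else M x $ i $ j) $ i $ j)" for l i j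
      by (cases "j = l") (simp_all add: M b)
  qed
  moreover have "(\<chi> l. det (\<chi> i j. if j = l then b x $ i else M x $ i $ j) * inverse (det (M x))) = y x" if "x \<in> U" for x
    using cramer[OF nz[OF that], of "y x" "b x"] eq[OF that] by (simp add: divide_inverse)
  ultimately show ?thesis by (rule C_on_cong[OF U])
qed

text \<open>Injectivity supplies the left inverse that \<open>inverse_function_theorem\<close> asks
  for. Smoothness of the inverse is bootstrapped: \<open>partial i g\<close> solves a linear system
  whose matrix is the Jacobian of \<open>f\<close> at \<open>g y\<close>, so it is as regular as
  \<open>g\<close>.\<close>

theorem smooth_inverse_function:
  fixes f :: "real^'n::finite \<Rightarrow> real^'n"
  assumes U: "open U" and f: "smooth_on U f" and x0: "x0 \<in> U" and inj: "inj (D f x0)"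
  obtains V W g where "x0 \<in> V" "V \<subseteq> U" "diffeomorphism_on V W f g"
proof -
  define f' where "f' x = Blinfun (D f x)" for x
  have dif: "f differentiable (at x)" if "x \<in> U" for x using smooth_on_differentiable[OF f that] .
  have f': "blinfun_apply (f' x) = D f x" if "x \<in> U" for x
    unfolding f'_def using dif[OF that] has_derivative_D has_derivative_bounded_linear
    by (intro bounded_linear_Blinfun_apply) blast
  have der: "(f has_derivative blinfun_apply (f' x)) (at x)" if "x \<in> U" for x
    using f'[OF that] dif[OF that] has_derivative_D by metis
  have contf: "continuous_on U f'"
  proof (rule continuous_on_blinfun_componentwise)
    fix b :: "real^'n" assume "b \<in> Basis"
    then obtain i where b: "b = axis i 1" by (auto simp: Basis_vec_def)
    have "continuous_on U (partial i f)" using f smooth_on_partial smooth_on_continuous by blast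
    then show "continuous_on U (\<lambda>x. blinfun_apply (f' x) b)"
      using continuous_on_cong[of U U "partial i f" "\<lambda>x. blinfun_apply (f' x) b"] f' b
      by (simp add: partial_def)
  qed
  obtain l where l: "linear l" "l \<circ> D f x0 = id"
    using linear_injective_left_inverse[OF linear_D[OF dif[OF x0]] inj] by blast
  have "Blinfun l o\<^sub>L f' x0 = id_blinfun"
  proof (rule blinfun_eqI)
    fix u show "blinfun_apply (Blinfun l o\<^sub>L f' x0) u = blinfun_apply id_blinfun u"
      using l f'[OF x0] linear_conv_bounded_linear[of l]
      by (simp add: bounded_linear_Blinfun_apply pointfree_idE)
  qed
  then obtain V W g g' where V: "open V" "V \<subseteq> U" "x0 \<in> V" and W: "open W" "homeomorphism V W f g"
    and g: "\<And>y. y \<in> W \<Longrightarrow> (g has_derivative (g' y)) (at y)"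
    and g': "\<And>y. y \<in> W \<Longrightarrow> g' y = inv (blinfun_apply (f' (g y)))"
    and bij: "\<And>y. y \<in> W \<Longrightarrow> bij (blinfun_apply (f' (g y)))"
    using inverse_function_theorem[OF U der contf x0] by metis
  have gV: "g y \<in> V" if "y \<in> W" for y using W(2) that unfolding homeomorphism_def by blast
  have gU: "g y \<in> U" if "y \<in> W" for y using gV[OF that] V by blast
  define M where "M y = (\<chi> r c. partial c f (g y) $ r)" for y
  have Mv: "M y *v u = D f (g y) u" if "y \<in> W" for y u
    unfolding D_partials[OF dif[OF gU[OF that]]] M_def
    by (simp add: vec_eq_iff matrix_vector_mult_def mult.commute)
  have nz: "det (M y) \<noteq> 0" if "y \<in> W" for y
  proof -
    have "inj ((*v) (M y))"
      using bij[OF that] f'[OF gU[OF that]] Mv[OF that] unfolding bij_def by (simp add: inj_def)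
    then show ?thesis
      by (metis invertible_det_nz invertible_left_inverse matrix_left_invertible_injective)
  qed
  have "C_on k W g" for k
  proof (induction k)
    case 0
    then show ?case using W(2) unfolding homeomorphism_def by simp
  next
    case (Suc k)
    have "C_on k W (partial i g)" for i
    proof (rule C_on_linear_solution[OF W(1), where M = M and b = "\<lambda>_. axis i 1"])
      fix r c
      have "C_on k U (\<lambda>x. partial c f x $ r)"
        using C_on_vec_nth[OF U] f smooth_on_partial unfolding smooth_on_def by blast
      from C_on_compose[OF W(1) U Suc this gU]
      show "C_on k W (\<lambda>x. M x $ r $ c)" by (simp add: M_def)
    next
      fix y assume y: "y \<in> W"
      have "partial i g y = inv (D f (g y)) (axis i 1)"
        using partial_eq[OF g[OF y]] g'[OF y] f'[OF gU[OF y]] by simp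
      moreover have "D f (g y) (inv (D f (g y)) (axis i 1)) = axis i 1"
        using bij[OF y] f'[OF gU[OF y]] by (simp add: bij_def surj_f_inv_f)
      ultimately show "M y *v partial i g y = axis i 1" using Mv[OF y] by simp
    qed (simp_all add: nz C_on_const)
    then show ?case using g unfolding C_on.simps differentiable_def by blast
  qed
  then have "smooth_on W g" unfolding smooth_on_def by blast
  then have "diffeomorphism_on V W f g"
    unfolding diffeomorphism_on_def using V W smooth_on_subset[OF f] by blast
  then show ?thesis using that V by blast
qed

section \<open>Implicit functions\<close>

definition vec_join :: "real^'a \<Rightarrow> real^'b \<Rightarrow> real^('a::finite + 'b::finite)" where
  "vec_join x y = (\<chi> s. case s of Inl i \<Rightarrow> x $ i | Inr j \<Rightarrow> y $ j)"

definition vec_left :: "real^('a::finite + 'b::finite) \<Rightarrow> real^'a" where "vec_left z = (\<chi> i. z $ Inl i)"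
definition vec_right :: "real^('a::finite + 'b::finite) \<Rightarrow> real^'b" where "vec_right z = (\<chi> j. z $ Inr j)"

lemma vec_join_simps [simp]: "vec_left (vec_join x y) = x" "vec_right (vec_join x y) = y" "vec_join (vec_left z) (vec_right z) = z"
  by (auto simp: vec_left_def vec_right_def vec_join_def vec_eq_iff split: sum.split)

lemma bounded_linear_vec_left: "bounded_linear vec_left"
  unfolding linear_conv_bounded_linear[symmetric] by (auto intro!: linearI simp: vec_left_def vec_eq_iff)

lemma bounded_linear_vec_right: "bounded_linear vec_right"
  unfolding linear_conv_bounded_linear[symmetric] by (auto intro!: linearI simp: vec_right_def vec_eq_iff)

lemma bounded_linear_vec_join_0: "bounded_linear (\<lambda>x. vec_join x 0)" "bounded_linear (vec_join 0)"
  unfolding linear_conv_bounded_linear[symmetric]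
  by (auto intro!: linearI simp: vec_join_def vec_eq_iff split: sum.split)

lemma vec_join_split: "vec_join x y = vec_join x 0 + vec_join 0 y"
  by (simp add: vec_join_def vec_eq_iff split: sum.split)

lemma smooth_on_vec_join: 
  assumes "open U" "smooth_on U f" "smooth_on U g"
  shows "smooth_on U (\<lambda>x. vec_join (f x) (g x))"
proof -
  have "smooth_on U (\<lambda>x. vec_join (f x) 0 + vec_join 0 (g x))"
    by (intro smooth_on_add smooth_on_linear[OF bounded_linear_vec_join_0(1)] smooth_on_linear[OF bounded_linear_vec_join_0(2)] assms)
  then show ?thesis by (simp add: vec_join_split[symmetric])
qed

text \<open>The inverse function theorem is applied to \<open>\<Phi>\<close>, which keeps the first
  block and replaces the second by the value of \<open>F\<close>; the solution is the second block
  of the inverse on the slice where that value is 0. Pairs are encoded by \<open>vec_join\<close> in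
  one vector type because \<open>smooth_on\<close> has domains of that form.\<close>

theorem smooth_implicit_function:
  fixes F :: "real^('n::finite + 'k::finite) \<Rightarrow> real^'k"
  assumes T: "open T" and F: "smooth_on T F" and p0: "vec_join p0 y0 \<in> T" and F0: "F (vec_join p0 y0) = 0"
    and der: "((\<lambda>y. F (vec_join p0 y)) has_derivative L) (at y0)" and inj: "\<And>w. L w = 0 \<Longrightarrow> w = 0"
  obtains V y where "open V" "p0 \<in> V" "smooth_on V y" "y p0 = y0"
    "\<And>p. p \<in> V \<Longrightarrow> vec_join p (y p) \<in> T \<and> F (vec_join p (y p)) = 0"
proof -
  define \<Phi> where "\<Phi> z = vec_join (vec_left z) (F z)" for z
  have smooth: "smooth_on T \<Phi>"
    unfolding \<Phi>_def by (intro smooth_on_vec_join[OF T] F smooth_on_linear[OF bounded_linear_vec_left T] smooth_on_ident)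
  let ?z = "vec_join p0 y0"
  have dF: "(F has_derivative D F ?z) (at ?z)" by (intro has_derivative_D smooth_on_differentiable[OF F p0])
  have "((\<lambda>z. vec_join (vec_left z) 0 + vec_join 0 (F z)) has_derivative (\<lambda>u. vec_join (vec_left u) 0 + vec_join 0 (D F ?z u))) (at ?z)"
    by (intro has_derivative_add bounded_linear.has_derivative[OF bounded_linear_vec_join_0(1)]
        bounded_linear.has_derivative[OF bounded_linear_vec_join_0(2)]
        bounded_linear.has_derivative[OF bounded_linear_vec_left] has_derivative_ident dF)
  then have "(\<Phi> has_derivative (\<lambda>u. vec_join (vec_left u) (D F ?z u))) (at ?z)"
    unfolding \<Phi>_def by (simp add: vec_join_split[symmetric])
  then have D\<Phi>: "D \<Phi> ?z u = vec_join (vec_left u) (D F ?z u)" for u by (rule D_eq)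
  have dj: "(vec_join p0 has_derivative vec_join 0) (at y0)"
  proof -
    have "((\<lambda>y. vec_join p0 0 + vec_join 0 y) has_derivative (\<lambda>u. 0 + vec_join 0 u)) (at y0)"
      by (intro has_derivative_add has_derivative_const bounded_linear.has_derivative[OF bounded_linear_vec_join_0(2)] has_derivative_ident)
    then show ?thesis by (simp add: vec_join_split[symmetric])
  qed
  have L: "L w = D F ?z (vec_join 0 w)" for w
    using has_derivative_unique[OF der has_derivative_compose[OF dj dF]] by simp
  have "inj (D \<Phi> ?z)"
  proof (rule linear_injective_0[THEN iffD2, rule_format, OF linear_D[OF smooth_on_differentiable[OF smooth p0]]])
    fix u assume "D \<Phi> ?z u = 0"
    then have 0: "vec_join (vec_left u) (D F ?z u) = 0" using D\<Phi> by simp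
    have z: "vec_left 0 = 0" "vec_right 0 = 0" by (simp_all add: vec_left_def vec_right_def vec_eq_iff)
    have "vec_left u = 0" "D F ?z u = 0" using arg_cong[OF 0, of vec_left] arg_cong[OF 0, of vec_right] z by auto
    moreover have u: "u = vec_join (vec_left u) (vec_right u)" by simp
    ultimately have "vec_right u = 0" using inj L by metis
    then show "u = 0" using u \<open>vec_left u = 0\<close> by (metis vec_join_simps(3) z)
  qed
  then obtain V' W g where V': "?z \<in> V'" "V' \<subseteq> T" and dif: "diffeomorphism_on V' W \<Phi> g"
    using smooth_inverse_function[OF T smooth p0] by metis
  have W: "open W" and g: "smooth_on W g" and hom: "homeomorphism V' W \<Phi> g"
    using dif unfolding diffeomorphism_on_def by auto
  \<comment> \<open>The slice of \<open>W\<close> at value 0: the points \<open>p\<close> for which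
    \<open>vec_join p 0\<close> has a preimage under \<open>\<Phi>\<close> in
    \<open>V'\<close>.\<close>
  define V where "V = (\<lambda>p. vec_join p 0) -` W"
  have V: "open V"
    unfolding V_def using W bounded_linear_vec_join_0(1)
    by (intro open_vimage linear_continuous_on)
  have \<Phi>z: "\<Phi> ?z = vec_join p0 0" unfolding \<Phi>_def using F0 by simp
  define y where "y p = vec_right (g (vec_join p 0))" for p
  have "p0 \<in> V" using hom V'(1) \<Phi>z unfolding V_def homeomorphism_def by (metis image_eqI vimageI)
  moreover have "smooth_on V y"
    unfolding y_def
    by (intro smooth_on_linear[OF bounded_linear_vec_right V] smooth_on_compose[OF V W _ g]
        smooth_on_linear[OF bounded_linear_vec_join_0(1) V] smooth_on_ident) (simp add: V_def)
  moreover have "y p0 = y0"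
    using hom V'(1) \<Phi>z unfolding y_def homeomorphism_def by (metis vec_join_simps(2))
  moreover have "vec_join p (y p) \<in> T \<and> F (vec_join p (y p)) = 0" if "p \<in> V" for p
  proof -
    let ?q = "g (vec_join p 0)"
    have q: "?q \<in> V'" "\<Phi> ?q = vec_join p 0" using that hom unfolding V_def homeomorphism_def by auto
    have "vec_left ?q = p" "F ?q = 0" using q(2) unfolding \<Phi>_def by (metis vec_join_simps(1), metis vec_join_simps(2))
    then have "?q = vec_join p (y p)" unfolding y_def by (metis vec_join_simps(3))
    then show ?thesis using q(1) V'(2) \<open>F ?q = 0\<close> by auto
  qed
  ultimately show ?thesis using that V by blast
qed

section \<open>Linear total differential systems\<close>

text \<open>The weight \<open>exp (- K t)\<close> turns the Picard operator into a contraction on the whole interval.\<close>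

lemma linear_ode_solution:
  fixes M :: "real \<Rightarrow> 'd::euclidean_space \<Rightarrow>\<^sub>L 'd"
  assumes M: "continuous_on {0..1} M"
  obtains z where "z 0 = y0"
    "\<And>t. t \<in> {0..1} \<Longrightarrow> (z has_vector_derivative M t (z t)) (at t within {0..1})"
proof -
  obtain C where C: "C > 0" "\<And>t. t \<in> {0..1} \<Longrightarrow> norm (M t) \<le> C"
    using compact_imp_bounded[OF compact_continuous_image[OF M compact_Icc]]
    unfolding bounded_pos by (auto simp: image_iff)
  \<comment> \<open>The factor 2 makes the contraction constant \<open>C / K\<close> equal to
    1/2.\<close>
  define K where "K = 2 * C"
  have K: "K > 0" using C by (simp add: K_def)
  \<comment> \<open>The unknown is \<open>exp (- K * t)\<close> times the solution, so that the
    plain supremum norm of \<open>\<zeta>\<close> is the weighted norm of the solution.\<close>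
  define G where "G \<zeta> t = exp (- K * t) *\<^sub>R (y0 + integral {0..t} (\<lambda>s. M s (exp (K * s) *\<^sub>R \<zeta> s)))"
    for \<zeta> :: "real \<Rightarrow> 'd" and t
  have cont: "continuous_on {0..1} (\<lambda>s. M s (exp (K * s) *\<^sub>R \<zeta> s))" if "continuous_on {0..1} \<zeta>" for \<zeta>
    by (intro continuous_intros M that)
  have der: "((\<lambda>t. y0 + integral {0..t} (\<lambda>s. M s (exp (K * s) *\<^sub>R \<zeta> s))) has_vector_derivative
      M t (exp (K * t) *\<^sub>R \<zeta> t)) (at t within {0..1})" if "continuous_on {0..1} \<zeta>" "t \<in> {0..1}" for \<zeta> t
    using has_vector_derivative_add[OF has_vector_derivative_const integral_has_vector_derivative[OF cont[OF that(1)] that(2)]]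
    by simp
  have contG: "continuous_on {0..1} (G \<zeta>)" if "continuous_on {0..1} \<zeta>" for \<zeta>
    unfolding G_def
    by (intro continuous_on_scaleR continuous_on_exp continuous_on_mult continuous_on_const continuous_on_id
        continuous_on_vector_derivative[OF der[OF that]])
  \<comment> \<open>Banach's theorem is used for bounded continuous functions on the whole line, so
    the image is extended from the interval by its boundary values.\<close>
  define T where "T \<zeta> = Bcontfun (ext_cont (G (apply_bcontfun \<zeta>)) 0 1)" for \<zeta> :: "real \<Rightarrow>\<^sub>C 'd"
  have T: "apply_bcontfun (T \<zeta>) = ext_cont (G (apply_bcontfun \<zeta>)) 0 1" for \<zeta>
  proof -
    have c: "continuous_on (cbox 0 1) (G (apply_bcontfun \<zeta>))" using contG by simp
    have "bounded (range (ext_cont (G (apply_bcontfun \<zeta>)) 0 1))"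
    proof (rule bounded_subset)
      show "bounded (G (apply_bcontfun \<zeta>) ` cbox 0 1)"
        by (rule compact_imp_bounded[OF compact_continuous_image[OF c compact_cbox]])
      show "range (ext_cont (G (apply_bcontfun \<zeta>)) 0 1) \<subseteq> G (apply_bcontfun \<zeta>) ` cbox 0 1"
        using clamp_in_interval[of "0::real" 1] by (auto simp: ext_cont_def)
    qed
    then have "ext_cont (G (apply_bcontfun \<zeta>)) 0 1 \<in> bcontfun"
      using continuous_on_ext_cont[OF c] by (simp add: bcontfun_def)
    then show ?thesis unfolding T_def by (simp add: Bcontfun_inverse)
  qed
  have lip: "dist (T \<zeta>) (T \<xi>) \<le> 1/2 * dist \<zeta> \<xi>" for \<zeta> \<xi>
  proof (rule dist_bound)
    fix s :: real
    define t where "t = clamp 0 1 s"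
    have t: "t \<in> {0..1}" using clamp_in_interval[of 0 1 s] unfolding t_def by simp
    let ?d = "dist \<zeta> \<xi>"
    let ?f = "\<lambda>\<zeta> s. blinfun_apply (M s) (exp (K * s) *\<^sub>R apply_bcontfun \<zeta> s)"
    have int: "?f \<zeta> integrable_on {0..t}" for \<zeta>
      using t by (intro integrable_continuous_real continuous_on_subset[OF cont]) auto
    have int2: "((\<lambda>s. exp (K * s) * (C * ?d)) has_integral (exp (K * t) * (C * ?d) / K - exp (K * 0) * (C * ?d) / K)) {0..t}"
    proof (rule fundamental_theorem_of_calculus)
      show "((\<lambda>t. exp (K * t) * (C * ?d) / K) has_vector_derivative exp (K * x) * (C * ?d)) (at x within {0..t})" for x
        using K by (auto intro!: derivative_eq_intros simp: has_real_derivative_iff_has_vector_derivative[symmetric])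
    qed (use t in auto)
    have "norm (integral {0..t} (?f \<zeta>) - integral {0..t} (?f \<xi>)) = norm (integral {0..t} (\<lambda>s. ?f \<zeta> s - ?f \<xi> s))"
      using integral_diff[OF int int] by simp
    also have "\<dots> \<le> integral {0..t} (\<lambda>s. exp (K * s) * (C * ?d))"
    proof (rule integral_norm_bound_integral)
      fix s assume s: "s \<in> {0..t}"
      have "norm (?f \<zeta> s - ?f \<xi> s) = norm (M s (exp (K * s) *\<^sub>R (\<zeta> s - \<xi> s)))"
        by (simp add: blinfun.diff_right[symmetric] scaleR_diff_right[symmetric])
      also have "\<dots> \<le> norm (M s) * (exp (K * s) * norm (\<zeta> s - \<xi> s))"
        using norm_blinfun[of "M s" "exp (K * s) *\<^sub>R (\<zeta> s - \<xi> s)"] by simp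
      also have "\<dots> \<le> C * (exp (K * s) * ?d)"
        using C s t dist_bounded[of \<zeta> s \<xi>] by (intro mult_mono) (auto simp: dist_norm)
      finally show "norm (?f \<zeta> s - ?f \<xi> s) \<le> exp (K * s) * (C * ?d)" by (simp add: mult_ac)
    qed (use int integrable_diff[OF int int] int2 in auto)
    also have "\<dots> = (exp (K * t) - 1) * (?d / 2)"
      using integral_unique[OF int2] C by (simp add: K_def field_simps)
    also have "\<dots> \<le> exp (K * t) * (?d / 2)" by (simp add: mult_right_mono)
    finally have *: "norm (integral {0..t} (?f \<zeta>) - integral {0..t} (?f \<xi>)) \<le> exp (K * t) * (?d / 2)" .
    have "dist (T \<zeta> s) (T \<xi> s) = exp (- K * t) * norm (integral {0..t} (?f \<zeta>) - integral {0..t} (?f \<xi>))"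
      unfolding T ext_cont_def G_def t_def[symmetric] dist_norm scaleR_diff_right[symmetric] by simp
    also have "\<dots> \<le> exp (- K * t) * (exp (K * t) * (?d / 2))" using * by (intro mult_left_mono) auto
    also have "\<dots> = 1/2 * ?d" by (simp add: exp_minus)
    finally show "dist (T \<zeta> s) (T \<xi> s) \<le> 1/2 * ?d" .
  qed
  have "\<exists>!\<zeta>. T \<zeta> = \<zeta>" by (rule banach_fix_type[of "1/2"]) (use lip in auto)
  then obtain \<zeta> where \<zeta>: "T \<zeta> = \<zeta>" by blast
  define z where "z t = y0 + integral {0..t} (\<lambda>s. M s (exp (K * s) *\<^sub>R \<zeta> s))" for t
  have z: "exp (K * t) *\<^sub>R \<zeta> t = z t" if "t \<in> {0..1}" for t
  proof -
    have "\<zeta> t = G (apply_bcontfun \<zeta>) t" using arg_cong[OF \<zeta>, of "\<lambda>f. apply_bcontfun f t"] that unfolding T by simp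
    then have "\<zeta> t = exp (- K * t) *\<^sub>R z t" unfolding G_def z_def .
    then show ?thesis by (simp add: exp_minus)
  qed
  show ?thesis
  proof
    show "z 0 = y0" by (simp add: z_def)
    show "(z has_vector_derivative M t (z t)) (at t within {0..1})" if t: "t \<in> {0..1}" for t
      using der[of "apply_bcontfun \<zeta>" t] t z[OF t] unfolding z_def by simp
  qed
qed

text \<open>Adding \<open>e\<^sup>2\<close> to the squared norm of \<open>r\<close> lets the mixed
  term be absorbed, since twice \<open>r \<bullet> \<epsilon>\<close> is at most the squared norm
  plus \<open>e\<^sup>2\<close>. The sum then grows at most at the rate \<open>2 * C + 1\<close>. It
  starts at \<open>e\<^sup>2\<close>, and the square root halves the exponent.\<close>

lemma gronwall_bound:
  fixes M :: "real \<Rightarrow> 'd::euclidean_space \<Rightarrow>\<^sub>L 'd" and r :: "real \<Rightarrow> 'd"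
  assumes r: "\<And>t. t \<in> {0..1} \<Longrightarrow> (r has_vector_derivative M t (r t) + \<epsilon> t) (at t within {0..1})"
    and M: "\<And>t. t \<in> {0..1} \<Longrightarrow> norm (M t) \<le> C" and e: "\<And>t. t \<in> {0..1} \<Longrightarrow> norm (\<epsilon> t) \<le> e"
    and r0: "r 0 = 0"
  shows "norm (r 1) \<le> e * exp (C + 1/2)"
proof -
  define f where "f t = (r t \<bullet> r t + e\<^sup>2) * exp (- (2 * C + 1) * t)" for t
  have e0: "e \<ge> 0" using order_trans[OF norm_ge_zero e[of 0]] by simp
  have "f 0 \<ge> f 1"
  proof (rule DERIV_nonpos_imp_decreasing_open[where f = f])
    fix t :: real assume t: "0 < t" "t < 1"
    then have t': "t \<in> {0..1}" by simp
    have r': "(r has_derivative (\<lambda>h. h *\<^sub>R (M t (r t) + \<epsilon> t))) (at t)"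
      using r[OF t'] t at_within_interior[of t "{0..1}"] unfolding has_vector_derivative_def by simp
    let ?d = "(2 * (r t \<bullet> (M t (r t) + \<epsilon> t)) - (2 * C + 1) * (r t \<bullet> r t + e\<^sup>2)) * exp (- (2 * C + 1) * t)"
    have "(f has_real_derivative ?d) (at t)"
      unfolding f_def has_field_derivative_def
      by (rule derivative_eq_intros r' refl | simp add: fun_eq_iff inner_commute algebra_simps)+
    moreover have "?d \<le> 0"
    proof (rule mult_nonpos_nonneg)
      have "r t \<bullet> M t (r t) \<le> norm (r t) * norm (M t (r t))" by (rule norm_cauchy_schwarz)
      also have "\<dots> \<le> norm (r t) * (norm (M t) * norm (r t))"
        by (intro mult_left_mono norm_blinfun) auto
      also have "\<dots> \<le> norm (r t) * (C * norm (r t))"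
        using M[OF t'] by (intro mult_left_mono mult_right_mono) auto
      finally have 1: "r t \<bullet> M t (r t) \<le> C * (r t \<bullet> r t)" by (simp add: dot_square_norm power2_eq_square mult_ac)
      have "0 \<le> (r t - \<epsilon> t) \<bullet> (r t - \<epsilon> t)" by simp
      then have "2 * (r t \<bullet> \<epsilon> t) \<le> r t \<bullet> r t + \<epsilon> t \<bullet> \<epsilon> t"
        by (simp add: inner_diff inner_commute algebra_simps del: inner_ge_zero)
      also have "\<epsilon> t \<bullet> \<epsilon> t \<le> e\<^sup>2" using e[OF t'] by (simp add: dot_square_norm power_mono)
      finally have 2: "2 * (r t \<bullet> \<epsilon> t) \<le> r t \<bullet> r t + e\<^sup>2" by simp
      have "C \<ge> 0" using M[OF t'] norm_ge_zero[of "M t"] by linarith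
      then have "C * e\<^sup>2 \<ge> 0" by simp
      with 1 2 show "2 * (r t \<bullet> (M t (r t) + \<epsilon> t)) - (2 * C + 1) * (r t \<bullet> r t + e\<^sup>2) \<le> 0"
        by (simp add: inner_add_right algebra_simps)
    qed simp
    ultimately show "\<exists>y. (f has_real_derivative y) (at t) \<and> y \<le> 0" by blast
  next
    have "continuous_on {0..1} r" using r by (rule continuous_on_vector_derivative)
    then show "continuous_on {0..1} f"
      unfolding f_def by (intro continuous_intros)
  qed simp
  then have "(norm (r 1))\<^sup>2 + e\<^sup>2 \<le> e\<^sup>2 * exp (2 * C + 1)"
    unfolding f_def by (simp add: r0 dot_square_norm exp_diff exp_minus exp_add field_simps)
  also have "exp (2 * C + 1) = (exp (C + 1/2))\<^sup>2"
    by (simp add: power2_eq_square exp_add[symmetric])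
  finally have "(norm (r 1))\<^sup>2 + e\<^sup>2 \<le> (e * exp (C + 1/2))\<^sup>2"
    by (simp only: power_mult_distrib)
  moreover have "(norm (r 1))\<^sup>2 \<le> (norm (r 1))\<^sup>2 + e\<^sup>2" by simp
  ultimately have "(norm (r 1))\<^sup>2 \<le> (e * exp (C + 1/2))\<^sup>2" by (rule order_trans[rotated])
  then show ?thesis by (rule power2_le_imp_le) (use e0 in simp)
qed

text \<open>Uniformity in \<open>q\<close> comes from uniform continuity of the partials on a
  compact set. It is required because the comparison of two rays uses the linearization at all
  points of a ray with a single \<delta>.\<close>

lemma uniform_linearization:
  fixes f :: "real^'n::finite \<Rightarrow> 'b::real_normed_vector"
  assumes U: "open U" and f: "smooth_on U f" and K: "compact K" "K \<subseteq> U" and e: "e > 0"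
  obtains \<delta> where "\<delta> > 0" "\<And>q k. q \<in> K \<Longrightarrow> norm k < \<delta> \<Longrightarrow> q + k \<in> U \<and> norm (f (q + k) - f q - D f q k) \<le> e * norm k"
proof -
  obtain \<rho> where \<rho>: "\<rho> > 0" "(\<Union>x\<in>K. cball x \<rho>) \<subseteq> U"
    using compact_subset_open_imp_cball_epsilon_subset[OF K(1) U K(2)] by blast
  \<comment> \<open>This compact enlargement contains every segment from \<open>q\<close> to
    \<open>q + k\<close> with \<open>norm k < \<rho>\<close>, and it still lies in
    \<open>U\<close>.\<close>
  define K' where "K' = {x + y | x y. x \<in> K \<and> y \<in> cball 0 \<rho>}"
  have K': "compact K'" unfolding K'_def using compact_sums[OF K(1) compact_cball] .
  have K'U: "K' \<subseteq> U" using \<rho>(2) unfolding K'_def by (force simp: dist_norm)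
  define N where "N = real CARD('n)"
  have N: "N > 0" by (simp add: N_def)
  have "\<exists>d>0. \<forall>x\<in>K'. \<forall>y\<in>K'. dist y x < d \<longrightarrow> dist (partial i f y) (partial i f x) < e / N" for i
  proof -
    have "continuous_on K' (partial i f)"
      using smooth_on_continuous[OF smooth_on_partial[OF f]] K'U continuous_on_subset by blast
    then have "uniformly_continuous_on K' (partial i f)" using K' by (rule compact_uniformly_continuous)
    then show ?thesis using e N unfolding uniformly_continuous_on_def by simp
  qed
  then obtain d where d: "\<And>i. d i > 0"
    "\<And>i x y. x \<in> K' \<Longrightarrow> y \<in> K' \<Longrightarrow> dist y x < d i \<Longrightarrow> dist (partial i f y) (partial i f x) < e / N"
    by metis
  define \<delta> where "\<delta> = min \<rho> (Min (range d))"
  have \<delta>: "\<delta> > 0" "\<delta> \<le> \<rho>" "\<delta> \<le> d i" for i using \<rho> d(1) by (auto simp: \<delta>_def min.coboundedI2)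
  show ?thesis
  proof
    show "\<delta> > 0" by fact
    fix q k :: "real^'n" assume q: "q \<in> K" and k: "norm k < \<delta>"
    have dif: "f differentiable (at x)" if "x \<in> K'" for x
      using smooth_on_differentiable[OF f] that K'U by blast
    let ?S = "cball q (norm k)"
    have S: "?S \<subseteq> K'"
    proof
      fix y assume "y \<in> ?S"
      then have "y = q + (y - q)" "y - q \<in> cball 0 \<rho>" using k \<delta> by (auto simp: dist_norm norm_minus_commute)
      then show "y \<in> K'" unfolding K'_def using q by blast
    qed
    have "norm (f (q + k) - f q - D f q (q + k - q)) \<le> norm (q + k - q) * e"
    proof (rule differentiable_bound_linearization)
      show "q + t *\<^sub>R (q + k - q) \<in> ?S" if "t \<in> {0..1}" for t :: real
        using that by (auto simp: dist_norm mult_left_le_one_le)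
      show "(f has_derivative D f x) (at x within ?S)" if "x \<in> ?S" for x
        using has_derivative_D[OF dif] S that has_derivative_at_withinI by blast
      show "q \<in> ?S" by simp
      fix y assume y: "y \<in> ?S"
      have yK: "y \<in> K'" "q \<in> K'" using S y by auto
      show "onorm (D f y - D f q) \<le> e"
      proof (rule onorm_le)
        fix u
        have "norm ((D f y - D f q) u) = norm (\<Sum>i\<in>UNIV. u $ i *\<^sub>R (partial i f y - partial i f q))"
          using D_partials[OF dif] yK by (simp add: scaleR_diff_right sum_subtractf)
        also have "\<dots> \<le> (\<Sum>i\<in>(UNIV::'n set). norm u * (e / N))"
        proof (rule sum_norm_le)
          fix i
          have "dist y q < d i" using y k \<delta>(3)[of i] by (simp add: dist_commute)
          then have "norm (partial i f y - partial i f q) \<le> e / N"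
            using d(2)[of q y i] yK by (simp add: dist_norm)
          then show "norm (u $ i *\<^sub>R (partial i f y - partial i f q)) \<le> norm u * (e / N)"
            using component_le_norm_cart[of u i] unfolding norm_scaleR by (intro mult_mono) auto
        qed
        also have "\<dots> = e * norm u" using N by (simp add: N_def)
        finally show "norm ((D f y - D f q) u) \<le> e * norm u" .
      qed
    qed
    moreover have "q + k \<in> K'" using S by (rule subsetD) (simp add: dist_norm)
    ultimately show "q + k \<in> U \<and> norm (f (q + k) - f q - D f q k) \<le> e * norm k"
      using K'U by (auto simp: mult.commute)
  qed
qed

lemma D_norm_le:
  fixes f :: "real^'n::finite \<Rightarrow> 'b::real_normed_vector"
  assumes "f differentiable (at p)" "\<And>i. norm (partial i f p) \<le> P"
  shows "norm (D f p u) \<le> real CARD('n) * P * norm u"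
proof -
  have "norm (D f p u) \<le> (\<Sum>i\<in>(UNIV::'n set). norm u * P)"
    unfolding D_partials[OF assms(1)] norm_scaleR
    by (intro sum_norm_le) (auto intro!: mult_mono assms(2) component_le_norm_cart)
  then show ?thesis by (simp add: mult_ac)
qed

text \<open>For a solution, differentiating \<open>L j y\<close> in direction \<open>i\<close> gives
  the left side of \<open>flat\<close> applied to \<open>y\<close>, so \<open>flat\<close> is the
  symmetry of second derivatives freed of \<open>y\<close>. Convexity keeps the rays from
  \<open>x0\<close> inside the set. Once \<open>y\<close> is known to be differentiable with the
  right partials, the equation raises its order of regularity step by step.\<close>

theorem linear_total_system:
  fixes L :: "'n::finite \<Rightarrow> real^'n \<Rightarrow> 'd::euclidean_space \<Rightarrow>\<^sub>L 'd"
  assumes \<Omega>: "open \<Omega>" and conv: "convex \<Omega>" and x0: "x0 \<in> \<Omega>" and L: "\<And>i. smooth_on \<Omega> (L i)"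
    and flat: "\<And>x i j. x \<in> \<Omega> \<Longrightarrow>
      partial i (L j) x + (L j x o\<^sub>L L i x) = partial j (L i) x + (L i x o\<^sub>L L j x)"
  obtains y where "smooth_on \<Omega> y" "y x0 = y0" "\<And>x i. x \<in> \<Omega> \<Longrightarrow> partial i y x = L i x (y x)"
proof -
  \<comment> \<open>\<open>M y u\<close> is the value of the connection form at \<open>y\<close> on
    the vector \<open>u\<close>; \<open>M1 y u w\<close> is the derivative of the form in direction
    \<open>u\<close>, evaluated on \<open>w\<close>.\<close>
  define M where "M y u = (\<Sum>i\<in>UNIV. u $ i *\<^sub>R L i y)" for y and u :: "real^'n"
  define M1 where "M1 y u w = (\<Sum>i\<in>UNIV. w $ i *\<^sub>R D (L i) y u)" for y and u w :: "real^'n"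
  define N where "N = real CARD('n)"
  have N: "N > 0" by (simp add: N_def)
  have half_cancel: "e / (2 * a) * a = e / 2" if "a > 0" for e a :: real using that by simp
  have dL: "L i differentiable (at x)" if "x \<in> \<Omega>" for i x
    using smooth_on_differentiable[OF L that] .
  have M_add: "M y (u + w) = M y u + M y w" for y u w
    by (simp add: M_def scaleR_add_left sum.distrib)
  have normsum: "norm (\<Sum>i\<in>UNIV. u $ i *\<^sub>R B i) \<le> N * norm u * c"
    if "\<And>i. norm (B i) \<le> c" for B :: "'n \<Rightarrow> 'd \<Rightarrow>\<^sub>L 'd" and c and u :: "real^'n"
  proof -
    have "norm (\<Sum>i\<in>UNIV. u $ i *\<^sub>R B i) \<le> (\<Sum>i\<in>(UNIV::'n set). norm u * c)"
      unfolding norm_scaleR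
      by (intro sum_norm_le) (auto intro!: mult_mono that component_le_norm_cart)
    then show ?thesis by (simp add: N_def)
  qed
  \<comment> \<open>Flatness for arbitrary vectors in place of coordinate directions, by bilinear
    expansion.\<close>
  have curv: "M1 x u w + (M x w o\<^sub>L M x u) = M1 x w u + (M x u o\<^sub>L M x w)" if x: "x \<in> \<Omega>" for x u w
  proof -
    have comp: "M x w o\<^sub>L M x u = (\<Sum>i\<in>UNIV. \<Sum>j\<in>UNIV. (u $ i * w $ j) *\<^sub>R (L j x o\<^sub>L L i x))" for u w
      unfolding M_def bounded_bilinear.sum_left[OF bounded_bilinear_blinfun_compose]
        bounded_bilinear.sum_right[OF bounded_bilinear_blinfun_compose]
        bounded_bilinear.scaleR_left[OF bounded_bilinear_blinfun_compose]
        bounded_bilinear.scaleR_right[OF bounded_bilinear_blinfun_compose]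
      by (simp add: scaleR_sum_right)
    have M1: "M1 x u w = (\<Sum>i\<in>UNIV. \<Sum>j\<in>UNIV. (u $ i * w $ j) *\<^sub>R partial i (L j) x)" for u w
      unfolding M1_def D_partials[OF dL[OF x]] scaleR_sum_right
      by (subst sum.swap) (simp add: mult.commute)
    have "M1 x u w + (M x w o\<^sub>L M x u)
        = (\<Sum>i\<in>UNIV. \<Sum>j\<in>UNIV. (u $ i * w $ j) *\<^sub>R (partial i (L j) x + (L j x o\<^sub>L L i x)))"
      unfolding M1 comp by (simp add: sum.distrib scaleR_add_right)
    also have "\<dots> = (\<Sum>i\<in>UNIV. \<Sum>j\<in>UNIV. (u $ i * w $ j) *\<^sub>R (partial j (L i) x + (L i x o\<^sub>L L j x)))"
      using flat[OF x] by (intro sum.cong) auto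
    also have "\<dots> = (\<Sum>j\<in>UNIV. \<Sum>i\<in>UNIV. (w $ j * u $ i) *\<^sub>R (partial j (L i) x + (L i x o\<^sub>L L j x)))"
      by (subst sum.swap) (simp add: mult.commute)
    also have "\<dots> = M1 x w u + (M x u o\<^sub>L M x w)"
      unfolding M1 comp by (simp add: sum.distrib scaleR_add_right)
    finally show ?thesis .
  qed
  have ray: "x0 + t *\<^sub>R (x - x0) \<in> \<Omega>" if "x \<in> \<Omega>" "t \<in> {0..1}" for x t
  proof -
    have "(1 - t) *\<^sub>R x0 + t *\<^sub>R x \<in> \<Omega>" using conv x0 that unfolding convex_alt by auto
    then show ?thesis by (simp add: algebra_simps)
  qed
  have "\<exists>z. z 0 = y0 \<and> (\<forall>t\<in>{0..1}. (z has_vector_derivative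
      M (x0 + t *\<^sub>R (x - x0)) (x - x0) (z t)) (at t within {0..1}))" if x: "x \<in> \<Omega>" for x
  proof -
    have "continuous_on {0..1} (\<lambda>t. M (x0 + t *\<^sub>R (x - x0)) (x - x0))"
      unfolding M_def
    proof (intro continuous_intros continuous_on_compose2[OF smooth_on_continuous[OF L]])
      show "(\<lambda>t. x0 + t *\<^sub>R (x - x0)) ` {0..1} \<subseteq> \<Omega>" using ray[OF x] by auto
    qed
    from linear_ode_solution[OF this] show ?thesis by metis
  qed
  then obtain Z where Z0: "\<And>x. x \<in> \<Omega> \<Longrightarrow> Z x 0 = y0"
    and Z: "\<And>x t. x \<in> \<Omega> \<Longrightarrow> t \<in> {0..1} \<Longrightarrow> (Z x has_vector_derivative
      M (x0 + t *\<^sub>R (x - x0)) (x - x0) (Z x t)) (at t within {0..1})"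
    by metis
  define y where "y x = Z x 1" for x
  have der: "(y has_derivative (\<lambda>h. M x h (y x))) (at x)" if x: "x \<in> \<Omega>" for x
  proof -
    define v where "v = x - x0"
    define \<gamma> where "\<gamma> t = x0 + t *\<^sub>R v" for t
    define K where "K = \<gamma> ` {0..1}"
    have "continuous_on {0..1} \<gamma>" unfolding \<gamma>_def by (intro continuous_intros)
    then have K: "compact K" unfolding K_def by (intro compact_continuous_image compact_Icc)
    have K\<Omega>: "K \<subseteq> \<Omega>" unfolding K_def \<gamma>_def v_def using ray[OF x] by auto
    have \<gamma>K: "\<gamma> t \<in> K" if "t \<in> {0..1}" for t using that by (auto simp: K_def)
    define z where "z = Z x"
    have z: "(z has_vector_derivative M (\<gamma> t) v (z t)) (at t within {0..1})" if "t \<in> {0..1}" for t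
      using Z[OF x that] unfolding z_def \<gamma>_def v_def .
    have bdd: "\<exists>B. B \<ge> 0 \<and> (\<forall>q\<in>K. norm (g q) \<le> B)" if "continuous_on \<Omega> g" for g :: "real^'n \<Rightarrow> 'd \<Rightarrow>\<^sub>L 'd"
      using compact_imp_bounded[OF compact_continuous_image[OF continuous_on_subset[OF that K\<Omega>] K]]
      unfolding bounded_pos by (metis image_eqI less_eq_real_def)
    obtain B where B: "B > 0" "\<And>t. t \<in> {0..1} \<Longrightarrow> norm (z t) \<le> B"
      using compact_imp_bounded[OF compact_continuous_image[OF continuous_on_vector_derivative[OF z] compact_Icc]]
      unfolding bounded_pos by (auto simp: image_iff)
    obtain b where b: "\<And>i. b i \<ge> 0" "\<And>i q. q \<in> K \<Longrightarrow> norm (L i q) \<le> b i"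
      using bdd[OF smooth_on_continuous[OF L]] by metis
    have "\<forall>i j. \<exists>B. B \<ge> 0 \<and> (\<forall>q\<in>K. norm (partial j (L i) q) \<le> B)"
      using bdd[OF smooth_on_continuous[OF smooth_on_partial[OF L]]] by blast
    then obtain b1 where b1: "\<And>i j. b1 i j \<ge> 0" "\<And>i j q. q \<in> K \<Longrightarrow> norm (partial j (L i) q) \<le> b1 i j"
      by metis
    define C0 where "C0 = (\<Sum>i\<in>UNIV. b i)"
    define C1 where "C1 = N * (\<Sum>i\<in>UNIV. \<Sum>j\<in>UNIV. b1 i j)"
    \<comment> \<open>\<open>C\<close> serves both as a bound of the coefficients on neighbouring
      rays and as a Lipschitz constant; the summand 1 is the linearization error taken with
      \<epsilon> = 1.\<close>
    define C where "C = C0 + (1 + C1)"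
    have pos: "C0 \<ge> 0" "C1 \<ge> 0" "C \<ge> 1"
      using b(1) b1(1) N by (auto simp: C0_def C1_def C_def intro!: sum_nonneg mult_nonneg_nonneg add_nonneg_nonneg)
    have L0: "norm (L i q) \<le> C0" if "q \<in> K" for i q
      using b(2)[OF that, of i] member_le_sum[of i UNIV b] b(1) unfolding C0_def by fastforce
    have DL: "norm (D (L i) q u) \<le> C1 * norm u" if q: "q \<in> K" for i q u
    proof -
      have le: "norm (partial j (L i) q) \<le> (\<Sum>i\<in>UNIV. \<Sum>j\<in>UNIV. b1 i j)" for j
      proof -
        have "norm (partial j (L i) q) \<le> b1 i j" using b1(2)[OF q] .
        also have "\<dots> \<le> (\<Sum>j\<in>UNIV. b1 i j)" using b1(1) by (intro member_le_sum) auto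
        also have "\<dots> \<le> (\<Sum>i\<in>UNIV. \<Sum>j\<in>UNIV. b1 i j)"
          using b1(1) by (intro member_le_sum[of i UNIV "\<lambda>i. \<Sum>j\<in>UNIV. b1 i j"]) (auto intro: sum_nonneg)
        finally show ?thesis .
      qed
      show ?thesis using D_norm_le[OF dL le] q K\<Omega> unfolding C1_def N_def by blast
    qed
    have unif: "\<exists>\<delta>>0. \<forall>q\<in>K. \<forall>k i. norm k < \<delta> \<longrightarrow>
        q + k \<in> \<Omega> \<and> norm (L i (q + k) - L i q - D (L i) q k) \<le> \<epsilon> * norm k" if "\<epsilon> > 0" for \<epsilon>
    proof -
      have "\<exists>\<delta>>0. \<forall>q\<in>K. \<forall>k. norm k < \<delta> \<longrightarrow>
        q + k \<in> \<Omega> \<and> norm (L i (q + k) - L i q - D (L i) q k) \<le> \<epsilon> * norm k" for i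
        using uniform_linearization[OF \<Omega> L K K\<Omega> \<open>\<epsilon> > 0\<close>, of i] by metis
      then obtain \<delta> where \<delta>: "\<And>i. \<delta> i > 0" "\<And>i q k. q \<in> K \<Longrightarrow> norm k < \<delta> i \<Longrightarrow>
        q + k \<in> \<Omega> \<and> norm (L i (q + k) - L i q - D (L i) q k) \<le> \<epsilon> * norm k" by metis
      have "Min (range \<delta>) > 0" using \<delta>(1) by simp
      moreover have "Min (range \<delta>) \<le> \<delta> i" for i by simp
      ultimately show ?thesis using \<delta>(2) by (meson less_le_trans)
    qed
    obtain \<delta>1 where \<delta>1: "\<delta>1 > 0" "\<And>q k i. q \<in> K \<Longrightarrow> norm k < \<delta>1 \<Longrightarrow>
        q + k \<in> \<Omega> \<and> norm (L i (q + k) - L i q - D (L i) q k) \<le> 1 * norm k"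
      using unif[of 1] by auto
    have Ldiff: "norm (L i (q + k) - L i q) \<le> C * norm k" if "q \<in> K" "norm k < \<delta>1" for i q k
    proof -
      have "norm (L i (q + k) - L i q) \<le> norm (L i (q + k) - L i q - D (L i) q k) + norm (D (L i) q k)"
        using norm_triangle_ineq[of "L i (q + k) - L i q - D (L i) q k" "D (L i) q k"] by simp
      also have "\<dots> \<le> 1 * norm k + C1 * norm k" using \<delta>1(2)[OF that, of i] DL[OF that(1)] by (intro add_mono) auto
      also have "\<dots> \<le> C * norm k" using pos by (simp add: C_def distrib_right mult_right_mono)
      finally show ?thesis .
    qed
    \<comment> \<open>\<open>G\<close> is the Gronwall factor, with \<open>norm v + 1\<close>
      bounding \<open>norm (v + h)\<close>. The constant \<open>c1\<close> goes with the
      linearization error, \<open>c2\<close> with the terms quadratic in \<open>h\<close>.\<close>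
    define G where "G = exp (N * (norm v + 1) * C + 1/2)"
    define c1 where "c1 = N * norm v * B"
    define c2 where "c2 = (N * norm v * C) * (N * C * B) + N * C * B + (N * C) * (N * C * B)"
    have c: "c1 \<ge> 0" "c2 \<ge> 0" "G > 0" using N B pos by (auto simp: c1_def c2_def G_def)
    have key: "norm (y (x + h) - y x - M x h (y x)) \<le> norm h * (\<epsilon> * c1 + norm h * c2) * G"
      if \<epsilon>: "\<epsilon> > 0" and h: "norm h < \<delta>1" "norm h < 1"
        and lin: "\<And>q k i. q \<in> K \<Longrightarrow> norm k \<le> norm h \<Longrightarrow> norm (L i (q + k) - L i q - D (L i) q k) \<le> \<epsilon> * norm k"
      for \<epsilon> h
    proof -
      have xK: "x \<in> K" using \<gamma>K[of 1] by (simp add: \<gamma>_def v_def)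
      have xh: "x + h \<in> \<Omega>" using \<delta>1(2)[OF xK h(1)] by simp
      define P where "P t = M (\<gamma> t + t *\<^sub>R h)" for t
      \<comment> \<open>Flatness makes \<open>t M\<^sub>h z\<close> a solution of the variational equation along the ray, so that \<open>q\<close> solves the
        equation along the neighbouring ray up to an error of order \<open>o(h)\<close>.\<close>
      define q where "q t = z t + t *\<^sub>R M (\<gamma> t) h (z t)" for t
      define q' where "q' t = M (\<gamma> t) v (z t) + M (\<gamma> t) h (z t)
          + t *\<^sub>R (M1 (\<gamma> t) h v (z t) + M (\<gamma> t) v (M (\<gamma> t) h (z t)))" for t
      have q': "(q has_vector_derivative q' t) (at t within {0..1})" if t: "t \<in> {0..1}" for t
      proof -
        have d\<gamma>: "(\<gamma> has_derivative (\<lambda>s. s *\<^sub>R v)) (at t within {0..1})"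
          unfolding \<gamma>_def by (auto intro!: derivative_eq_intros)
        have \<gamma>\<Omega>: "\<gamma> t \<in> \<Omega>" using \<gamma>K[OF t] K\<Omega> by blast
        have "((\<lambda>t. L i (\<gamma> t)) has_derivative (\<lambda>s. D (L i) (\<gamma> t) (s *\<^sub>R v))) (at t within {0..1})" for i
          using has_derivative_compose[OF d\<gamma> has_derivative_D[OF dL[OF \<gamma>\<Omega>]]] .
        then have "((\<lambda>t. M (\<gamma> t) h) has_derivative (\<lambda>s. \<Sum>i\<in>UNIV. h $ i *\<^sub>R D (L i) (\<gamma> t) (s *\<^sub>R v))) (at t within {0..1})"
          unfolding M_def by (intro has_derivative_sum has_derivative_scaleR_right)
        moreover have "(\<Sum>i\<in>UNIV. h $ i *\<^sub>R D (L i) (\<gamma> t) (s *\<^sub>R v)) = s *\<^sub>R M1 (\<gamma> t) v h" for s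
          unfolding M1_def using linear_scale[OF linear_D[OF dL[OF \<gamma>\<Omega>]]] by (simp add: scaleR_sum_right mult.commute)
        ultimately have dM: "((\<lambda>t. M (\<gamma> t) h) has_derivative (\<lambda>s. s *\<^sub>R M1 (\<gamma> t) v h)) (at t within {0..1})"
          by simp
        have dz: "(z has_derivative (\<lambda>s. s *\<^sub>R M (\<gamma> t) v (z t))) (at t within {0..1})"
          using z[OF t] unfolding has_vector_derivative_def .
        have "((\<lambda>t. M (\<gamma> t) h (z t)) has_derivative (\<lambda>s. M (\<gamma> t) h (s *\<^sub>R M (\<gamma> t) v (z t)) + (s *\<^sub>R M1 (\<gamma> t) v h) (z t))) (at t within {0..1})"
          using bounded_bilinear.FDERIV[OF bounded_bilinear_blinfun_apply dM dz] .
        then have "((\<lambda>t. M (\<gamma> t) h (z t)) has_vector_derivative (M (\<gamma> t) h (M (\<gamma> t) v (z t)) + M1 (\<gamma> t) v h (z t))) (at t within {0..1})"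
          unfolding has_vector_derivative_def by (simp add: blinfun.scaleR_right blinfun.scaleR_left scaleR_add_right)
        moreover have "M (\<gamma> t) h (M (\<gamma> t) v (z t)) + M1 (\<gamma> t) v h (z t) = M1 (\<gamma> t) h v (z t) + M (\<gamma> t) v (M (\<gamma> t) h (z t))"
          using arg_cong[OF curv[OF \<gamma>\<Omega>, of v h], of "\<lambda>A. blinfun_apply A (z t)"]
          by (simp add: blinfun.add_left add.commute)
        ultimately have dMz: "((\<lambda>t. M (\<gamma> t) h (z t)) has_vector_derivative (M1 (\<gamma> t) h v (z t) + M (\<gamma> t) v (M (\<gamma> t) h (z t)))) (at t within {0..1})"
          by simp
        have "((\<lambda>t. t *\<^sub>R M (\<gamma> t) h (z t)) has_vector_derivative
            (t *\<^sub>R (M1 (\<gamma> t) h v (z t) + M (\<gamma> t) v (M (\<gamma> t) h (z t))) + 1 *\<^sub>R M (\<gamma> t) h (z t))) (at t within {0..1})"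
          by (rule has_vector_derivative_scaleR[OF _ dMz]) (rule DERIV_ident)
        from has_vector_derivative_add[OF z[OF t] this] show ?thesis
          unfolding q_def[abs_def] q'_def by (simp add: algebra_simps)
      qed
      define r where "r t = Z (x + h) t - q t" for t
      define err where "err t = P t (v + h) (q t) - q' t" for t
      have near: "norm (t *\<^sub>R h) \<le> norm h" if "t \<in> {0..1}" for t
        using that by (simp add: mult_left_le_one_le)
      have dr: "(r has_vector_derivative P t (v + h) (r t) + err t) (at t within {0..1})" if t: "t \<in> {0..1}" for t
      proof -
        have eqs: "x0 + t *\<^sub>R (x + h - x0) = \<gamma> t + t *\<^sub>R h" "x + h - x0 = v + h"
          by (simp_all add: \<gamma>_def v_def algebra_simps)
        have "(Z (x + h) has_vector_derivative P t (v + h) (Z (x + h) t)) (at t within {0..1})"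
          using Z[OF xh t] unfolding P_def eqs(1) unfolding eqs(2) .
        from has_vector_derivative_diff[OF this q'[OF t]] show ?thesis
          unfolding r_def[abs_def] err_def by (simp add: blinfun.diff_right)
      qed
      have PL: "norm (L i (\<gamma> t + t *\<^sub>R h)) \<le> C" if t: "t \<in> {0..1}" for i t
      proof -
        have "norm (L i (\<gamma> t + t *\<^sub>R h)) \<le> norm (L i (\<gamma> t + t *\<^sub>R h) - L i (\<gamma> t) - D (L i) (\<gamma> t) (t *\<^sub>R h))
            + norm (D (L i) (\<gamma> t) (t *\<^sub>R h)) + norm (L i (\<gamma> t))"
          using norm_triangle_ineq[of "L i (\<gamma> t + t *\<^sub>R h) - L i (\<gamma> t)" "L i (\<gamma> t)"]
            norm_triangle_ineq[of "L i (\<gamma> t + t *\<^sub>R h) - L i (\<gamma> t) - D (L i) (\<gamma> t) (t *\<^sub>R h)" "D (L i) (\<gamma> t) (t *\<^sub>R h)"]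
          by simp
        also have "\<dots> \<le> 1 * norm (t *\<^sub>R h) + C1 * norm (t *\<^sub>R h) + C0"
          using \<delta>1(2)[OF \<gamma>K[OF t], of "t *\<^sub>R h" i] near[OF t] h DL[OF \<gamma>K[OF t], of i "t *\<^sub>R h"] L0[OF \<gamma>K[OF t], of i]
          by linarith
        also have "\<dots> \<le> 1 * 1 + C1 * 1 + C0"
          using near[OF t] h pos by (intro add_mono mult_left_mono) auto
        finally show ?thesis by (simp add: C_def)
      qed
      have PM: "norm (P t u) \<le> N * norm u * C" if "t \<in> {0..1}" for t u
        unfolding P_def M_def using PL[OF that] by (rule normsum)
      have MM: "norm (M (\<gamma> t) u) \<le> N * norm u * C" if t: "t \<in> {0..1}" for t u
        unfolding M_def
      proof (rule normsum)
        show "norm (L i (\<gamma> t)) \<le> C" for i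
          using L0[OF \<gamma>K[OF t], of i] pos by (simp add: C_def)
      qed
      have PMd: "norm (P t u - M (\<gamma> t) u) \<le> N * norm u * (C * norm h)" if t: "t \<in> {0..1}" for t u
      proof -
        have "P t u - M (\<gamma> t) u = (\<Sum>i\<in>UNIV. u $ i *\<^sub>R (L i (\<gamma> t + t *\<^sub>R h) - L i (\<gamma> t)))"
          unfolding P_def M_def by (simp add: scaleR_diff_right sum_subtractf)
        also have "norm \<dots> \<le> N * norm u * (C * norm h)"
        proof (rule normsum)
          show "norm (L i (\<gamma> t + t *\<^sub>R h) - L i (\<gamma> t)) \<le> C * norm h" for i
            using Ldiff[OF \<gamma>K[OF t], of "t *\<^sub>R h" i] near[OF t] h(1) pos
            by (meson dual_order.trans le_less_trans mult_left_mono zero_le_one)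
        qed
        finally show ?thesis .
      qed
      have PMd2: "norm (P t v - M (\<gamma> t) v - t *\<^sub>R M1 (\<gamma> t) h v) \<le> N * norm v * (\<epsilon> * norm h)" if t: "t \<in> {0..1}" for t
      proof -
        have "D (L i) (\<gamma> t) (t *\<^sub>R h) = t *\<^sub>R D (L i) (\<gamma> t) h" for i
          using linear_scale[OF linear_D[OF dL]] \<gamma>K[OF t] K\<Omega> by blast
        then have "P t v - M (\<gamma> t) v - t *\<^sub>R M1 (\<gamma> t) h v
            = (\<Sum>i\<in>UNIV. v $ i *\<^sub>R (L i (\<gamma> t + t *\<^sub>R h) - L i (\<gamma> t) - D (L i) (\<gamma> t) (t *\<^sub>R h)))"
          unfolding P_def M_def M1_def by (simp add: scaleR_diff_right sum_subtractf scaleR_sum_right mult.commute)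
        also have "norm \<dots> \<le> N * norm v * (\<epsilon> * norm h)"
        proof (rule normsum)
          show "norm (L i (\<gamma> t + t *\<^sub>R h) - L i (\<gamma> t) - D (L i) (\<gamma> t) (t *\<^sub>R h)) \<le> \<epsilon> * norm h" for i
            using lin[OF \<gamma>K[OF t] near[OF t], of i] near[OF t] \<epsilon>
            by (meson dual_order.trans mult_left_mono less_imp_le)
        qed
        finally show ?thesis .
      qed
      have bnd: "norm (blinfun_apply A w) \<le> a * c" if "norm A \<le> a" "norm w \<le> c" "0 \<le> a" for A :: "'d \<Rightarrow>\<^sub>L 'd" and w a c
        using norm_blinfun[of A w] mult_mono[OF that(1,2,3) norm_ge_zero] by linarith
      have err: "norm (err t) \<le> norm h * (\<epsilon> * c1 + norm h * c2)" if t: "t \<in> {0..1}" for t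
      proof -
        let ?z = "z t" and ?w = "M (\<gamma> t) h (z t)"
        have nw: "norm ?w \<le> N * norm h * C * B"
          using MM[OF t, of h] B(2)[OF t] N pos by (intro bnd) auto
        \<comment> \<open>The first term is a linearization remainder; each of the other three is of
          second order in \<open>h\<close>.\<close>
        have eq: "err t = (P t v - M (\<gamma> t) v - t *\<^sub>R M1 (\<gamma> t) h v) ?z + t *\<^sub>R (P t v - M (\<gamma> t) v) ?w
            + (P t h - M (\<gamma> t) h) ?z + t *\<^sub>R P t h ?w"
          unfolding err_def q_def q'_def P_def M_add
          by (simp add: blinfun.add_left blinfun.add_right blinfun.diff_left blinfun.scaleR_left blinfun.scaleR_right algebra_simps)
        have t1: "norm (t *\<^sub>R a) \<le> norm a" for a :: 'd
          using t by (simp add: mult_left_le_one_le)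
        have 1: "norm ((P t v - M (\<gamma> t) v - t *\<^sub>R M1 (\<gamma> t) h v) ?z) \<le> N * norm v * (\<epsilon> * norm h) * B"
          using PMd2[OF t] B(2)[OF t] N \<epsilon> by (intro bnd) auto
        have 2: "norm (t *\<^sub>R (P t v - M (\<gamma> t) v) ?w) \<le> N * norm v * (C * norm h) * (N * norm h * C * B)"
          by (rule order_trans[OF t1 bnd[OF PMd[OF t] nw]]) (use N pos in auto)
        have 3: "norm ((P t h - M (\<gamma> t) h) ?z) \<le> N * norm h * (C * norm h) * B"
          using PMd[OF t, of h] B(2)[OF t] N pos by (intro bnd) auto
        have 4: "norm (t *\<^sub>R P t h ?w) \<le> N * norm h * C * (N * norm h * C * B)"
          by (rule order_trans[OF t1 bnd[OF PM[OF t] nw]]) (use N pos in auto)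
        have "norm (err t) \<le> N * norm v * (\<epsilon> * norm h) * B + N * norm v * (C * norm h) * (N * norm h * C * B)
            + N * norm h * (C * norm h) * B + N * norm h * C * (N * norm h * C * B)"
          unfolding eq by (intro norm_triangle_mono 1 2 3 4)
        also have "\<dots> = norm h * (\<epsilon> * c1 + norm h * c2)"
          unfolding c1_def c2_def by (simp add: algebra_simps)
        finally show ?thesis .
      qed
      have "norm (r 1) \<le> norm h * (\<epsilon> * c1 + norm h * c2) * exp (N * (norm v + 1) * C + 1/2)"
      proof (rule gronwall_bound[OF dr _ err])
        show "norm (P t (v + h)) \<le> N * (norm v + 1) * C" if "t \<in> {0..1}" for t
        proof -
          have "norm (P t (v + h)) \<le> N * norm (v + h) * C" using PM[OF that] .
          also have "\<dots> \<le> N * (norm v + 1) * C"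
            using norm_triangle_ineq[of v h] h N pos by (intro mult_right_mono mult_left_mono) auto
          finally show ?thesis .
        qed
        show "r 0 = 0" unfolding r_def q_def z_def using Z0[OF x] Z0[OF xh] by simp
      qed
      moreover have "r 1 = y (x + h) - y x - M x h (y x)"
        unfolding r_def q_def y_def z_def by (simp add: \<gamma>_def v_def)
      ultimately show ?thesis unfolding G_def by simp
    qed
    have blin: "bounded_linear (\<lambda>h. M x h (y x))"
      unfolding linear_conv_bounded_linear[symmetric]
      by (rule linearI) (simp_all add: M_def scaleR_add_left sum.distrib blinfun.add_left blinfun.scaleR_left
          blinfun.sum_left scaleR_sum_right)
    show ?thesis
      unfolding has_derivative_at_alt
    proof (intro conjI blin allI impI)
      fix e :: real assume e: "e > 0"
      \<comment> \<open>Each of the two error terms receives \<open>e / 2\<close>; the summand 1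
        keeps the denominator positive when \<open>c1\<close> is 0.\<close>
      define \<epsilon> where "\<epsilon> = e / (2 * (c1 * G + 1))"
      have \<epsilon>: "\<epsilon> > 0" using e c by (simp add: \<epsilon>_def add_nonneg_pos)
      obtain \<delta>2 where \<delta>2: "\<delta>2 > 0" "\<And>q k i. q \<in> K \<Longrightarrow> norm k < \<delta>2 \<Longrightarrow>
          norm (L i (q + k) - L i q - D (L i) q k) \<le> \<epsilon> * norm k"
        using unif[OF \<epsilon>] by blast
      define \<delta> where "\<delta> = min (min \<delta>1 1) (min \<delta>2 (e / (2 * (c2 * G + 1))))"
      have \<delta>: "\<delta> > 0" using \<delta>1(1) \<delta>2(1) e c by (simp add: \<delta>_def add_nonneg_pos)
      show "\<exists>d>0. \<forall>x'. norm (x' - x) < d \<longrightarrow> norm (y x' - y x - M x (x' - x) (y x)) \<le> e * norm (x' - x)"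
      proof (intro exI conjI allI impI)
        show "\<delta> > 0" by fact
        fix x' assume "norm (x' - x) < \<delta>"
        then have h: "norm (x' - x) < \<delta>1" "norm (x' - x) < 1" "norm (x' - x) < \<delta>2" "norm (x' - x) < e / (2 * (c2 * G + 1))"
          by (auto simp: \<delta>_def)
        have "norm (y (x + (x' - x)) - y x - M x (x' - x) (y x))
            \<le> norm (x' - x) * (\<epsilon> * c1 + norm (x' - x) * c2) * G"
          using h(3) \<delta>2(2) by (intro key[OF \<epsilon> h(1,2)]) auto
        also have "\<dots> = norm (x' - x) * (\<epsilon> * (c1 * G) + norm (x' - x) * (c2 * G))" by (simp add: algebra_simps)
        also have "\<dots> \<le> norm (x' - x) * (e / 2 + e / 2)"
        proof (intro mult_left_mono add_mono)
          have "\<epsilon> * (c1 * G) \<le> \<epsilon> * (c1 * G + 1)" using \<epsilon> by simp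
          also have "\<dots> = e / 2"
            unfolding \<epsilon>_def using c by (intro half_cancel add_nonneg_pos) auto
          finally show "\<epsilon> * (c1 * G) \<le> e / 2" .
          have p: "c2 * G + 1 > 0" using add_nonneg_pos[of "c2 * G" 1] c by simp
          have "norm (x' - x) * (c2 * G) \<le> norm (x' - x) * (c2 * G + 1)" by (simp add: mult_left_mono)
          also have "\<dots> \<le> e / (2 * (c2 * G + 1)) * (c2 * G + 1)" using h(4) p by (intro mult_right_mono) auto
          also have "\<dots> = e / 2" using p by (rule half_cancel)
          finally show "norm (x' - x) * (c2 * G) \<le> e / 2" .
        qed simp
        finally show "norm (y x' - y x - M x (x' - x) (y x)) \<le> e * norm (x' - x)" by (simp add: mult.commute)
      qed
    qed
  qed
  have part: "partial i y x = L i x (y x)" if "x \<in> \<Omega>" for i x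
  proof -
    have "M x (axis i 1) = (\<Sum>k\<in>UNIV. if k = i then L i x else 0)"
      unfolding M_def by (intro sum.cong) (auto simp: axis_def)
    then show ?thesis using partial_eq[OF der[OF that], of i] by simp
  qed
  have diff: "y differentiable (at x)" if "x \<in> \<Omega>" for x
    using der[OF that] unfolding differentiable_def by blast
  have "C_on k \<Omega> y" for k
  proof (induction k)
    case 0
    then show ?case using diff by (auto intro!: continuous_at_imp_continuous_on differentiable_imp_continuous_within)
  next
    case (Suc k)
    show ?case
    proof (rule C_on_SucI[OF \<Omega> diff part])
      show "C_on k \<Omega> (\<lambda>x. L i x (y x))" for i
        using L unfolding smooth_on_def by (intro C_on_bilinear[OF bounded_bilinear_blinfun_apply \<Omega>] Suc) auto
    qed
  qed
  then have "smooth_on \<Omega> y" unfolding smooth_on_def by blast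
  moreover have "y x0 = y0"
  proof -
    have "(Z x0 has_vector_derivative 0) (at t within {0..1})" if "t \<in> {0..1}" for t
      using Z[OF x0 that] by (simp add: M_def)
    then have "Z x0 1 = Z x0 0"
      using has_vector_derivative_zero_constant[of "{0..1::real}" "Z x0"] by (metis atLeastAtMost_iff convex_real_interval(5) order_refl zero_le_one)
    then show ?thesis using Z0[OF x0] by (simp add: y_def)
  qed
  ultimately show ?thesis using that part by blast
qed

section \<open>Simultaneous diagonalization\<close>

text \<open>A maximizer \<open>x\<close> of the quadratic form on the unit sphere of
  \<open>W\<close> is an eigenvector: moving along the defect \<open>y = L x - c *\<^sub>R x\<close>
  would raise the Rayleigh quotient to first order unless \<open>y = 0\<close>.\<close>

lemma self_adjoint_eigenvector:
  fixes L :: "'d::euclidean_space \<Rightarrow> 'd"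
  assumes W: "subspace W" "W \<noteq> {0}" and L: "linear L" and inv: "\<And>x. x \<in> W \<Longrightarrow> L x \<in> W"
    and sym: "\<And>x y. x \<in> W \<Longrightarrow> y \<in> W \<Longrightarrow> L x \<bullet> y = x \<bullet> L y"
  obtains x c where "x \<in> W" "norm x = 1" "L x = c *\<^sub>R x"
proof -
  interpret L: linear L by fact
  have "0 \<in> W" using W(1) by (rule subspace_0)
  then obtain w where w: "w \<in> W" "w \<noteq> 0" using W(2) by blast
  let ?S = "W \<inter> sphere 0 1"
  have "compact ?S" using closed_subspace[OF W(1)] by (simp add: closed_Int_compact)
  have "w /\<^sub>R norm w \<in> ?S" using w subspace_scale[OF W(1)] by simp
  then have "?S \<noteq> {}" by blast
  have "continuous_on ?S (\<lambda>x. L x \<bullet> x)"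
    by (intro continuous_intros linear_continuous_on) (use L linear_conv_bounded_linear in blast)
  then obtain x where x: "x \<in> ?S" "\<And>y. y \<in> ?S \<Longrightarrow> L y \<bullet> y \<le> L x \<bullet> x"
    using continuous_attains_sup[OF \<open>compact ?S\<close> \<open>?S \<noteq> {}\<close>] by blast
  define c where "c = L x \<bullet> x"
  have xW: "x \<in> W" and nx: "norm x = 1" using x(1) by auto
  have max: "L y \<bullet> y \<le> c * (y \<bullet> y)" if y: "y \<in> W" for y
  proof (cases "y = 0")
    case False
    have "L (y /\<^sub>R norm y) \<bullet> (y /\<^sub>R norm y) \<le> c"
      unfolding c_def using y False subspace_scale[OF W(1)] by (intro x(2)) simp
    then have "(L y \<bullet> y) / (norm y)\<^sup>2 \<le> c" by (simp add: L.scaleR divide_simps power2_eq_square)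
    then show ?thesis using False by (simp add: divide_le_eq dot_square_norm)
  qed (simp add: L.zero)
  define y where "y = L x - c *\<^sub>R x"
  have yW: "y \<in> W" unfolding y_def using xW inv W(1) by (intro subspace_diff subspace_scale) auto
  have quad: "2 * t * (y \<bullet> y) \<le> t\<^sup>2 * (c * (y \<bullet> y) - L y \<bullet> y)" for t
  proof -
    have "x + t *\<^sub>R y \<in> W" using xW yW W(1) by (intro subspace_add subspace_scale) auto
    from max[OF this] have "L x \<bullet> x + 2 * t * (L x \<bullet> y) + t\<^sup>2 * (L y \<bullet> y)
        \<le> c * (1 + 2 * t * (x \<bullet> y) + t\<^sup>2 * (y \<bullet> y))"
      using sym[OF xW yW] dot_square_norm[of x] nx
      by (simp add: L.add L.scaleR inner_add inner_commute power2_eq_square algebra_simps)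
    then have "2 * t * (L x \<bullet> y - c * (x \<bullet> y)) \<le> t\<^sup>2 * (c * (y \<bullet> y) - L y \<bullet> y)"
      unfolding c_def[symmetric] by (simp add: algebra_simps)
    moreover have "L x \<bullet> y - c * (x \<bullet> y) = y \<bullet> y"
      by (simp add: y_def inner_diff_left)
    ultimately show ?thesis by simp
  qed
  have "y \<bullet> y = 0"
  proof (rule ccontr)
    assume "y \<bullet> y \<noteq> 0"
    then have pos: "y \<bullet> y > 0" by simp
    define k where "k = c * (y \<bullet> y) - L y \<bullet> y"
    \<comment> \<open>So small that the quadratic term of \<open>quad\<close> is at most half of the
      linear one.\<close>
    define t where "t = (y \<bullet> y) / (\<bar>k\<bar> + 1)"
    have t: "t > 0" using pos by (simp add: t_def)
    have "t * k \<le> t * (\<bar>k\<bar> + 1)" using t by (intro mult_left_mono) auto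
    also have "\<dots> = y \<bullet> y" by (simp add: t_def)
    finally have "t * k \<le> y \<bullet> y" .
    moreover have "t * (2 * (y \<bullet> y)) \<le> t * (t * k)"
      using quad[of t] by (simp add: k_def power2_eq_square algebra_simps)
    then have "2 * (y \<bullet> y) \<le> t * k" using t by simp
    ultimately show False using pos by linarith
  qed
  then have "L x = c *\<^sub>R x" by (simp add: y_def)
  then show ?thesis using that xW nx by blast
qed

text \<open>Induction on the dimension: an operator that is not scalar on \<open>W\<close> has a
  proper eigenspace, which all the others preserve because they commute with it. If every operator
  is scalar on \<open>W\<close>, any unit vector will do.\<close>

lemma common_eigenvector:
  fixes L :: "'j \<Rightarrow> 'd::euclidean_space \<Rightarrow> 'd"
  assumes "subspace W" "W \<noteq> {0}" and lin: "\<And>j. linear (L j)"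
    and "\<And>j x. x \<in> W \<Longrightarrow> L j x \<in> W"
    and "\<And>j x y. x \<in> W \<Longrightarrow> y \<in> W \<Longrightarrow> L j x \<bullet> y = x \<bullet> L j y"
    and "\<And>j k x. x \<in> W \<Longrightarrow> L j (L k x) = L k (L j x)"
  shows "\<exists>x\<in>W. norm x = 1 \<and> (\<forall>j. \<exists>c. L j x = c *\<^sub>R x)"
  using assms(1,2,4,5,6)
proof (induction "dim W" arbitrary: W rule: less_induct)
  case less
  show ?case
  proof (cases "\<exists>j x c. x \<in> W \<and> norm x = 1 \<and> L j x = c *\<^sub>R x \<and> (\<exists>w\<in>W. L j w \<noteq> c *\<^sub>R w)")
    case True
    then obtain j x c where x: "x \<in> W" "norm x = 1" "L j x = c *\<^sub>R x" and ex: "\<exists>w\<in>W. L j w \<noteq> c *\<^sub>R w"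
      by blast
    define E where "E = {w \<in> W. L j w = c *\<^sub>R w}"
    have sub: "subspace E"
      unfolding E_def subspace_def using less.prems(1) lin[of j]
      by (auto simp: subspace_0 subspace_add subspace_scale linear_0 linear_add linear_scale scaleR_add_right)
    have psub: "E \<subset> W" using ex by (auto simp: E_def)
    have "dim E < dim W"
      using psub sub less.prems(1) by (simp add: dim_psubset span_eq_iff[THEN iffD2])
    moreover have "x \<in> E" "x \<noteq> 0" using x unfolding E_def by auto
    then have "E \<noteq> {0}" by blast
    moreover have "L k w \<in> E" if "w \<in> E" for k w
      using that less.prems(3) less.prems(5)[of w j k] linear_scale[OF lin[of k], of c w] by (simp add: E_def)
    ultimately have "\<exists>x\<in>E. norm x = 1 \<and> (\<forall>j. \<exists>c. L j x = c *\<^sub>R x)"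
      using less.prems psub sub by (intro less.hyps) (auto simp: E_def)
    then show ?thesis using psub by blast
  next
    case False
    have scalar: "\<exists>c. \<forall>w\<in>W. L j w = c *\<^sub>R w" for j
      using self_adjoint_eigenvector[OF less.prems(1,2) lin[of j]] less.prems(3,4) False by metis
    obtain x where "x \<in> W" "norm x = 1"
      using self_adjoint_eigenvector[OF less.prems(1,2) lin] less.prems(3,4) by metis
    then show ?thesis using scalar by metis
  qed
qed

text \<open>A common eigenvector is split off; its orthogonal complement in \<open>W\<close> is
  invariant because the operators are self-adjoint.\<close>

lemma common_eigenbasis:
  fixes L :: "'j \<Rightarrow> 'd::euclidean_space \<Rightarrow> 'd"
  assumes "subspace W" and lin: "\<And>j. linear (L j)"
    and "\<And>j x. x \<in> W \<Longrightarrow> L j x \<in> W"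
    and "\<And>j x y. x \<in> W \<Longrightarrow> y \<in> W \<Longrightarrow> L j x \<bullet> y = x \<bullet> L j y"
    and "\<And>j k x. x \<in> W \<Longrightarrow> L j (L k x) = L k (L j x)"
  shows "\<exists>B. finite B \<and> pairwise orthogonal B \<and> span B = W \<and>
    (\<forall>b\<in>B. norm b = 1 \<and> (\<forall>j. \<exists>c. L j b = c *\<^sub>R b))"
  using assms(1,3,4,5)
proof (induction "dim W" arbitrary: W rule: less_induct)
  case less
  show ?case
  proof (cases "W = {0}")
    case True
    then show ?thesis by (intro exI[of _ "{}"]) auto
  next
    case False
    obtain v where v: "v \<in> W" "norm v = 1" "\<forall>j. \<exists>c. L j v = c *\<^sub>R v"
      using common_eigenvector[of W L, OF less.prems(1) False lin less.prems(2,3,4)] by blast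
    have vv: "v \<bullet> v = 1" using v(2) by (simp add: dot_square_norm)
    define E where "E = {w \<in> W. w \<bullet> v = 0}"
    have sub: "subspace E"
      unfolding E_def subspace_def using less.prems(1)
      by (auto simp: subspace_0 subspace_add subspace_scale inner_add_left)
    have "v \<notin> E" using vv by (simp add: E_def)
    moreover have "E \<subseteq> W" by (auto simp: E_def)
    ultimately have psub: "E \<subset> W" using v(1) by blast
    have "dim E < dim W"
      using psub sub less.prems(1) by (simp add: dim_psubset span_eq_iff[THEN iffD2])
    moreover have "L k w \<in> E" if w: "w \<in> E" for k w
    proof -
      obtain c where "L k v = c *\<^sub>R v" using v(3) by blast
      then have "L k w \<bullet> v = 0" using w less.prems(3)[of w v k] v(1) by (simp add: E_def)
      then show ?thesis using w less.prems(2) by (simp add: E_def)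
    qed
    ultimately have "\<exists>B. finite B \<and> pairwise orthogonal B \<and> span B = E \<and>
        (\<forall>b\<in>B. norm b = 1 \<and> (\<forall>j. \<exists>c. L j b = c *\<^sub>R b))"
      using less.prems psub sub by (intro less.hyps) (auto simp: E_def)
    then obtain B where B: "finite B" "pairwise orthogonal B" "span B = E"
      "\<forall>b\<in>B. norm b = 1 \<and> (\<forall>j. \<exists>c. L j b = c *\<^sub>R b)" by blast
    have BE: "B \<subseteq> E" using B(3) span_superset by blast
    have "span (insert v B) = W"
    proof
      show "span (insert v B) \<subseteq> W"
        using v(1) BE psub less.prems(1) by (intro span_minimal) auto
      show "W \<subseteq> span (insert v B)"
      proof
        fix w assume w: "w \<in> W"
        have "w - (w \<bullet> v) *\<^sub>R v \<in> E"
          using w v vv less.prems(1) by (auto simp: E_def inner_diff_left intro: subspace_diff subspace_scale)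
        then show "w \<in> span (insert v B)" unfolding span_insert B(3) by blast
      qed
    qed
    moreover have "pairwise orthogonal (insert v B)"
      using B(2) BE by (auto simp: pairwise_insert E_def orthogonal_def inner_commute)
    ultimately show ?thesis using B v by (intro exI[of _ "insert v B"]) auto
  qed
qed

lemma simultaneous_diagonalization:
  fixes L :: "'j \<Rightarrow> 'd::euclidean_space \<Rightarrow> 'd"
  assumes W: "subspace W" and lin: "\<And>j. linear (L j)" and dim: "dim W = CARD('n)"
    and inv: "\<And>j x. x \<in> W \<Longrightarrow> L j x \<in> W"
    and sym: "\<And>j x y. x \<in> W \<Longrightarrow> y \<in> W \<Longrightarrow> L j x \<bullet> y = x \<bullet> L j y"
    and comm: "\<And>j k x. x \<in> W \<Longrightarrow> L j (L k x) = L k (L j x)"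
  obtains e :: "'n::finite \<Rightarrow> 'd" and \<mu> where "\<And>i. e i \<in> W" "\<And>i k. e i \<bullet> e k = (if i = k then 1 else 0)"
    "\<And>j i. L j (e i) = \<mu> j i *\<^sub>R e i"
proof -
  obtain B where B: "finite B" "pairwise orthogonal B" "span B = W"
    "\<forall>b\<in>B. norm b = 1 \<and> (\<forall>j. \<exists>c. L j b = c *\<^sub>R b)"
    using common_eigenbasis[OF W lin inv sym comm] by metis
  have "0 \<notin> B" using B(4) by force
  then have "independent B" using B(2) pairwise_orthogonal_independent by blast
  then have "card B = CARD('n)" using dim B(3) dim_span_eq_card_independent by metis
  then obtain e where e: "bij_betw e (UNIV :: 'n set) B"
    using finite_same_card_bij[OF finite_class.finite_UNIV B(1)] by metis
  have eB: "e i \<in> B" for i using e bij_betwE by blast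
  have ed: "e i \<bullet> e k = (if i = k then 1 else 0)" for i k
  proof (cases "i = k")
    case True
    then show ?thesis using B(4) eB[of k] by (simp add: dot_square_norm)
  next
    case False
    then have "e i \<noteq> e k" using e by (auto simp: bij_betw_def inj_def)
    then show ?thesis using B(2) eB False by (auto simp: pairwise_def orthogonal_def)
  qed
  have "\<forall>j i. \<exists>c. L j (e i) = c *\<^sub>R e i" using B(4) eB by blast
  then obtain \<mu> where "\<And>j i. L j (e i) = \<mu> j i *\<^sub>R e i" by metis
  then show ?thesis using that ed eB B(3) span_base by metis
qed

text \<open>Finitely many hyperplanes form a null set. The vectors of \<open>S\<close> will be
  columns of eigenvalues and their differences, and \<open>c\<close> the coefficients of a
  combination with simple, non-zero spectrum.\<close>

lemma avoid_hyperplanes: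
  fixes S :: "('d::euclidean_space) set"
  assumes "finite S" "0 \<notin> S"
  obtains c where "\<And>s. s \<in> S \<Longrightarrow> c \<bullet> s \<noteq> 0"
proof -
  have "negligible (\<Union>s\<in>S. {x. s \<bullet> x = 0})"
    using assms by (intro negligible_Union finite_imageI) (auto intro: negligible_hyperplane)
  then have "(\<Union>s\<in>S. {x. s \<bullet> x = 0}) \<noteq> UNIV" using non_negligible_UNIV by metis
  then obtain c where "c \<notin> (\<Union>s\<in>S. {x. s \<bullet> x = 0})" by blast
  then show ?thesis using that[of c] by (auto simp: inner_commute)
qed

section \<open>Smooth dependence of simple eigenvectors\<close>

lemma smooth_on_matrix_vector_mult [smooth_intros]:
  fixes M :: "real^'n::finite \<Rightarrow> real^'k::finite^'l::finite"
  assumes "open U" "smooth_on U M" "smooth_on U v"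
  shows "smooth_on U (\<lambda>x. M x *v v x)"
  unfolding matrix_vector_mult_def by (intro smooth_intros assms)

text \<open>The eigenvalue is eliminated: pairing \<open>B v = (v \<bullet> B v) G v\<close> with \<open>v\<close> shows that a solution with
  \<open>v \<bullet> B v \<noteq> 0\<close> is normalized, and the linearization of this equation is injective at a simple non-zero
  eigenvalue.\<close>

lemma smooth_generalized_eigenvector:
  fixes B G :: "real^'n::finite \<Rightarrow> real^'n^'n"
  assumes U: "open U" "p0 \<in> U" and B: "smooth_on U B" and G: "smooth_on U G"
    and symB: "\<And>x y. x \<bullet> (B p0 *v y) = y \<bullet> (B p0 *v x)"
    and symG: "\<And>x y. x \<bullet> (G p0 *v y) = y \<bullet> (G p0 *v x)"
    and eig: "B p0 *v v0 = c *\<^sub>R (G p0 *v v0)" and unit: "v0 \<bullet> (G p0 *v v0) = 1" and c: "c \<noteq> 0"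
    and simple: "\<And>w. B p0 *v w = c *\<^sub>R (G p0 *v w) \<Longrightarrow> \<exists>t. w = t *\<^sub>R v0"
  obtains V v where "open V" "p0 \<in> V" "V \<subseteq> U" "smooth_on V v" "v p0 = v0"
    "\<And>p. p \<in> V \<Longrightarrow> B p *v v p = (v p \<bullet> (B p *v v p)) *\<^sub>R (G p *v v p)"
    "\<And>p. p \<in> V \<Longrightarrow> v p \<bullet> (G p *v v p) = 1"
proof -
  define F :: "real^('n + 'n) \<Rightarrow> real^'n" where
    "F z = B (vec_left z) *v vec_right z - (vec_right z \<bullet> (B (vec_left z) *v vec_right z)) *\<^sub>R (G (vec_left z) *v vec_right z)" for z
  define T :: "(real^('n + 'n)) set" where "T = vec_left -` U"
  have T: "open T" unfolding T_def by (intro open_vimage U linear_continuous_on bounded_linear_vec_left)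
  have sm_left: "smooth_on T vec_left" and sm_right: "smooth_on T vec_right"
    using smooth_on_linear[OF bounded_linear_vec_left T smooth_on_ident]
      smooth_on_linear[OF bounded_linear_vec_right T smooth_on_ident] by auto
  have BT: "smooth_on T (\<lambda>z. B (vec_left z))" and GT: "smooth_on T (\<lambda>z. G (vec_left z))"
    by (intro smooth_on_compose[OF T U(1) sm_left]; simp add: B G T_def)+
  have F: "smooth_on T F" unfolding F_def by (intro smooth_intros T BT GT sm_right)
  have vB: "v0 \<bullet> (B p0 *v v0) = c" using eig unit by simp
  \<comment> \<open>The derivative in the second block at \<open>v0\<close>, by the product rule for
    the cubic term of \<open>F\<close>.\<close>
  define L where "L w = B p0 *v w - ((v0 \<bullet> (B p0 *v w) + w \<bullet> (B p0 *v v0)) *\<^sub>R (G p0 *v v0)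
      + (v0 \<bullet> (B p0 *v v0)) *\<^sub>R (G p0 *v w))" for w
  have dm: "((\<lambda>y. M *v y) has_derivative (\<lambda>w. M *v w)) (at x)" for M :: "real^'n^'n" and x
    by (rule bounded_linear_imp_has_derivative) (rule matrix_vector_mul_bounded_linear)
  have der: "((\<lambda>y. F (vec_join p0 y)) has_derivative L) (at v0)"
    unfolding F_def vec_join_simps L_def
    by (rule derivative_eq_intros dm refl | simp add: fun_eq_iff algebra_simps)+
  have inj: "w = 0" if "L w = 0" for w
  proof -
    define g where "g = w \<bullet> (G p0 *v v0)"
    have Bw: "v0 \<bullet> (B p0 *v w) = c * g" "w \<bullet> (B p0 *v v0) = c * g"
      using symB[of v0 w] eig by (simp_all add: g_def)
    \<comment> \<open>Pairing with \<open>v0\<close> isolates the component \<open>g\<close> along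
      \<open>v0\<close>: one term \<open>c * g\<close> stands against three. Once
      \<open>g = 0\<close>, the vector \<open>w\<close> is an eigenvector for \<open>c\<close>,
      hence a multiple of \<open>v0\<close>, hence zero.\<close>
    have "v0 \<bullet> L w = v0 \<bullet> (B p0 *v w) - ((v0 \<bullet> (B p0 *v w) + w \<bullet> (B p0 *v v0)) * (v0 \<bullet> (G p0 *v v0))
        + (v0 \<bullet> (B p0 *v v0)) * (v0 \<bullet> (G p0 *v w)))"
      unfolding L_def by (simp add: inner_diff_right inner_add_right)
    also have "\<dots> = - 2 * c * g" unfolding Bw unit vB symG[of v0 w] g_def[symmetric] by simp
    finally have g: "g = 0" using that c by simp
    have "B p0 *v w = c *\<^sub>R (G p0 *v w)"
      using that unfolding L_def Bw vB g by simp
    then obtain t where t: "w = t *\<^sub>R v0" using simple by blast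
    have "g = t" unfolding g_def t using unit by simp
    then show "w = 0" using g t by simp
  qed
  have "vec_join p0 v0 \<in> T" "F (vec_join p0 v0) = 0" using U(2) eig vB by (simp_all add: T_def F_def)
  from smooth_implicit_function[OF T F this der inj]
  obtain V v where V: "open V" "p0 \<in> V" "smooth_on V v" "v p0 = v0"
    and Fv: "\<And>p. p \<in> V \<Longrightarrow> vec_join p (v p) \<in> T \<and> F (vec_join p (v p)) = 0" by metis
  have VU: "V \<subseteq> U" using Fv by (auto simp: T_def)
  define h where "h p = v p \<bullet> (B p *v v p)" for p
  have h: "continuous_on V h" unfolding h_def
    by (intro smooth_on_continuous smooth_intros V smooth_on_subset[OF B VU])
  \<comment> \<open>The normalization of \<open>v\<close> results from cancelling \<open>h\<close>,
    so the zeros of \<open>h\<close> are removed; at \<open>p0\<close> its value is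
    \<open>c\<close>.\<close>
  define V' where "V' = V \<inter> h -` (- {0})"
  have "open V'" unfolding V'_def by (rule continuous_open_preimage[OF h V(1)]) auto
  moreover have "p0 \<in> V'" using V vB c by (simp add: V'_def h_def)
  moreover have eq: "B p *v v p = h p *\<^sub>R (G p *v v p)" if "p \<in> V'" for p
    using Fv[of p] that by (simp add: V'_def F_def h_def)
  moreover have "v p \<bullet> (G p *v v p) = 1" if "p \<in> V'" for p
  proof -
    have "h p = h p * (v p \<bullet> (G p *v v p))"
      using arg_cong[OF eq[OF that], of "\<lambda>x. v p \<bullet> x"] by (simp add: h_def)
    then show ?thesis using that by (simp add: V'_def)
  qed
  moreover have "smooth_on V' v" by (rule smooth_on_subset[OF V(3)]) (simp add: V'_def)
  moreover have "V' \<subseteq> U" using VU by (auto simp: V'_def)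
  ultimately show ?thesis using that V(4) unfolding h_def by metis
qed

section \<open>Moving frames\<close>

lemma partial_scaleR:
  assumes "f differentiable (at p)" "g differentiable (at p)"
  shows "partial i (\<lambda>x. f x *\<^sub>R g x) p = f p *\<^sub>R partial i g p + partial i f p *\<^sub>R g p"
  by (rule partial_bilinear[OF bounded_bilinear_scaleR assms])

lemma partial_inner:
  assumes "f differentiable (at p)" "g differentiable (at p)"
  shows "partial i (\<lambda>x. f x \<bullet> g x) p = f p \<bullet> partial i g p + partial i f p \<bullet> g p"
  by (rule partial_bilinear[OF bounded_bilinear_inner assms])

lemma partial_inner_constant:
  assumes W: "open W" "p \<in> W" and "smooth_on W f" "smooth_on W g" and const: "\<And>x. x \<in> W \<Longrightarrow> f x \<bullet> g x = c"
  shows "partial i f p \<bullet> g p = - (f p \<bullet> partial i g p)"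
proof -
  have "partial i (\<lambda>x. f x \<bullet> g x) p = 0"
    using partial_cong[OF W, of "\<lambda>x. f x \<bullet> g x" "\<lambda>_. c"] const by simp
  then show ?thesis
    unfolding partial_inner[OF smooth_on_differentiable[OF assms(3) W(2)] smooth_on_differentiable[OF assms(4) W(2)]]
    by simp
qed

text \<open>A family indexed by the coordinate type forms the columns of a square matrix, for which
  a left inverse is also a right inverse.\<close>

lemma orthonormal_expansion:
  fixes b :: "'s::finite \<Rightarrow> real^'s"
  assumes "\<And>r s. b r \<bullet> b s = (if r = s then 1 else 0)"
  shows "v = (\<Sum>s\<in>UNIV. (v \<bullet> b s) *\<^sub>R b s)"
proof -
  define Q where "Q = (\<chi> r c. b c $ r)"
  have "transpose Q ** Q = mat 1"
    using assms by (simp add: Q_def matrix_matrix_mult_def transpose_def vec_eq_iff mat_def inner_vec_def)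
  then have "Q ** transpose Q = mat 1" by (simp add: matrix_left_right_inverse)
  then have "v = Q *v (transpose Q *v v)" by (metis matrix_vector_mul_assoc matrix_vector_mul_lid)
  also have "\<dots> = (\<Sum>s\<in>UNIV. (v \<bullet> b s) *\<^sub>R b s)"
    by (simp del: transpose_matrix_vector add: vec_eq_iff Q_def matrix_vector_mult_def transpose_def inner_vec_def mult.commute)
  finally show ?thesis .
qed

definition orthonormal_pair :: "('m \<Rightarrow> 'd::real_inner) \<Rightarrow> ('n \<Rightarrow> 'd) \<Rightarrow> bool" where
  "orthonormal_pair N e \<longleftrightarrow> (\<forall>j k. N j \<bullet> N k = (if j = k then 1 else 0)) \<and>
     (\<forall>i k. e i \<bullet> e k = (if i = k then 1 else 0)) \<and> (\<forall>j i. N j \<bullet> e i = 0)"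

lemma sum_UNIV_Plus:
  fixes f :: "'m::finite + 'n::finite \<Rightarrow> 'b::comm_monoid_add"
  shows "(\<Sum>s\<in>UNIV. f s) = (\<Sum>j\<in>UNIV. f (Inl j)) + (\<Sum>i\<in>UNIV. f (Inr i))"
  using sum.Plus[of "UNIV :: 'm set" "UNIV :: 'n set" f] by (simp add: o_def)

lemma orthonormal_pair_expansion:
  fixes N :: "'m::finite \<Rightarrow> real^('m + 'n::finite)" and e :: "'n \<Rightarrow> real^('m + 'n)"
  assumes "orthonormal_pair N e"
  shows "v = (\<Sum>j\<in>UNIV. (v \<bullet> N j) *\<^sub>R N j) + (\<Sum>i\<in>UNIV. (v \<bullet> e i) *\<^sub>R e i)"
proof -
  define b where "b s = (case s of Inl j \<Rightarrow> N j | Inr i \<Rightarrow> e i)" for s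
  have "b r \<bullet> b s = (if r = s then 1 else 0)" for r s
    using assms unfolding orthonormal_pair_def b_def by (auto split: sum.split simp: inner_commute)
  from orthonormal_expansion[of b, OF this, of v] show ?thesis by (simp add: sum_UNIV_Plus b_def)
qed

lemma orthonormal_pair_eqI:
  fixes N :: "'m::finite \<Rightarrow> real^('m + 'n::finite)" and e :: "'n \<Rightarrow> real^('m + 'n)"
  assumes "orthonormal_pair N e" "\<And>j. v \<bullet> N j = w \<bullet> N j" "\<And>i. v \<bullet> e i = w \<bullet> e i"
  shows "v = w"
  using orthonormal_pair_expansion[OF assms(1), of v] orthonormal_pair_expansion[OF assms(1), of w] assms(2,3)
  by simp

lemma orthonormal_pairD:
  assumes "orthonormal_pair N e"
  shows "N j \<bullet> N k = (if j = k then 1 else 0)" "e i \<bullet> e l = (if i = l then 1 else 0)"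
    "N j \<bullet> e i = 0" "e i \<bullet> N j = 0"
  using assms unfolding orthonormal_pair_def by (auto simp: inner_commute)

lemma sum_delta_scaleR:
  fixes b :: "'s::finite \<Rightarrow> 'b::real_vector"
  shows "(\<Sum>s\<in>UNIV. (if s = r then c s else 0) *\<^sub>R b s) = c r *\<^sub>R b r"
    "(\<Sum>s\<in>UNIV. (if r = s then c s else 0) *\<^sub>R b s) = c r *\<^sub>R b r"
  by (simp_all add: if_distrib[of "\<lambda>x. x *\<^sub>R _"] cong: if_cong)

text \<open>The equations for \<open>\<partial>\<^sub>iN\<^sub>j\<close> and \<open>\<partial>\<^sub>ie\<^sub>k\<close> are the columns of \<open>dg = g\<theta>\<close> for the matrix \<open>g\<close> with
  columns \<open>N\<^sub>j\<close>, \<open>e\<^sub>k\<close>.\<close>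

definition moving_frame ::
  "(real^'n::finite) set \<Rightarrow> ('m::finite \<Rightarrow> real^'n \<Rightarrow> real^('m + 'n)) \<Rightarrow> ('n \<Rightarrow> real^'n \<Rightarrow> real^('m + 'n)) \<Rightarrow>
   (real^'n \<Rightarrow> real^'n^'m) \<Rightarrow> (real^'n \<Rightarrow> real^'n^'n) \<Rightarrow> bool" where
  "moving_frame W N e A F \<longleftrightarrow> open W \<and> (\<forall>j. smooth_on W (N j)) \<and> (\<forall>i. smooth_on W (e i)) \<and>
     (\<forall>x\<in>W. orthonormal_pair (\<lambda>j. N j x) (\<lambda>i. e i x) \<and>
       (\<forall>i j. partial i (N j) x = A x $ j $ i *\<^sub>R e i x) \<and>
       (\<forall>i k. partial i (e k) x = F x $ i $ k *\<^sub>R e i x -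
          (if i = k then (\<Sum>j\<in>UNIV. A x $ j $ i *\<^sub>R N j x) + (\<Sum>l\<in>UNIV. F x $ i $ l *\<^sub>R e l x) else 0)))"

lemma moving_frameD:
  assumes "moving_frame W N e A F"
  shows "open W" "smooth_on W (N j)" "smooth_on W (e i)"
    "x \<in> W \<Longrightarrow> orthonormal_pair (\<lambda>j. N j x) (\<lambda>i. e i x)"
    "x \<in> W \<Longrightarrow> partial i (N j) x = A x $ j $ i *\<^sub>R e i x"
    "x \<in> W \<Longrightarrow> partial i (e k) x = F x $ i $ k *\<^sub>R e i x -
          (if i = k then (\<Sum>j\<in>UNIV. A x $ j $ i *\<^sub>R N j x) + (\<Sum>l\<in>UNIV. F x $ i $ l *\<^sub>R e l x) else 0)"
  using assms unfolding moving_frame_def by blast+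

text \<open>Both sides are second derivatives of \<open>N\<close>, computed from \<open>eq\<close>
  in the two orders. For the position vector this expresses that the tangent connection is
  torsion-free; for the other normals it is the Codazzi equation.\<close>

lemma mixed_partials_weingarten:
  fixes N :: "real^'n::finite \<Rightarrow> real^'s::finite"
  assumes W: "open W" "x \<in> W" and N: "smooth_on W N" and e: "\<And>i. smooth_on W (e i)" and a: "\<And>i. smooth_on W (a i)"
    and eq: "\<And>i x. x \<in> W \<Longrightarrow> partial i N x = a i x *\<^sub>R e i x"
  shows "a k x *\<^sub>R partial i (e k) x + partial i (a k) x *\<^sub>R e k x = a i x *\<^sub>R partial k (e i) x + partial k (a i) x *\<^sub>R e i x"
proof -
  have "partial i (partial k N) x = a k x *\<^sub>R partial i (e k) x + partial i (a k) x *\<^sub>R e k x" for i k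
  proof -
    have "partial i (partial k N) x = partial i (\<lambda>x. a k x *\<^sub>R e k x) x"
      by (rule partial_cong[OF W]) (rule eq)
    also have "\<dots> = a k x *\<^sub>R partial i (e k) x + partial i (a k) x *\<^sub>R e k x"
      by (intro partial_scaleR smooth_on_differentiable[OF _ W(2)] e a)
    finally show ?thesis .
  qed
  then show ?thesis using partial_commute[OF W(1) N W(2)] by metis
qed

text \<open>The position vector is treated like the other members: for an immersion into the sphere
  it is a unit normal field with tangent derivative. The condition thus says that the whole normal
  frame in Euclidean space is parallel.\<close>

definition parallel_normals ::
  "(real^'n::finite) set \<Rightarrow> ('m \<Rightarrow> real^'n \<Rightarrow> 'd::euclidean_space) \<Rightarrow> bool" where
  "parallel_normals W N \<longleftrightarrow> open W \<and> (\<forall>j. smooth_on W (N j)) \<and>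
     (\<forall>x\<in>W. (\<forall>j k. N j x \<bullet> N k x = (if j = k then 1 else 0)) \<and> (\<forall>i j k. partial i (N j) x \<bullet> N k x = 0))"

text \<open>The derivatives of the frame are determined by inner products. Those of
  \<open>e k\<close> with the normals are the Weingarten formula read backwards. Those with the
  tangent vectors follow from skewness together with the symmetry of the second derivatives of
  \<open>Y\<close>, as for the Levi-Civita connection of a diagonal metric.\<close>

lemma moving_frame_fundamental_forms:
  fixes N :: "'m::finite \<Rightarrow> real^'n::finite \<Rightarrow> real^('m + 'n)"
  assumes PN: "parallel_normals W N" and Y: "\<And>x. x \<in> W \<Longrightarrow> Y x = N j1 x"
    and FF: "fundamental_forms j1 W Y N A" and nz: "\<And>x i. x \<in> W \<Longrightarrow> A x $ j1 $ i \<noteq> 0"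
  shows "moving_frame W N (\<lambda>i x. (1 / A x $ j1 $ i) *\<^sub>R partial i Y x) A (rotation_coeffs j1 A)"
proof -
  define e where "e i x = (1 / A x $ j1 $ i) *\<^sub>R partial i Y x" for i x
  have W: "open W" and N: "smooth_on W (N j)" for j using PN unfolding parallel_normals_def by auto
  have A: "smooth_on W A" using FF unfolding fundamental_forms_def by blast
  have a: "smooth_on W (\<lambda>x. A x $ j $ i)" for i j by (intro smooth_intros W A)
  have Ys: "smooth_on W Y" by (rule smooth_on_cong[OF W N]) (simp add: Y)
  have e: "smooth_on W (e i)" for i
    unfolding e_def[abs_def] using nz by (intro smooth_on_scaleR smooth_on_partial smooth_on_divide smooth_on_const W a Ys)
  have pY: "partial i Y x = partial i (N j1) x" if "x \<in> W" for i x
    by (rule partial_cong[OF W that Y])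
  have on: "orthonormal_pair (\<lambda>j. N j x) (\<lambda>i. e i x)" and wein: "partial i (N j) x = A x $ j $ i *\<^sub>R e i x"
    if x: "x \<in> W" for x i j
  proof -
    have NN: "N j x \<bullet> N k x = (if j = k then 1 else 0)" and pN: "partial i (N j) x \<bullet> N k x = 0" for i j k
      using PN x unfolding parallel_normals_def by auto
    have I: "first_form Y x u w = (\<Sum>i\<in>UNIV. (A x $ j1 $ i)\<^sup>2 * (u $ i * w $ i))"
      and II: "second_form (- {j1}) Y N x u w =
        (\<Sum>i\<in>UNIV. \<Sum>j\<in>- {j1}. (A x $ j1 $ i * A x $ j $ i * (u $ i * w $ i)) *\<^sub>R N j x)" for u w
      using FF x unfolding fundamental_forms_def by auto
    have "axis i (1::real) $ l * axis k 1 $ l = (if l = i then (if i = k then 1 else 0) else 0)" for i k l :: 'n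
      by (simp add: axis_def)
    then have axis: "(\<Sum>l\<in>UNIV. c l * (axis i 1 $ l * axis k 1 $ l)) = (if i = k then c i else 0)" for c :: "'n \<Rightarrow> real" and i k
      by (simp add: if_distrib cong: if_cong)
    have YY: "partial i Y x \<bullet> partial k Y x = (if i = k then (A x $ j1 $ i)\<^sup>2 else 0)" for i k
      using I[of "axis i 1" "axis k 1"] unfolding first_form_def partial_def[symmetric] axis .
    have NY: "partial i (N j) x \<bullet> partial k Y x = (if i = k then A x $ j1 $ i * A x $ j $ i else 0)" for i j k
    proof (cases "j = j1")
      case True
      then show ?thesis using YY[of i k] pY[OF x] by (simp add: power2_eq_square)
    next
      case False
      have pick: "(\<Sum>l\<in>-{j1}. c l *\<^sub>R N l x) \<bullet> N j x = c j" for c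
      proof -
        have "(\<Sum>l\<in>-{j1}. c l *\<^sub>R N l x) \<bullet> N j x = (\<Sum>l\<in>-{j1}. if l = j then c l else 0)"
          unfolding inner_sum_left by (intro sum.cong) (auto simp: NN)
        then show ?thesis using False by simp
      qed
      have "partial i (N j) x \<bullet> partial k Y x = second_form (- {j1}) Y N x (axis i 1) (axis k 1) \<bullet> N j x"
        unfolding second_form_def partial_def[symmetric] pick ..
      also have "\<dots> = (\<Sum>l\<in>UNIV. A x $ j1 $ l * A x $ j $ l * (axis i 1 $ l * axis k 1 $ l))"
        unfolding II inner_sum_left[of _ UNIV] pick ..
      finally show ?thesis unfolding axis .
    qed
    have ee: "e i x \<bullet> e k x = (if i = k then 1 else 0)" for i k
      unfolding e_def using nz[OF x] by (auto simp: YY power2_eq_square)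
    have Ne: "N j x \<bullet> e i x = 0" for i j
      unfolding e_def using pN[of i j1 j] pY[OF x] by (simp add: inner_commute)
    show on: "orthonormal_pair (\<lambda>j. N j x) (\<lambda>i. e i x)"
      unfolding orthonormal_pair_def using NN ee Ne by blast
    show "partial i (N j) x = A x $ j $ i *\<^sub>R e i x"
    proof (rule orthonormal_pair_eqI[OF on])
      show "partial i (N j) x \<bullet> N k x = A x $ j $ i *\<^sub>R e i x \<bullet> N k x" for k
        using pN Ne by (simp add: inner_commute)
      show "partial i (N j) x \<bullet> e k x = A x $ j $ i *\<^sub>R e i x \<bullet> e k x" for k
        unfolding e_def using NY[of i j k] YY[of i k] nz[OF x] by (auto simp: power2_eq_square)
    qed
  qed
  have wY: "partial i Y x = A x $ j1 $ i *\<^sub>R e i x" if "x \<in> W" for i x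
    unfolding e_def using nz[OF that] by simp
  let ?F = "rotation_coeffs j1 A"
  have skew: "partial i (e k) x \<bullet> e l x = - (e k x \<bullet> partial i (e l) x)" if "x \<in> W" for i k l x
    by (rule partial_inner_constant[OF W that e e, where c = "if k = l then 1 else 0"]) (simp add: orthonormal_pairD[OF on])
  have eN: "partial i (e k) x \<bullet> N j x = (if i = k then - A x $ j $ i else 0)" if "x \<in> W" for i k j x
  proof -
    have "partial i (e k) x \<bullet> N j x = - (e k x \<bullet> partial i (N j) x)"
      by (rule partial_inner_constant[OF W that e N, of _ _ 0]) (simp add: orthonormal_pairD[OF on])
    then show ?thesis using wein[OF that] orthonormal_pairD[OF on[OF that]] by simp
  qed
  have diag: "partial i (e k) x \<bullet> e k x = 0" if "x \<in> W" for i k x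
    using skew[OF that, of i k k] by (simp add: inner_commute)
  have sym: "A x $ j1 $ k *\<^sub>R partial i (e k) x + partial i (\<lambda>x. A x $ j1 $ k) x *\<^sub>R e k x
      = A x $ j1 $ i *\<^sub>R partial k (e i) x + partial k (\<lambda>x. A x $ j1 $ i) x *\<^sub>R e i x" if "x \<in> W" for i k x
    by (rule mixed_partials_weingarten[OF W that Ys e a wY])
  have off: "partial i (e k) x \<bullet> e i x = ?F x $ i $ k" if x: "x \<in> W" and ik: "i \<noteq> k" for i k x
  proof -
    have "A x $ j1 $ k * (partial i (e k) x \<bullet> e i x) = partial k (\<lambda>x. A x $ j1 $ i) x"
      using arg_cong[OF sym[OF x, of k i], of "\<lambda>v. v \<bullet> e i x"] ik diag[OF x] orthonormal_pairD[OF on[OF x]]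
      by (simp add: inner_add_left)
    then show ?thesis using ik nz[OF x] by (simp add: rotation_coeffs_def field_simps)
  qed
  have three: "partial i (e k) x \<bullet> e l x = 0" if x: "x \<in> W" and d: "i \<noteq> k" "l \<noteq> i" for i k l x
  proof (cases "k = l")
    case False
    \<comment> \<open>\<open>T\<close> is skew in its last two indices and, for distinct indices,
      symmetric in its first two; alternating these exchanges turns it into its own
      negative.\<close>
    define T where "T i k l = (partial i (e k) x \<bullet> e l x) / A x $ j1 $ i" for i k l
    have T1: "T i k l = T k i l" if "l \<noteq> i" "l \<noteq> k" for i k l
    proof -
      have "A x $ j1 $ k * (partial i (e k) x \<bullet> e l x) = A x $ j1 $ i * (partial k (e i) x \<bullet> e l x)"
        using arg_cong[OF sym[OF x, of k i], of "\<lambda>v. v \<bullet> e l x"] that orthonormal_pairD[OF on[OF x]]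
        by (simp add: inner_add_left)
      then show ?thesis using nz[OF x] by (simp add: T_def field_simps)
    qed
    have T2: "T i k l = - T i l k" for i k l
      unfolding T_def using skew[OF x, of i k l] by (simp add: inner_commute)
    have "T i k l = T k i l" using T1 d False by auto
    also have "\<dots> = - T k l i" by (rule T2)
    also have "T k l i = T l k i" using T1 d by auto
    also have "- T l k i = T l i k" using T2[of l i k] by simp
    also have "T l i k = T i l k" using T1 d False by auto
    also have "\<dots> = - T i k l" by (rule T2)
    finally have "T i k l = 0" by simp
    then show ?thesis using nz[OF x] by (simp add: T_def)
  qed (use diag[OF x] in simp)
  have gauss: "partial i (e k) x = ?F x $ i $ k *\<^sub>R e i x -
          (if i = k then (\<Sum>j\<in>UNIV. A x $ j $ i *\<^sub>R N j x) + (\<Sum>l\<in>UNIV. ?F x $ i $ l *\<^sub>R e l x) else 0)"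
    if x: "x \<in> W" for i k x
  proof (cases "i = k")
    case False
    have "partial i (e k) x = ?F x $ i $ k *\<^sub>R e i x"
    proof (rule orthonormal_pair_eqI[OF on[OF x]])
      show "partial i (e k) x \<bullet> N j x = (?F x $ i $ k *\<^sub>R e i x) \<bullet> N j x" for j
        using False by (simp add: eN[OF x] orthonormal_pairD[OF on[OF x]])
      show "partial i (e k) x \<bullet> e l x = (?F x $ i $ k *\<^sub>R e i x) \<bullet> e l x" for l
        using off[OF x False] three[OF x False, of l]
        by (cases "l = i") (simp_all add: orthonormal_pairD[OF on[OF x]])
    qed
    then show ?thesis using False by simp
  next
    case True
    have Fii: "?F x $ i $ i = 0" by (simp add: rotation_coeffs_def)
    \<comment> \<open>The derivative of \<open>e i\<close> in its own direction is the skew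
      counterpart of the off-diagonal coefficients.\<close>
    have c: "partial i (e i) x \<bullet> e l x = - ?F x $ i $ l" for l
    proof (cases "i = l")
      case False
      have "partial i (e i) x \<bullet> e l x = - (e i x \<bullet> partial i (e l) x)" by (rule skew[OF x])
      then show ?thesis using off[OF x False] by (simp only: inner_commute)
    qed (use diag[OF x] Fii in simp)
    have "partial i (e i) x = (\<Sum>j\<in>UNIV. (- A x $ j $ i) *\<^sub>R N j x) + (\<Sum>l\<in>UNIV. (- ?F x $ i $ l) *\<^sub>R e l x)"
      using orthonormal_pair_expansion[OF on[OF x], of "partial i (e i) x"] unfolding c eN[OF x] by simp
    then show ?thesis using True Fii by (simp add: sum_negf)
  qed
  show ?thesis
    unfolding moving_frame_def e_def[symmetric] e_def[abs_def, symmetric]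
    using W N e on wein gauss by blast
qed

lemma smooth_on_rotation_coeffs:
  assumes W: "open W" and A: "smooth_on W A" and nz: "\<And>x i. x \<in> W \<Longrightarrow> A x $ j1 $ i \<noteq> 0"
  shows "smooth_on W (rotation_coeffs j1 A)"
  unfolding rotation_coeffs_def
proof (intro smooth_on_vec_lambda W)
  show "smooth_on W (\<lambda>x. if i = j then 0 else partial j (\<lambda>y. A y $ j1 $ i) x / A x $ j1 $ j)" for i j
    using nz by (cases "i = j") (auto intro!: smooth_on_const smooth_on_divide smooth_intros W A)
qed

text \<open>The equation for \<open>A\<close> is the \<open>e j\<close> component of the symmetry of
  second derivatives of \<open>N i\<close> (Codazzi). The equations for \<open>F\<close> are the
  \<open>e i\<close> components of that symmetry for \<open>e j\<close>: with three distinct indices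
  only off-diagonal derivatives occur, with two of them the derivative of \<open>e j\<close> along
  itself brings in the sum (Gauss).\<close>

lemma G_system_moving_frame:
  fixes N :: "'m::finite \<Rightarrow> real^'n::finite \<Rightarrow> real^('m + 'n)"
  assumes MF: "moving_frame W N e A F" and A: "smooth_on W A" and F: "smooth_on W F"
    and orth: "\<And>x. x \<in> W \<Longrightarrow> transpose (A x) ** A x = mat 1" and Fii: "\<And>x i. x \<in> W \<Longrightarrow> F x $ i $ i = 0"
  shows "G_system_I W A F"
proof -
  note W = moving_frameD(1)[OF MF] and N = moving_frameD(2)[OF MF] and e = moving_frameD(3)[OF MF]
    and on = orthonormal_pairD[OF moving_frameD(4)[OF MF]] and wein = moving_frameD(5)[OF MF] and gauss = moving_frameD(6)[OF MF]
  have a: "smooth_on W (\<lambda>x. A x $ j $ i)" for i j by (intro smooth_intros W A)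
  have f: "smooth_on W (\<lambda>x. F x $ j $ i)" for i j by (intro smooth_intros W F)
  have gauss_off: "partial i (e k) x = F x $ i $ k *\<^sub>R e i x" if "x \<in> W" "i \<noteq> k" for i k x
    using gauss[OF that(1), of i k] that(2) by simp
  have sumdelta: "(\<Sum>l\<in>UNIV. c l *\<^sub>R e l x) \<bullet> e i x = c i" if "x \<in> W" for c i x
    unfolding inner_sum_left inner_scaleR_left on(2)[OF that] by (simp add: if_distrib cong: if_cong)
  have sum0: "(\<Sum>j\<in>UNIV. c j *\<^sub>R N j x) \<bullet> e i x = 0" if "x \<in> W" for c i x
    unfolding inner_sum_left using on(3)[OF that] by simp
  have gauss_e: "partial i (e k) x \<bullet> e i x = F x $ i $ k" if "x \<in> W" for i k x
    unfolding gauss[OF that, of i k] using Fii[OF that] on(2)[OF that]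
    by (auto simp: inner_diff_left inner_add_left sumdelta[OF that] sum0[OF that])
  have dia: "partial i (e k) x \<bullet> e k x = 0" if "x \<in> W" for i k x
    using gauss_e[OF that, of k k] gauss_off[OF that, of i k] on(2)[OF that] Fii[OF that] by (cases "i = k") auto
  have 1: "partial k (\<lambda>y. A y $ i $ j) x = F x $ j $ k * A x $ i $ k" if x: "x \<in> W" and kj: "k \<noteq> j" for x i j k
  proof -
    have "A x $ i $ k *\<^sub>R partial j (e k) x + partial j (\<lambda>x. A x $ i $ k) x *\<^sub>R e k x
      = A x $ i $ j *\<^sub>R partial k (e j) x + partial k (\<lambda>x. A x $ i $ j) x *\<^sub>R e j x"
      by (rule mixed_partials_weingarten[OF W x N[of i] e a wein])
    from arg_cong[OF this, of "\<lambda>v. v \<bullet> e j x"] show ?thesis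
      using gauss_e[OF x] dia[OF x] on(2)[OF x] kj by (simp add: inner_add_left mult.commute)
  qed
  have second: "partial k (partial i (e j)) x = F x $ i $ j *\<^sub>R partial k (e i) x + partial k (\<lambda>x. F x $ i $ j) x *\<^sub>R e i x"
    if x: "x \<in> W" and ij: "i \<noteq> j" for x i j k
  proof -
    have "partial k (partial i (e j)) x = partial k (\<lambda>x. F x $ i $ j *\<^sub>R e i x) x"
      by (rule partial_cong[OF W x]) (rule gauss_off[OF _ ij])
    then show ?thesis by (simp add: partial_scaleR smooth_on_differentiable[OF _ x] e f)
  qed
  have 2: "partial k (\<lambda>y. F y $ i $ j) x = F x $ i $ k * F x $ k $ j"
    if x: "x \<in> W" and d: "i \<noteq> j" "j \<noteq> k" "i \<noteq> k" for x i j k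
  proof -
    have "F x $ i $ j *\<^sub>R partial k (e i) x + partial k (\<lambda>x. F x $ i $ j) x *\<^sub>R e i x
        = F x $ k $ j *\<^sub>R partial i (e k) x + partial i (\<lambda>x. F x $ k $ j) x *\<^sub>R e k x"
      using second[OF x, of i j k] second[OF x, of k j i] d partial_commute[OF W e x, of k i j] by auto
    from arg_cong[OF this, of "\<lambda>v. v \<bullet> e i x"] show ?thesis
      using gauss_e[OF x] dia[OF x] on(2)[OF x] d by (simp add: inner_add_left)
  qed
  have 3: "partial j (\<lambda>y. F y $ i $ j) x + partial i (\<lambda>y. F y $ j $ i) x + (\<Sum>k\<in>UNIV. F x $ i $ k * F x $ j $ k) = 0"
    if x: "x \<in> W" and ij: "i \<noteq> j" for x i j
  proof -
    let ?n = "\<lambda>x. (\<Sum>l\<in>UNIV. A x $ l $ j *\<^sub>R N l x)" and ?t = "\<lambda>x. (\<Sum>k\<in>UNIV. F x $ j $ k *\<^sub>R e k x)"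
    have sm: "smooth_on W ?n" "smooth_on W ?t" by (intro smooth_intros W a f N e)+
    have "partial i (partial j (e j)) x = partial i (\<lambda>x. (- 1) *\<^sub>R (?n x + ?t x)) x"
      by (rule partial_cong[OF W x]) (simp add: gauss Fii)
    also have "\<dots> = (- 1) *\<^sub>R partial i (\<lambda>x. ?n x + ?t x) x"
      by (intro partial_linear bounded_linear_scaleR_right smooth_on_differentiable[OF _ x] smooth_on_add W sm)
    also have "partial i (\<lambda>x. ?n x + ?t x) x = partial i ?n x + partial i ?t x"
      by (intro partial_add smooth_on_differentiable[OF _ x] sm)
    finally have A1: "partial i (partial j (e j)) x \<bullet> e i x = - (partial i ?n x \<bullet> e i x) - partial i ?t x \<bullet> e i x"
      by (simp add: inner_diff_left)
    have "partial i ?n x = (\<Sum>l\<in>UNIV. A x $ l $ j *\<^sub>R partial i (N l) x + partial i (\<lambda>x. A x $ l $ j) x *\<^sub>R N l x)"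
      by (simp add: partial_sum partial_scaleR smooth_on_differentiable[OF _ x] smooth_intros W a N)
    then have "partial i ?n x \<bullet> e i x = (\<Sum>l\<in>UNIV. A x $ l $ j * A x $ l $ i)"
      using on(2,3)[OF x] wein[OF x] by (simp add: inner_sum_left inner_add_left)
    also have "\<dots> = (transpose (A x) ** A x) $ j $ i"
      by (simp add: matrix_matrix_mult_def transpose_def)
    \<comment> \<open>Orthogonality of distinct columns of \<open>A\<close> removes the normal part;
      this is the Gauss equation of a flat metric.\<close>
    also have "\<dots> = 0" using ij by (simp add: orth[OF x] mat_def)
    finally have A2: "partial i ?n x \<bullet> e i x = 0" .
    have "partial i ?t x = (\<Sum>k\<in>UNIV. F x $ j $ k *\<^sub>R partial i (e k) x + partial i (\<lambda>x. F x $ j $ k) x *\<^sub>R e k x)"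
      by (simp add: partial_sum partial_scaleR smooth_on_differentiable[OF _ x] smooth_intros W f e)
    then have A3: "partial i ?t x \<bullet> e i x = (\<Sum>k\<in>UNIV. F x $ i $ k * F x $ j $ k) + partial i (\<lambda>y. F y $ j $ i) x"
      by (simp add: inner_sum_left inner_add_left gauss_e[OF x] on(2)[OF x] sum.distrib mult.commute if_distrib cong: if_cong)
    have A4: "partial j (partial i (e j)) x \<bullet> e i x = partial j (\<lambda>y. F y $ i $ j) x"
      using second[OF x ij, of j] dia[OF x] on(2)[OF x] by (simp add: inner_add_left)
    show ?thesis using A1 A2 A3 A4 partial_commute[OF W e x, of i j j] by simp
  qed
  show ?thesis
    unfolding G_system_I_def using A F orth Fii 1 2 3 by blast
qed

section \<open>The frame equations in matrix form and their integrability\<close>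

lemma smooth_on_if [smooth_intros]:
  "smooth_on U f \<Longrightarrow> smooth_on U g \<Longrightarrow> smooth_on U (\<lambda>x. if b then f x else g x)"
  by (cases b) simp_all

lemma bounded_bilinear_matrix_mult:
  "bounded_bilinear ((**) :: real^'b::finite^'a::finite \<Rightarrow> real^'c::finite^'b \<Rightarrow> real^'c^'a)"
proof -
  have "bilinear ((**) :: real^'b^'a \<Rightarrow> real^'c^'b \<Rightarrow> real^'c^'a)"
    unfolding bilinear_def
    by (auto intro!: linearI simp: matrix_matrix_mult_def vec_eq_iff sum.distrib sum_distrib_left algebra_simps)
  then show ?thesis by (simp add: bilinear_conv_bounded_bilinear)
qed

lemma bounded_linear_transpose: "bounded_linear (transpose :: real^'b::finite^'a::finite \<Rightarrow> real^'a^'b)"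
  unfolding linear_conv_bounded_linear[symmetric]
  by (auto intro!: linearI simp: transpose_def vec_eq_iff)

lemma bounded_linear_column: "bounded_linear (column c :: real^'b::finite^'a::finite \<Rightarrow> real^'a)"
  unfolding linear_conv_bounded_linear[symmetric]
  by (auto intro!: linearI simp: column_def vec_eq_iff)

lemma frame_connection_nth:
  fixes A :: "real^'n::finite^'m::finite"
  shows "frame_connection A F i $ Inl j $ Inl k = 0"
    "frame_connection A F i $ Inl j $ Inr l = - (if l = i then A $ j $ i else 0)"
    "frame_connection A F i $ Inr s $ Inl j = (if s = i then A $ j $ i else 0)"
    "frame_connection A F i $ Inr s $ Inr l = (if s = i then F $ i $ l else 0) - (if l = i then F $ i $ s else 0)"
  by (auto simp: frame_connection_def block_matrix_def matrix_matrix_mult_def transpose_def C_mat_def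
      if_distrib[of "\<lambda>x. _ * x"] if_distrib[of "\<lambda>x. x * _"] cong: if_cong)

lemma column_mult:
  fixes g :: "real^'b::finite^'a::finite" and \<theta> :: "real^'c::finite^'b"
  shows "column c (g ** \<theta>) = (\<Sum>r\<in>UNIV. \<theta> $ r $ c *\<^sub>R column r g)"
  by (simp add: vec_eq_iff column_def matrix_matrix_mult_def mult.commute)

lemma column_mult_frame_connection:
  fixes A :: "real^'n::finite^'m::finite"
  shows "column (Inl j) (g ** frame_connection A F i) = A $ j $ i *\<^sub>R column (Inr i) g"
    "column (Inr k) (g ** frame_connection A F i) = F $ i $ k *\<^sub>R column (Inr i) g -
          (if i = k then (\<Sum>j\<in>UNIV. A $ j $ i *\<^sub>R column (Inl j) g) + (\<Sum>l\<in>UNIV. F $ i $ l *\<^sub>R column (Inr l) g) else 0)"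
proof -
  show "column (Inl j) (g ** frame_connection A F i) = A $ j $ i *\<^sub>R column (Inr i) g"
    unfolding column_mult sum_UNIV_Plus frame_connection_nth by (simp add: sum_delta_scaleR)
  have "column (Inr k) (g ** frame_connection A F i)
    = (\<Sum>j\<in>UNIV. - (if k = i then A $ j $ i else 0) *\<^sub>R column (Inl j) g)
      + ((\<Sum>s\<in>UNIV. (if s = i then F $ i $ k else 0) *\<^sub>R column (Inr s) g)
      - (\<Sum>s\<in>UNIV. (if k = i then F $ i $ s else 0) *\<^sub>R column (Inr s) g))"
    unfolding column_mult sum_UNIV_Plus frame_connection_nth by (simp add: scaleR_diff_left sum_subtractf)
  then show "column (Inr k) (g ** frame_connection A F i) = F $ i $ k *\<^sub>R column (Inr i) g -
          (if i = k then (\<Sum>j\<in>UNIV. A $ j $ i *\<^sub>R column (Inl j) g) + (\<Sum>l\<in>UNIV. F $ i $ l *\<^sub>R column (Inr l) g) else 0)"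
    unfolding sum_delta_scaleR by (auto simp: sum_negf)
qed

lemma matrix_eq_columns: "(\<And>c. column c g = column c h) \<Longrightarrow> g = h"
  by (simp add: vec_eq_iff column_def)

lemma orthogonal_matrix_columns:
  fixes g :: "real^('m::finite + 'n::finite)^('m + 'n)"
  shows "orthogonal_matrix g \<longleftrightarrow> orthonormal_pair (\<lambda>j. column (Inl j) g) (\<lambda>i. column (Inr i) g)"
proof -
  have "(transpose g ** g) $ r $ c = column r g \<bullet> column c g" for r c
    by (simp add: matrix_matrix_mult_def transpose_def column_def inner_vec_def)
  then have "orthogonal_matrix g \<longleftrightarrow> (\<forall>r c. column r g \<bullet> column c g = (if r = c then 1 else 0))"
    unfolding orthogonal_matrix by (simp add: vec_eq_iff mat_def)
  also have "\<dots> \<longleftrightarrow> orthonormal_pair (\<lambda>j. column (Inl j) g) (\<lambda>i. column (Inr i) g)"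
    unfolding orthonormal_pair_def by (auto simp: split_sum_all inner_commute)
  finally show ?thesis .
qed

lemma orthogonal_matrix_inv_mult:
  fixes g :: "real^'a::finite^'a"
  assumes "orthogonal_matrix g"
  shows "matrix_inv g ** x = y \<longleftrightarrow> x = g ** y"
proof -
  have "\<exists>g'. g ** g' = mat 1 \<and> g' ** g = mat 1" using assms unfolding orthogonal_matrix_def by blast
  then have "g ** matrix_inv g = mat 1 \<and> matrix_inv g ** g = mat 1" unfolding matrix_inv_def by (rule someI_ex)
  then show ?thesis by (metis matrix_mul_assoc matrix_mul_lid)
qed

lemma frame_solution_partial:
  assumes FS: "frame_solution W A F g" and x: "x \<in> W"
  shows "partial i g x = g x ** frame_connection (A x) (F x) i"
proof -
  have "matrix_inv (g x) ** D g x (axis i 1) = (\<Sum>k\<in>UNIV. (if k = i then 1 else 0) *\<^sub>R frame_connection (A x) (F x) k)"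
    using FS x unfolding frame_solution_def by (simp add: axis_def)
  then have "matrix_inv (g x) ** partial i g x = frame_connection (A x) (F x) i"
    unfolding partial_def sum_delta_scaleR by simp
  moreover have "orthogonal_matrix (g x)" using FS x unfolding frame_solution_def by blast
  ultimately show ?thesis by (simp add: orthogonal_matrix_inv_mult)
qed

lemma frame_solutionI:
  assumes W: "open W" and g: "smooth_on W g" and orth: "\<And>x. x \<in> W \<Longrightarrow> orthogonal_matrix (g x)"
    and eq: "\<And>x i. x \<in> W \<Longrightarrow> partial i g x = g x ** frame_connection (A x) (F x) i"
  shows "frame_solution W A F g"
proof -
  interpret mm: bounded_bilinear "(**) :: real^('b + 'a)^('b + 'a) \<Rightarrow> real^('b + 'a)^('b + 'a) \<Rightarrow> _"
    by (rule bounded_bilinear_matrix_mult)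
  have "matrix_inv (g x) ** D g x u = (\<Sum>i\<in>UNIV. u $ i *\<^sub>R frame_connection (A x) (F x) i)" if x: "x \<in> W" for x u
    unfolding orthogonal_matrix_inv_mult[OF orth[OF x]] D_partials[OF smooth_on_differentiable[OF g x]] eq[OF x]
    by (simp add: mm.sum_right mm.scaleR_right)
  then show ?thesis unfolding frame_solution_def using g orth by blast
qed

lemma moving_frame_of_frame_solution:
  fixes g :: "real^'n::finite \<Rightarrow> real^('m::finite + 'n)^('m + 'n)"
  assumes W: "open W" and FS: "frame_solution W A F g"
  shows "moving_frame W (\<lambda>j x. column (Inl j) (g x)) (\<lambda>i x. column (Inr i) (g x)) A F"
proof -
  have g: "smooth_on W g" and orth: "\<And>x. x \<in> W \<Longrightarrow> orthogonal_matrix (g x)"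
    using FS unfolding frame_solution_def by auto
  have sm: "smooth_on W (\<lambda>x. column c (g x))" for c by (rule smooth_on_linear[OF bounded_linear_column W g])
  have p: "partial i (\<lambda>x. column c (g x)) x = column c (g x ** frame_connection (A x) (F x) i)" if "x \<in> W" for i c x
    unfolding partial_linear[OF bounded_linear_column smooth_on_differentiable[OF g that]]
      frame_solution_partial[OF FS that] ..
  show ?thesis
    unfolding moving_frame_def using W sm orth
    by (auto simp: orthogonal_matrix_columns p column_mult_frame_connection)
qed

lemma frame_solution_of_moving_frame:
  fixes N :: "'m::finite \<Rightarrow> real^'n::finite \<Rightarrow> real^('m + 'n)"
  assumes MF: "moving_frame W N e A F"
    and N: "\<And>j x. column (Inl j) (g x) = N j x" and e: "\<And>i x. column (Inr i) (g x) = e i x"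
  shows "frame_solution W A F g"
proof (rule frame_solutionI)
  show W: "open W" using moving_frameD(1)[OF MF] .
  show g: "smooth_on W g"
  proof (intro smooth_on_vec W)
    fix r c
    have "smooth_on W (\<lambda>x. column c (g x) $ r)"
      by (cases c) (auto simp: N e intro!: smooth_intros W moving_frameD(2,3)[OF MF])
    then show "smooth_on W (\<lambda>x. g x $ r $ c)" by (simp add: column_def)
  qed
  fix x assume x: "x \<in> W"
  show "orthogonal_matrix (g x)"
    unfolding orthogonal_matrix_columns N e by (rule moving_frameD(4)[OF MF x])
  show "partial i g x = g x ** frame_connection (A x) (F x) i" for i
  proof (rule matrix_eq_columns)
    fix c
    have col: "column c (partial i g x) = partial i (\<lambda>x. column c (g x)) x" for c
      by (rule partial_linear[OF bounded_linear_column smooth_on_differentiable[OF g x], symmetric])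
    show "column c (partial i g x) = column c (g x ** frame_connection (A x) (F x) i)"
      unfolding col
      by (cases c) (simp_all add: N e column_mult_frame_connection moving_frameD(5,6)[OF MF x])
  qed
qed

text \<open>If \<open>dg = g T\<close>, the second derivative of \<open>g\<close> is
  \<open>g\<close> times \<open>\<partial>\<^sub>iT\<^sub>j + T\<^sub>iT\<^sub>j\<close>, so the
  symmetry of this matrix in \<open>i\<close> and \<open>j\<close> is flatness at \<lambda> = 1. For
  distinct \<open>i\<close> and \<open>j\<close> the blocks with normal rows vanish, the lower left
  one is symmetric by the equation for \<open>A\<close>, and the lower right one carries the
  equations for \<open>F\<close>.\<close>

lemma frame_connection_flat:
  fixes A :: "real^'n::finite \<Rightarrow> real^'n^'m::finite"
  assumes \<Omega>: "open \<Omega>" and G: "G_system_I \<Omega> A F" and x: "x \<in> \<Omega>"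
  shows "partial i (\<lambda>y. frame_connection (A y) (F y) j) x + frame_connection (A x) (F x) i ** frame_connection (A x) (F x) j
    = partial j (\<lambda>y. frame_connection (A y) (F y) i) x + frame_connection (A x) (F x) j ** frame_connection (A x) (F x) i"
    (is "?P i j = ?P j i")
proof (cases "i = j")
  case ij: False
  have A: "smooth_on \<Omega> A" and F: "smooth_on \<Omega> F" using G unfolding G_system_I_def by auto
  have a: "smooth_on \<Omega> (\<lambda>x. A x $ j $ i)" for i j by (intro smooth_intros \<Omega> A)
  have f: "smooth_on \<Omega> (\<lambda>x. F x $ j $ i)" for i j by (intro smooth_intros \<Omega> F)
  have Fii: "F y $ i $ i = 0" if "y \<in> \<Omega>" for y i using G that unfolding G_system_I_def by simp
  have dF0: "partial k (\<lambda>y. F y $ i $ i) x = 0" for i k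
    using partial_cong[OF \<Omega> x, of "\<lambda>y. F y $ i $ i" "\<lambda>_. 0" k] Fii by simp
  have dA: "partial k (\<lambda>y. A y $ i $ j) x = F x $ j $ k * A x $ i $ k" if "k \<noteq> j" for i j k
    using G x that unfolding G_system_I_def by simp
  have dF1: "partial j (\<lambda>y. F y $ i $ j) x + partial i (\<lambda>y. F y $ j $ i) x + (\<Sum>k\<in>UNIV. F x $ i $ k * F x $ j $ k) = 0"
    if "i \<noteq> j" for i j
    using G x that unfolding G_system_I_def by simp
  have dF2: "partial k (\<lambda>y. F y $ i $ j) x = F x $ i $ k * F x $ k $ j" if "i \<noteq> j" "j \<noteq> k" "i \<noteq> k" for i j k
    using G x that unfolding G_system_I_def by simp
  have "(transpose (A x) ** A x) $ i $ j = 0" if "i \<noteq> j" for i j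
    using G x that unfolding G_system_I_def by (simp add: mat_def)
  then have AA: "(\<Sum>a\<in>UNIV. A x $ a $ i * A x $ a $ j) = 0" if "i \<noteq> j" for i j
    using that by (simp add: matrix_matrix_mult_def transpose_def)
  define T where "T i y = frame_connection (A y) (F y) i" for i y
  have sm: "smooth_on \<Omega> (\<lambda>y. T i y $ r $ c)" for i r c
    by (cases r; cases c) (auto simp: T_def frame_connection_nth intro!: smooth_intros \<Omega> a f)
  have T: "smooth_on \<Omega> (T i)" for i by (intro smooth_on_vec \<Omega> sm)
  have pT: "partial k (T i) x $ r $ c = partial k (\<lambda>y. T i y $ r $ c) x" for k i r c
  proof -
    have "bounded_linear (\<lambda>M :: real^('m + 'n)^('m + 'n). M $ r $ c)"
      by (rule bounded_linear_compose[OF bounded_linear_vec_nth bounded_linear_vec_nth])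
    from partial_linear[OF this smooth_on_differentiable[OF T x], of k i] show ?thesis by simp
  qed
  have entry: "?P i j $ r $ c = partial i (\<lambda>y. T j y $ r $ c) x
      + ((\<Sum>b\<in>UNIV. T i x $ r $ Inl b * T j x $ Inl b $ c) + (\<Sum>s\<in>UNIV. T i x $ r $ Inr s * T j x $ Inr s $ c))" for i j r c
    unfolding T_def[symmetric] T_def[abs_def, symmetric]
    by (simp add: pT[unfolded T_def[abs_def]] T_def[abs_def] matrix_matrix_mult_def sum_UNIV_Plus)
  have neg: "partial k (\<lambda>y. - h y) x = - partial k h x" if "smooth_on \<Omega> h" for k and h :: "real^'n \<Rightarrow> real"
    by (rule partial_linear[OF bounded_linear_minus[OF bounded_linear_ident] smooth_on_differentiable[OF that x]])
  have dif: "partial k (\<lambda>y. h y - h' y) x = partial k h x - partial k h' x" if "smooth_on \<Omega> h" "smooth_on \<Omega> h'"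
    for k and h h' :: "real^'n \<Rightarrow> real"
    using partial_add[OF smooth_on_differentiable[OF that(1) x] smooth_on_differentiable[OF smooth_on_minus[OF \<Omega> that(2)] x]]
    by (simp add: neg[OF that(2)])
  have ite: "partial k (\<lambda>y. if b then h y else 0) x = (if b then partial k h x else 0)" for b k and h :: "real^'n \<Rightarrow> real"
    by simp
  have delta: "(\<Sum>s\<in>UNIV. (if s = i then c s else 0) * d s) = c i * d i" "(\<Sum>s\<in>UNIV. d s * (if s = i then c s else 0)) = d i * c i"
    for c d :: "'n \<Rightarrow> real" and i
    by (simp_all add: if_distrib[of "\<lambda>x. x * _"] if_distrib[of "\<lambda>x. _ * x"] cong: if_cong)
  have "?P i j $ r $ c = ?P j i $ r $ c" for r c
  proof (cases r; cases c)
    fix a b assume rc: "r = Inl a" "c = Inl b"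
    have "?P i j $ r $ c = 0" if "i \<noteq> j" for i j
      unfolding entry rc T_def frame_connection_nth using that
      by (simp add: sum_negf delta)
    from this[OF ij] this[OF ij[symmetric]] show ?thesis by (rule trans[OF _ sym])
  next
    fix a l assume rc: "r = Inl a" "c = Inr l"
    have "?P i j $ r $ c = 0" if "i \<noteq> j" for i j
      unfolding entry rc T_def frame_connection_nth using that
      by (simp add: sum_negf delta neg a dA)
    from this[OF ij] this[OF ij[symmetric]] show ?thesis by (rule trans[OF _ sym])
  next
    fix s b assume rc: "r = Inr s" "c = Inl b"
    have P: "?P i j $ r $ c = (if s = j then F x $ j $ i * A x $ b $ i else 0) + (if s = i then F x $ i $ j * A x $ b $ j else 0)"
      if "i \<noteq> j" for i j
      unfolding entry rc T_def frame_connection_nth using that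
      by (simp add: left_diff_distrib sum_subtractf delta dA)
    show ?thesis unfolding P[OF ij] P[OF ij[symmetric]] by simp
  next
    fix k l assume rc: "r = Inr k" "c = Inr l"
    have P: "?P i j $ r $ c = (if k = j then partial i (\<lambda>y. F y $ j $ l) x else 0) - (if l = j then partial i (\<lambda>y. F y $ j $ k) x else 0)
        + (if k = i then F x $ i $ j * F x $ j $ l else 0)
        - (if k = i \<and> l = j then (\<Sum>s\<in>UNIV. F x $ i $ s * F x $ j $ s) else 0)
        + (if l = j then F x $ i $ k * F x $ j $ i else 0)"
      if "i \<noteq> j" for i j
    proof -
      have 1: "partial i (\<lambda>y. T j y $ r $ c) x = (if k = j then partial i (\<lambda>y. F y $ j $ l) x else 0) - (if l = j then partial i (\<lambda>y. F y $ j $ k) x else 0)"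
        unfolding rc T_def frame_connection_nth by (simp add: dif f neg)
      \<comment> \<open>The contribution through normal indices pairs two distinct columns of
        \<open>A\<close>.\<close>
      have 2: "(\<Sum>b\<in>UNIV. T i x $ r $ Inl b * T j x $ Inl b $ c) = 0"
        unfolding rc T_def frame_connection_nth using AA[OF that] by (cases "k = i"; cases "l = j") (simp_all add: sum_negf)
      have "(\<Sum>s\<in>UNIV. T i x $ r $ Inr s * T j x $ Inr s $ c)
          = (\<Sum>s\<in>UNIV. ((if k = i then F x $ i $ s else 0)) * (if s = j then F x $ j $ l else 0))
            - (\<Sum>s\<in>UNIV. (if k = i \<and> l = j then F x $ i $ s * F x $ j $ s else 0))
            - (\<Sum>s\<in>UNIV. (if s = i then F x $ i $ k else 0) * (if s = j then F x $ j $ l else 0))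
            + (\<Sum>s\<in>UNIV. (if s = i then F x $ i $ k else 0) * (if l = j then F x $ j $ s else 0))"
        unfolding rc T_def frame_connection_nth sum_subtractf[symmetric] sum.distrib[symmetric]
        by (intro sum.cong) (auto simp: algebra_simps)
      also have "\<dots> = (if k = i then F x $ i $ j * F x $ j $ l else 0) - (if k = i \<and> l = j then (\<Sum>s\<in>UNIV. F x $ i $ s * F x $ j $ s) else 0)
          + (if l = j then F x $ i $ k * F x $ j $ i else 0)"
        unfolding delta using that by simp
      finally show ?thesis unfolding entry 1 2 by simp
    qed
    have S: "(\<Sum>s\<in>UNIV. F x $ j $ s * F x $ i $ s) = (\<Sum>s\<in>UNIV. F x $ i $ s * F x $ j $ s)"
      by (simp add: mult.commute)
    \<comment> \<open>If \<open>k\<close> and \<open>l\<close> are \<open>i\<close> and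
      \<open>j\<close> in some order, the entry is the equation with the sum; if exactly one of them
      lies in \<open>{i, j}\<close>, it is the equation for distinct indices.\<close>
    show ?thesis
      unfolding P[OF ij] P[OF ij[symmetric]] S
      using ij dF1[OF ij] dF0 Fii[OF x] dF2[of j k i] dF2[of j l i] dF2[of i k j] dF2[of i l j]
      by (cases "k = i"; cases "k = j"; cases "l = i"; cases "l = j") (auto simp: mult.commute)
  qed
  then show ?thesis by (simp add: vec_eq_iff)
qed simp

text \<open>Right multiplication by the connection matrices is a linear system on the space of
  matrices, and their flatness is its integrability condition. The solution that starts at the
  identity stays orthogonal because the matrices are skew.\<close>

theorem frame_solution_exists:
  fixes A :: "real^'n::finite \<Rightarrow> real^'n^'m::finite"
  assumes \<Omega>: "open \<Omega>" "convex \<Omega>" and G: "G_system_I \<Omega> A F"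
  shows "\<exists>g. frame_solution \<Omega> A F g"
proof (cases "\<Omega> = {}")
  case True
  have "C_on k {} g" for k and g :: "real^'n \<Rightarrow> real^('m + 'n)^('m + 'n)"
    by (induction k arbitrary: g) auto
  then show ?thesis unfolding True frame_solution_def smooth_on_def by auto
next
  case False
  then obtain x0 where x0: "x0 \<in> \<Omega>" by blast
  interpret mm: bounded_bilinear "(**) :: real^('m + 'n)^('m + 'n) \<Rightarrow> real^('m + 'n)^('m + 'n) \<Rightarrow> real^('m + 'n)^('m + 'n)"
    by (rule bounded_bilinear_matrix_mult)
  have A: "smooth_on \<Omega> A" and F: "smooth_on \<Omega> F" using G unfolding G_system_I_def by auto
  define T where "T i y = frame_connection (A y) (F y) i" for i y
  have "smooth_on \<Omega> (\<lambda>y. T i y $ r $ c)" for i r c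
    by (cases r; cases c) (auto simp: T_def frame_connection_nth intro!: smooth_intros \<Omega> A F)
  then have T: "smooth_on \<Omega> (T i)" for i by (intro smooth_on_vec \<Omega>)
  define L where "L i y = mm.prod_left (T i y)" for i y
  have L: "smooth_on \<Omega> (L i)" for i
    unfolding L_def[abs_def] by (rule smooth_on_linear[OF mm.bounded_linear_prod_left \<Omega>(1) T])
  have pL: "partial i (L j) x = mm.prod_left (partial i (T j) x)" if "x \<in> \<Omega>" for i j x
    unfolding L_def[abs_def]
    by (rule partial_linear[OF mm.bounded_linear_prod_left smooth_on_differentiable[OF T that]])
  have flat: "partial i (L j) x + (L j x o\<^sub>L L i x) = partial j (L i) x + (L i x o\<^sub>L L j x)" if x: "x \<in> \<Omega>" for x i j
  proof (rule blinfun_eqI)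
    fix g
    have "partial i (T j) x + T i x ** T j x = partial j (T i) x + T j x ** T i x"
      using frame_connection_flat[OF \<Omega>(1) G x, of i j] unfolding T_def[abs_def] by simp
    then show "blinfun_apply (partial i (L j) x + (L j x o\<^sub>L L i x)) g = blinfun_apply (partial j (L i) x + (L i x o\<^sub>L L j x)) g"
      unfolding pL[OF x] L_def
      by (simp add: blinfun.add_left matrix_mul_assoc[symmetric] mm.add_right[symmetric])
  qed
  obtain g where g: "smooth_on \<Omega> g" "g x0 = mat 1" and pg: "\<And>x i. x \<in> \<Omega> \<Longrightarrow> partial i g x = L i x (g x)"
    using linear_total_system[OF \<Omega> x0 L flat, of "mat 1"] by blast
  have pg: "partial i g x = g x ** T i x" if "x \<in> \<Omega>" for x i
    using pg[OF that] by (simp add: L_def)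
  have skew: "transpose (T i x) = - T i x" for i x
  proof -
    have "transpose (T i x) $ r $ c = (- T i x) $ r $ c" for r c
      by (cases r; cases c) (auto simp: transpose_def T_def frame_connection_nth)
    then show ?thesis unfolding vec_eq_iff by blast
  qed
  \<comment> \<open>Since \<open>T\<close> acts on \<open>g\<close> from the right, it is
    \<open>g g\<^sup>t\<close> rather than \<open>g\<^sup>t g\<close> whose derivative cancels term
    by term.\<close>
  define h where "h y = g y ** transpose (g y)" for y
  have gt: "smooth_on \<Omega> (\<lambda>y. transpose (g y))" by (rule smooth_on_linear[OF bounded_linear_transpose \<Omega>(1) g(1)])
  have h: "smooth_on \<Omega> h" unfolding h_def[abs_def] by (rule smooth_on_bilinear[OF mm.bounded_bilinear_axioms \<Omega>(1) g(1) gt])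
  have ph: "partial i h x = 0" if x: "x \<in> \<Omega>" for i x
  proof -
    have "partial i h x = g x ** partial i (\<lambda>y. transpose (g y)) x + partial i g x ** transpose (g x)"
      unfolding h_def[abs_def]
      by (rule partial_bilinear[OF mm.bounded_bilinear_axioms smooth_on_differentiable[OF g(1) x] smooth_on_differentiable[OF gt x]])
    also have "partial i (\<lambda>y. transpose (g y)) x = - T i x ** transpose (g x)"
      unfolding partial_linear[OF bounded_linear_transpose smooth_on_differentiable[OF g(1) x]] pg[OF x]
      by (simp add: matrix_transpose_mul skew)
    also have "g x ** (- T i x ** transpose (g x)) + partial i g x ** transpose (g x) = 0"
      unfolding pg[OF x] by (simp add: mm.minus_left mm.minus_right matrix_mul_assoc)
    finally show ?thesis .
  qed
  have "(h has_derivative (\<lambda>_. 0)) (at x within \<Omega>)" if x: "x \<in> \<Omega>" for x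
  proof -
    have "D h x = (\<lambda>_. 0)"
      using D_partials[OF smooth_on_differentiable[OF h x]] by (simp add: ph[OF x] fun_eq_iff)
    then show ?thesis
      using has_derivative_D[OF smooth_on_differentiable[OF h x]] has_derivative_at_withinI by metis
  qed
  then have "h x = h x0" if "x \<in> \<Omega>" for x
    using has_derivative_zero_constant[OF \<Omega>(2), of h] that x0 by metis
  then have "orthogonal_matrix (g x)" if "x \<in> \<Omega>" for x
    using that g(2) by (simp add: h_def orthogonal_matrix matrix_left_right_inverse)
  then have "frame_solution \<Omega> A F g"
    using pg g(1) \<Omega>(1) unfolding T_def by (intro frame_solutionI) auto
  then show ?thesis by blast
qed

section \<open>Tangent and normal bundles of an immersion\<close>

lemma orth_proj_eqI:
  assumes S: "subspace S" and w: "w \<in> S" and orth: "\<And>s. s \<in> S \<Longrightarrow> (v - w) \<bullet> s = 0"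
  shows "orth_proj S v = w"
  unfolding orth_proj_def
proof (rule the_equality)
  show "w \<in> S \<and> (\<forall>s\<in>S. (v - w) \<bullet> s = 0)" using w orth by blast
  fix w' assume w': "w' \<in> S \<and> (\<forall>s\<in>S. (v - w') \<bullet> s = 0)"
  then have "w' - w \<in> S" using S w by (simp add: subspace_diff)
  then have "(v - w) \<bullet> (w' - w) = 0" "(v - w') \<bullet> (w' - w) = 0" using w' orth by auto
  then have "(w' - w) \<bullet> (w' - w) = 0" by (simp add: inner_diff_left)
  then show "w' = w" by simp
qed

lemma orth_proj_eq_0D:
  fixes S :: "'d::euclidean_space set"
  assumes S: "subspace S" and 0: "orth_proj S v = 0" and s: "s \<in> S"
  shows "v \<bullet> s = 0"
proof -
  have sp: "span S = S" using S by (simp add: span_eq_iff)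
  obtain y z where y: "y \<in> S" and z: "\<And>w. w \<in> S \<Longrightarrow> orthogonal z w" and v: "v = y + z"
    using orthogonal_subspace_decomp_exists[of S v] unfolding sp by metis
  have "orth_proj S v = y"
    by (rule orth_proj_eqI[OF S y]) (use z v in \<open>auto simp: orthogonal_def\<close>)
  then show ?thesis using 0 z[OF s] v by (simp add: orthogonal_def)
qed

lemma inner_sum_orthonormal:
  fixes N :: "'m::finite \<Rightarrow> 'd::real_inner"
  assumes "\<And>j k. N j \<bullet> N k = (if j = k then 1 else 0)"
  shows "(\<Sum>j\<in>J. c j *\<^sub>R N j) \<bullet> N k = (if k \<in> J then c k else 0)"
  by (simp add: inner_sum_left assms if_distrib cong: if_cong)

text \<open>The orthonormal vectors leave a complement of dimension \<open>CARD('n)\<close>, so the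
  inclusion of \<open>T\<close> in it is an equality by dimension.\<close>

lemma orthogonal_complement_frame:
  fixes N :: "'m::finite \<Rightarrow> real^('m + 'n::finite)" and T :: "(real^('m + 'n)) set"
  assumes N: "\<And>j k. N j \<bullet> N k = (if j = k then 1 else 0)"
    and T: "subspace T" "dim T = CARD('n)" and orth: "\<And>t j. t \<in> T \<Longrightarrow> t \<bullet> N j = 0"
  shows "T = {v. \<forall>j. v \<bullet> N j = 0}"
proof -
  let ?S = "span (range N)" and ?C = "{v. \<forall>j. v \<bullet> N j = 0}"
  have inj: "inj N" by (rule injI) (metis N zero_neq_one)
  have "pairwise orthogonal (range N)" using N by (auto simp: pairwise_def orthogonal_def)
  moreover have "0 \<notin> range N" using N by (metis imageE inner_zero_left zero_neq_one)
  ultimately have "independent (range N)" by (rule pairwise_orthogonal_independent)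
  then have "dim ?S = CARD('m)" using inj by (simp add: dim_eq_card_independent card_image)
  moreover have "dim {y \<in> UNIV. \<forall>x\<in>?S. orthogonal x y} + dim ?S = dim (UNIV :: (real^('m + 'n)) set)"
    by (rule dim_subspace_orthogonal_to_vectors) auto
  moreover have "{y \<in> UNIV. \<forall>x\<in>?S. orthogonal x y} = ?C"
  proof -
    have "(\<forall>x\<in>?S. orthogonal x y) \<longleftrightarrow> (\<forall>j. y \<bullet> N j = 0)"  for y
    proof
      assume "\<forall>x\<in>?S. orthogonal x y"
      then show "\<forall>j. y \<bullet> N j = 0" using span_base[of _ "range N"] by (auto simp: orthogonal_def inner_commute)
    next
      assume "\<forall>j. y \<bullet> N j = 0"
      then have "orthogonal y x" if "x \<in> ?S" for x
        using orthogonal_to_span[OF that, of y] by (auto simp: orthogonal_def)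
      then show "\<forall>x\<in>?S. orthogonal x y" by (simp add: orthogonal_commute)
    qed
    then show ?thesis by auto
  qed
  ultimately have "dim ?C = CARD('n)" by simp
  moreover have "subspace ?C" by (auto simp: subspace_def inner_add_left)
  moreover have "T \<subseteq> ?C" using orth by auto
  ultimately show ?thesis using T by (intro subspace_dim_equal) auto
qed

text \<open>The setting shared by the given immersion, its reparametrizations and the immersions
  built from solutions. Flatness of the tangent bundle and non-degeneracy enter as hypotheses of
  single lemmas.\<close>

locale normal_framed_immersion =
  fixes W :: "(real^'n::finite) set" and X :: "real^'n \<Rightarrow> real^('m::finite + 'n)"
    and N :: "'m \<Rightarrow> real^'n \<Rightarrow> real^('m + 'n)" and j1 :: 'm
  assumes normals: "parallel_normals W N" and X: "\<And>x. x \<in> W \<Longrightarrow> N j1 x = X x"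
    and inj: "\<And>x. x \<in> W \<Longrightarrow> inj (D X x)"
begin

lemma open_W: "open W" and N_smooth: "smooth_on W (N j)"
  and N_orth: "x \<in> W \<Longrightarrow> N j x \<bullet> N k x = (if j = k then 1 else 0)"
  and dN_orth: "x \<in> W \<Longrightarrow> partial i (N j) x \<bullet> N k x = 0"
  using normals unfolding parallel_normals_def by auto

lemma X_smooth: "smooth_on W X"
  by (rule smooth_on_cong[OF open_W N_smooth X])

lemma X_diff: "x \<in> W \<Longrightarrow> X differentiable (at x)"
  by (rule smooth_on_differentiable[OF X_smooth])

lemma N_diff: "x \<in> W \<Longrightarrow> N j differentiable (at x)"
  by (rule smooth_on_differentiable[OF N_smooth])

lemma partial_X: "x \<in> W \<Longrightarrow> partial i X x = partial i (N j1) x"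
  by (rule partial_cong[OF open_W _ X[symmetric]])

lemma D_X: "x \<in> W \<Longrightarrow> D X x u = D (N j1) x u"
  by (rule D_cong[OF open_W _ X[symmetric]])

lemma D_N_orth: "x \<in> W \<Longrightarrow> D (N j) x u \<bullet> N k x = 0"
  by (simp add: D_partials[OF N_diff] inner_sum_left dN_orth)

lemma tangent_space: "x \<in> W \<Longrightarrow> tangent_space X x = {v. \<forall>j. v \<bullet> N j x = 0}"
  unfolding tangent_space_def
proof (rule orthogonal_complement_frame)
  assume x: "x \<in> W"
  have lin: "linear (D X x)" by (rule linear_D[OF X_diff[OF x]])
  show "subspace (range (D X x))" using linear_subspace_image[OF lin] by simp
  show "dim (range (D X x)) = CARD('n)"
    using dim_image_eq[OF lin, of UNIV] inj[OF x] by (simp add: inj_on_subset)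
qed (auto simp: N_orth D_N_orth D_X)

lemma subspace_tangent: "x \<in> W \<Longrightarrow> subspace (tangent_space X x)"
  by (auto simp: tangent_space subspace_def inner_add_left)

lemma normal_space: "x \<in> W \<Longrightarrow> normal_space X x = {v. v = (\<Sum>j\<in>UNIV. (v \<bullet> N j x) *\<^sub>R N j x)}"
proof (intro equalityI subsetI)
  fix v assume x: "x \<in> W" and v: "v \<in> normal_space X x"
  let ?w = "v - (\<Sum>j\<in>UNIV. (v \<bullet> N j x) *\<^sub>R N j x)"
  have wN: "?w \<bullet> N k x = 0" for k
    by (simp add: inner_diff_left inner_sum_orthonormal[OF N_orth[OF x]])
  then have "v \<bullet> ?w = 0" using v tangent_space[OF x] unfolding normal_space_def by blast
  moreover have "?w \<bullet> (\<Sum>j\<in>UNIV. c j *\<^sub>R N j x) = 0" for c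
    by (simp only: inner_sum_right inner_scaleR_right wN mult_zero_right sum.neutral_const)
  then have "(\<Sum>j\<in>UNIV. (v \<bullet> N j x) *\<^sub>R N j x) \<bullet> ?w = 0" by (subst inner_commute)
  ultimately have "?w \<bullet> ?w = 0" by (simp add: inner_diff_left)
  then show "v \<in> {v. v = (\<Sum>j\<in>UNIV. (v \<bullet> N j x) *\<^sub>R N j x)}" by simp
next
  fix v assume x: "x \<in> W" and v: "v \<in> {v. v = (\<Sum>j\<in>UNIV. (v \<bullet> N j x) *\<^sub>R N j x)}"
  have "(\<Sum>j\<in>UNIV. (v \<bullet> N j x) *\<^sub>R N j x) \<bullet> t = 0" if "t \<in> tangent_space X x" for t
    using that unfolding tangent_space[OF x] inner_sum_left inner_scaleR_left
    by (intro sum.neutral) (auto simp: inner_commute)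
  then show "v \<in> normal_space X x" unfolding normal_space_def using v by auto
qed

lemma normal_sum: "x \<in> W \<Longrightarrow> (\<Sum>j\<in>J. c j *\<^sub>R N j x) \<in> normal_space X x"
  unfolding normal_space_def by (auto simp: tangent_space inner_sum_left inner_sum_right inner_commute intro!: sum.neutral)

lemma sphere_normal_sum:
  "x \<in> W \<Longrightarrow> j1 \<notin> J \<Longrightarrow> (\<Sum>j\<in>J. c j *\<^sub>R N j x) \<in> sphere_normal_space X x"
  unfolding sphere_normal_space_def X[symmetric] using normal_sum
  by (auto simp: inner_sum_orthonormal[OF N_orth])

lemma sphere_normal_space:
  assumes x: "x \<in> W" and v: "v \<in> sphere_normal_space X x"
  shows "v = (\<Sum>j\<in>-{j1}. (v \<bullet> N j x) *\<^sub>R N j x)"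
proof -
  have "v = (\<Sum>j\<in>UNIV. (v \<bullet> N j x) *\<^sub>R N j x)" and "v \<bullet> N j1 x = 0"
    using v normal_space[OF x] X[OF x] unfolding sphere_normal_space_def by auto
  moreover have "(\<Sum>j\<in>UNIV. (v \<bullet> N j x) *\<^sub>R N j x)
      = (v \<bullet> N j1 x) *\<^sub>R N j1 x + (\<Sum>j\<in>UNIV - {j1}. (v \<bullet> N j x) *\<^sub>R N j x)"
    by (rule sum.remove) auto
  ultimately show ?thesis by (simp add: Compl_eq_Diff_UNIV)
qed

lemma subspace_sphere_normal: "subspace (sphere_normal_space X x)"
  unfolding sphere_normal_space_def normal_space_def by (auto simp: subspace_def inner_add_left)

lemma nabla_sphere_normal:
  assumes x: "x \<in> W"
  shows "nabla (sphere_normal_space X) i s x = (\<Sum>j\<in>-{j1}. (partial i s x \<bullet> N j x) *\<^sub>R N j x)"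
  unfolding nabla_def
proof (rule orth_proj_eqI[OF subspace_sphere_normal sphere_normal_sum[OF x]])
  fix v assume "v \<in> sphere_normal_space X x"
  note v = sphere_normal_space[OF x this]
  have z: "(partial i s x - (\<Sum>j\<in>-{j1}. (partial i s x \<bullet> N j x) *\<^sub>R N j x)) \<bullet> (\<Sum>j\<in>-{j1}. c j *\<^sub>R N j x) = 0" for c
    unfolding inner_sum_right
    by (intro sum.neutral) (simp add: inner_diff_left inner_sum_orthonormal[OF N_orth[OF x]])
  show "(partial i s x - (\<Sum>j\<in>-{j1}. (partial i s x \<bullet> N j x) *\<^sub>R N j x)) \<bullet> v = 0"
    using z[of "\<lambda>j. v \<bullet> N j x"] unfolding v[symmetric] .
qed simp

lemma parallel_frame: "parallel_frame j1 W X N"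
proof -
  have "parallel_section W (sphere_normal_space X) (N j)" if "j \<noteq> j1" for j
  proof -
    have "N j x \<in> sphere_normal_space X x" if "x \<in> W" for x
      using sphere_normal_sum[OF that, of "{j}" "\<lambda>_. 1"] \<open>j \<noteq> j1\<close> by simp
    then show ?thesis
      unfolding parallel_section_def smooth_section_def using N_smooth
      by (auto simp: nabla_sphere_normal dN_orth)
  qed
  then show ?thesis unfolding parallel_frame_def using X N_orth by blast
qed

text \<open>In a parallel frame the normal connection acts on the coefficient functions by plain
  partial derivatives, and these commute.\<close>

lemma flat_sphere_normal: "flat_bundle W (sphere_normal_space X)"
  unfolding flat_bundle_def
proof (intro allI impI ballI)
  fix s x i k assume s: "smooth_section W (sphere_normal_space X) s" and x: "x \<in> W"
  have ss: "smooth_on W s" and sE: "\<And>x. x \<in> W \<Longrightarrow> s x \<in> sphere_normal_space X x"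
    using s unfolding smooth_section_def by auto
  have sin: "smooth_on W (\<lambda>y. s y \<bullet> N j y)" for j by (intro smooth_intros open_W ss N_smooth)
  have dN: "partial i (N j) y \<bullet> s y = 0" if y: "y \<in> W" for i j y
    using arg_cong[OF sphere_normal_space[OF y sE[OF y]], of "\<lambda>v. partial i (N j) y \<bullet> v"] dN_orth[OF y]
    by (simp add: inner_sum_right)
  have d1: "partial i s y \<bullet> N j y = partial i (\<lambda>y. s y \<bullet> N j y) y" if y: "y \<in> W" for i j y
    using partial_inner[OF smooth_on_differentiable[OF ss y] N_diff[OF y], of i j] dN[OF y, of i j]
    by (simp add: inner_commute)
  define n where "n i y = (\<Sum>j\<in>-{j1}. partial i (\<lambda>y. s y \<bullet> N j y) y *\<^sub>R N j y)" for i y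
  have n: "nabla (sphere_normal_space X) i s y = n i y" if "y \<in> W" for i y
    by (simp add: nabla_sphere_normal[OF that] n_def d1[OF that])
  have n_smooth: "smooth_on W (n i)" for i
    unfolding n_def by (intro smooth_intros open_W sin N_smooth)
  have d2: "partial k (n i) x \<bullet> N j x = partial k (partial i (\<lambda>y. s y \<bullet> N j y)) x" if "j \<noteq> j1" for i k j
  proof -
    have "partial k (n i) x = (\<Sum>l\<in>-{j1}. partial i (\<lambda>y. s y \<bullet> N l y) x *\<^sub>R partial k (N l) x
        + partial k (partial i (\<lambda>y. s y \<bullet> N l y)) x *\<^sub>R N l x)"
      unfolding n_def[abs_def]
      by (simp add: partial_sum partial_scaleR smooth_on_differentiable[OF _ x] smooth_intros open_W sin N_smooth)
    then show ?thesis
      using that by (simp add: sum.distrib inner_add_left inner_sum_left dN_orth[OF x] N_orth[OF x] if_distrib cong: if_cong)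
  qed
  have "nabla (sphere_normal_space X) k (nabla (sphere_normal_space X) i s) x
      = (\<Sum>j\<in>-{j1}. partial k (partial i (\<lambda>y. s y \<bullet> N j y)) x *\<^sub>R N j x)" for i k
  proof -
    have "partial k (nabla (sphere_normal_space X) i s) x = partial k (n i) x"
      by (rule partial_cong[OF open_W x n])
    then show ?thesis unfolding nabla_sphere_normal[OF x] by (intro sum.cong) (simp_all add: d2)
  qed
  note comm = this
  show "nabla (sphere_normal_space X) i (nabla (sphere_normal_space X) k s) x
      = nabla (sphere_normal_space X) k (nabla (sphere_normal_space X) i s) x"
    unfolding comm by (intro sum.cong refl arg_cong2[where f = scaleR] partial_commute[OF open_W sin x])
qed

lemma nabla_tangent:
  assumes x: "x \<in> W"
  shows "nabla (tangent_space X) i s x = partial i s x - (\<Sum>j\<in>UNIV. (partial i s x \<bullet> N j x) *\<^sub>R N j x)"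
  unfolding nabla_def
proof (rule orth_proj_eqI[OF subspace_tangent[OF x]])
  show "partial i s x - (\<Sum>j\<in>UNIV. (partial i s x \<bullet> N j x) *\<^sub>R N j x) \<in> tangent_space X x"
    by (simp add: tangent_space[OF x] inner_diff_left inner_sum_orthonormal[OF N_orth[OF x]])
  fix t assume "t \<in> tangent_space X x"
  then have "N j x \<bullet> t = 0" for j by (simp add: tangent_space[OF x] inner_commute)
  then show "(partial i s x - (partial i s x - (\<Sum>j\<in>UNIV. (partial i s x \<bullet> N j x) *\<^sub>R N j x))) \<bullet> t = 0"
    by (simp add: inner_sum_left)
qed

text \<open>For tangent \<open>s\<close> the covariant derivative is \<open>\<partial>\<^sub>is + \<Sum>\<^sub>j \<langle>s, \<partial>\<^sub>iN\<^sub>j\<rangle> N\<^sub>j\<close>, and the second derivatives of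
  \<open>s\<close> drop out of the commutator.\<close>

lemma tangent_curvature:
  assumes s: "smooth_section W (tangent_space X) s" and x: "x \<in> W"
  shows "nabla (tangent_space X) k (nabla (tangent_space X) i s) x - nabla (tangent_space X) i (nabla (tangent_space X) k s) x
    = (\<Sum>j\<in>UNIV. (s x \<bullet> partial i (N j) x) *\<^sub>R partial k (N j) x) - (\<Sum>j\<in>UNIV. (s x \<bullet> partial k (N j) x) *\<^sub>R partial i (N j) x)"
proof -
  have ss: "smooth_on W s" and sN: "\<And>y j. y \<in> W \<Longrightarrow> s y \<bullet> N j y = 0"
    using s unfolding smooth_section_def by (auto simp: tangent_space)
  have sd: "partial i s y \<bullet> N j y = - (s y \<bullet> partial i (N j) y)" if y: "y \<in> W" for i j y
    by (rule partial_inner_constant[OF open_W y ss N_smooth sN])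
  define n where "n i y = partial i s y + (\<Sum>j\<in>UNIV. (s y \<bullet> partial i (N j) y) *\<^sub>R N j y)" for i y
  have n: "nabla (tangent_space X) i s y = n i y" if "y \<in> W" for i y
    by (simp add: nabla_tangent[OF that] n_def sd[OF that] sum_negf)
  \<comment> \<open>Tangential projection at the fixed point \<open>x\<close>. It annihilates
    combinations of the \<open>N j\<close> and fixes the derivatives of the
    \<open>N j\<close>.\<close>
  define P where "P v = v - (\<Sum>j\<in>UNIV. (v \<bullet> N j x) *\<^sub>R N j x)" for v
  have P_add: "P (v + w) = P v + P w" for v w
    by (simp add: P_def inner_add_left scaleR_add_left sum.distrib)
  have P_fix: "P v = v" if "\<And>j. v \<bullet> N j x = 0" for v using that by (simp add: P_def)
  have P_kill: "P (\<Sum>j\<in>UNIV. c j *\<^sub>R N j x) = 0" for c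
    by (simp add: P_def inner_sum_orthonormal[OF N_orth[OF x]])
  have main: "nabla (tangent_space X) k (nabla (tangent_space X) i s) x
      = P (partial k (partial i s) x) + (\<Sum>j\<in>UNIV. (s x \<bullet> partial i (N j) x) *\<^sub>R partial k (N j) x)" for i k
  proof -
    have "partial k (nabla (tangent_space X) i s) x = partial k (n i) x"
      by (rule partial_cong[OF open_W x n])
    also have "\<dots> = partial k (partial i s) x + partial k (\<lambda>y. \<Sum>j\<in>UNIV. (s y \<bullet> partial i (N j) y) *\<^sub>R N j y) x"
      unfolding n_def[abs_def]
      by (intro partial_add smooth_on_differentiable[OF _ x] smooth_intros open_W ss N_smooth)
    also have "partial k (\<lambda>y. \<Sum>j\<in>UNIV. (s y \<bullet> partial i (N j) y) *\<^sub>R N j y) x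
        = (\<Sum>j\<in>UNIV. (s x \<bullet> partial i (N j) x) *\<^sub>R partial k (N j) x) + (\<Sum>j\<in>UNIV. partial k (\<lambda>y. s y \<bullet> partial i (N j) y) x *\<^sub>R N j x)"
      by (simp add: partial_sum partial_scaleR sum.distrib smooth_on_differentiable[OF _ x] smooth_intros open_W ss N_smooth)
    finally have "P (partial k (nabla (tangent_space X) i s) x) = P (partial k (partial i s) x)
        + (P (\<Sum>j\<in>UNIV. (s x \<bullet> partial i (N j) x) *\<^sub>R partial k (N j) x) + 0)"
      by (simp only: P_add P_kill)
    also have "P (\<Sum>j\<in>UNIV. (s x \<bullet> partial i (N j) x) *\<^sub>R partial k (N j) x) = (\<Sum>j\<in>UNIV. (s x \<bullet> partial i (N j) x) *\<^sub>R partial k (N j) x)"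
      by (rule P_fix) (simp add: inner_sum_left dN_orth[OF x])
    finally show ?thesis unfolding nabla_tangent[OF x] P_def by simp
  qed
  show ?thesis unfolding main partial_commute[OF open_W ss x, of k i] by simp
qed

end

text \<open>Parallelism controls only the components of \<open>dN\<close> that are normal inside the
  sphere. The components along the position vector vanish because \<open>N j\<close> is orthogonal
  to \<open>dX\<close>, and differentiating a constant inner product moves the derivative
  across.\<close>

lemma normal_framed_immersionI:
  fixes X :: "real^'n::finite \<Rightarrow> real^('m::finite + 'n)"
  assumes imm: "sphere_immersion U X" and PF: "parallel_frame j1 U X N"
  shows "normal_framed_immersion U X N j1"
proof
  have U: "open U" and X: "smooth_on U X" and inj: "\<And>x. x \<in> U \<Longrightarrow> inj (D X x)"
    using imm unfolding sphere_immersion_def by auto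
  have j1: "\<And>x. x \<in> U \<Longrightarrow> N j1 x = X x" and on: "\<And>x j k. x \<in> U \<Longrightarrow> N j x \<bullet> N k x = (if j = k then 1 else 0)"
    and par: "\<And>j. j \<noteq> j1 \<Longrightarrow> parallel_section U (sphere_normal_space X) (N j)"
    using PF unfolding parallel_frame_def by auto
  show "inj (D X x)" if "x \<in> U" for x using inj[OF that] .
  show "N j1 x = X x" if "x \<in> U" for x using j1[OF that] .
  have N: "smooth_on U (N j)" for j
  proof (cases "j = j1")
    case True
    show ?thesis unfolding True by (rule smooth_on_cong[OF U X]) (simp add: j1)
  next
    case False
    then show ?thesis using par unfolding parallel_section_def smooth_section_def by blast
  qed
  have sub: "subspace (sphere_normal_space X x)" for x
    unfolding sphere_normal_space_def normal_space_def by (auto simp: subspace_def inner_add_left)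
  have mem: "N j x \<in> sphere_normal_space X x" if "j \<noteq> j1" "x \<in> U" for j x
    using par that unfolding parallel_section_def smooth_section_def by blast
  have skew: "partial i (N j) x \<bullet> N k x = - (N j x \<bullet> partial i (N k) x)" if x: "x \<in> U" for i j k x
    by (rule partial_inner_constant[OF U x N N]) (rule on)
  have pX: "partial i (N j1) x \<bullet> N j x = 0" if x: "x \<in> U" for i j x
  proof (cases "j = j1")
    case True
    then show ?thesis using skew[OF x, of i j1 j1] by (simp add: inner_commute)
  next
    case False
    have "D X x (axis i 1) \<in> tangent_space X x" by (simp add: tangent_space_def)
    then have "N j x \<bullet> partial i X x = 0"
      using mem[OF False x] unfolding sphere_normal_space_def normal_space_def partial_def by blast
    moreover have "partial i X x = partial i (N j1) x" by (rule partial_cong[OF U x]) (simp add: j1)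
    ultimately show ?thesis by (simp add: inner_commute)
  qed
  have "partial i (N j) x \<bullet> N k x = 0" if x: "x \<in> U" for i j k x
  proof (cases "j = j1 \<or> k = j1")
    case True
    then show ?thesis using pX[OF x] skew[OF x, of i j k] by (auto simp: inner_commute)
  next
    case False
    have "orth_proj (sphere_normal_space X x) (partial i (N j) x) = 0"
      using par False x unfolding parallel_section_def nabla_def by blast
    then show ?thesis using orth_proj_eq_0D[OF sub _ mem] False x by blast
  qed
  then show "parallel_normals U N" unfolding parallel_normals_def using U N on by blast
qed

text \<open>In the basis \<open>v\<close>, which diagonalizes all the forms at once, a shape
  operator is diagonal; division by \<open>a j1 i\<close> compensates for the stretching of
  \<open>v i\<close> by \<open>dX\<close>. The operators are thus the image of a space of diagonals
  under the injective linear map \<open>\<Lambda>\<close>.\<close>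

lemma dim_shape_operators:
  fixes N :: "'m::finite \<Rightarrow> real^'n::finite \<Rightarrow> 'd::euclidean_space" and v :: "'n \<Rightarrow> real^'n"
  assumes X: "X differentiable (at p)" and N: "\<And>j. N j differentiable (at p)" and inj: "inj (D X p)"
    and NN: "\<And>j k. N j p \<bullet> N k p = (if j = k then 1 else 0)"
    and e: "\<And>i k. e i \<bullet> e k = (if i = k then 1 else 0)"
    and DX: "\<And>i. D X p (v i) = a j1 i *\<^sub>R e i" and DN: "\<And>i j. D (N j) p (v i) = a j i *\<^sub>R e i"
    and nz: "\<And>i. a j1 i \<noteq> 0" and \<nu>: "\<And>c. (\<Sum>j\<in>J. c j *\<^sub>R N j p) \<in> \<nu>"
  shows "dim (shape_operators \<nu> J X N p) = dim {d :: real^'n. \<exists>c. \<forall>i. d $ i = (\<Sum>j\<in>J. c j * a j i) / a j1 i}"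
proof -
  interpret DX: linear "D X p" by (rule linear_D[OF X])
  have linN: "linear (D (N j) p)" for j by (rule linear_D[OF N])
  define Q where "Q = (\<chi> r i. v i $ r)"
  have Qv: "Q *v w = (\<Sum>i\<in>UNIV. w $ i *\<^sub>R v i)" for w
    by (simp add: Q_def matrix_vector_mult_def vec_eq_iff mult.commute)
  have DQ: "D X p (Q *v w) = (\<Sum>i\<in>UNIV. (w $ i * a j1 i) *\<^sub>R e i)" for w
    unfolding Qv by (simp add: DX.sum DX.scaleR DX)
  have DQe: "D X p (Q *v w) \<bullet> e k = w $ k * a j1 k" for w k
    unfolding DQ by (simp add: inner_sum_orthonormal[OF e])
  have "inj ((*v) Q)"
  proof (rule injI)
    fix w w' assume "Q *v w = Q *v w'"
    then have "w $ k * a j1 k = w' $ k * a j1 k" for k using DQe by metis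
    then show "w = w'" using nz by (simp add: vec_eq_iff)
  qed
  then obtain R where R: "R ** Q = mat 1" using matrix_left_invertible_injective by blast
  then have QR: "Q ** R = mat 1" by (simp add: matrix_left_right_inverse)
  define \<Lambda> where "\<Lambda> d = Q ** (\<chi> r c. if r = c then d $ r else 0) ** R" for d :: "real^'n"
  have \<Lambda>: "\<Lambda> d *v (Q *v w) = Q *v (\<chi> i. d $ i * w $ i)" for d w
  proof -
    have "\<Lambda> d *v (Q *v w) = Q *v ((\<chi> r c. if r = c then d $ r else 0) *v w)"
      unfolding \<Lambda>_def by (simp add: matrix_vector_mul_assoc matrix_mul_assoc[symmetric] R)
    also have "(\<chi> r c. if r = c then d $ r else 0) *v w = (\<chi> i. d $ i * w $ i)"
      by (simp add: matrix_vector_mult_def vec_eq_iff if_distrib[of "\<lambda>x. x * _"] cong: if_cong)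
    finally show ?thesis .
  qed
  let ?L = "{d :: real^'n. \<exists>c. \<forall>i. d $ i = (\<Sum>j\<in>J. c j * a j i) / a j1 i}"
  have "shape_operators \<nu> J X N p = \<Lambda> ` ?L"
  proof (intro equalityI subsetI)
    fix S assume "S \<in> shape_operators \<nu> J X N p"
    then obtain n where n: "\<And>u w. D X p (S *v u) \<bullet> D X p w = second_form J X N p u w \<bullet> n"
      unfolding shape_operators_def by blast
    define c where "c j = N j p \<bullet> n" for j
    have S: "D X p (S *v u) \<bullet> D X p w = (\<Sum>j\<in>J. c j * (D (N j) p u \<bullet> D X p w))" for u w
      unfolding n second_form_def c_def by (simp add: inner_sum_left mult.commute)
    define d where "d = (\<chi> i. (\<Sum>j\<in>J. c j * a j i) / a j1 i)"
    have "S *v v i = d $ i *\<^sub>R v i" for i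
    proof -
      have da: "d $ i * a j1 i = (\<Sum>j\<in>J. c j * a j i)" using nz[of i] by (simp add: d_def)
      have "D X p (S *v v i) \<bullet> D X p w = D X p (d $ i *\<^sub>R v i) \<bullet> D X p w" for w
        unfolding S DN DX.scaleR DX scaleR_scaleR da by (simp add: sum_distrib_right mult.assoc)
      \<comment> \<open>The second argument is chosen so that the product is the squared norm of the
        difference of the two images.\<close>
      then have "(D X p (S *v v i) - D X p (d $ i *\<^sub>R v i)) \<bullet> D X p (S *v v i - d $ i *\<^sub>R v i) = 0"
        by (simp add: inner_diff_left)
      then have "D X p (S *v v i) = D X p (d $ i *\<^sub>R v i)" by (simp add: DX.diff)
      then show ?thesis using inj by (simp add: inj_def)
    qed
    then have "S *v (Q *v w) = Q *v (\<chi> i. d $ i * w $ i)" for w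
      unfolding Qv by (simp add: matrix_vector_mult_scaleR linear_sum[OF matrix_vector_mul_linear] mult.commute)
    then have "(S ** Q) *v w = (\<Lambda> d ** Q) *v w" for w using \<Lambda> by (simp add: matrix_vector_mul_assoc)
    then have "S ** Q = \<Lambda> d ** Q" by (simp add: matrix_eq)
    then have "S ** (Q ** R) = \<Lambda> d ** (Q ** R)" by (simp add: matrix_mul_assoc)
    then have "S = \<Lambda> d" by (simp add: QR)
    moreover have "d \<in> ?L" by (auto simp: d_def)
    ultimately show "S \<in> \<Lambda> ` ?L" by blast
  next
    fix S assume "S \<in> \<Lambda> ` ?L"
    then obtain d c where S: "S = \<Lambda> d" and d: "\<And>i. d $ i = (\<Sum>j\<in>J. c j * a j i) / a j1 i" by blast
    let ?n = "\<Sum>j\<in>J. c j *\<^sub>R N j p"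
    have "D X p (S *v u) \<bullet> D X p w = second_form J X N p u w \<bullet> ?n" for u w
    proof -
      define z where "z = R *v u"
      have u: "u = Q *v z" unfolding z_def by (simp add: matrix_vector_mul_assoc QR)
      have DNu: "D (N j) p u = (\<Sum>i\<in>UNIV. (z $ i * a j i) *\<^sub>R e i)" for j
        unfolding u Qv by (simp add: linear_sum[OF linN] linear_scale[OF linN] DN)
      have "second_form J X N p u w \<bullet> ?n = (\<Sum>j\<in>J. c j * (D (N j) p u \<bullet> D X p w))"
        unfolding second_form_def inner_sum_right
        by (intro sum.cong) (auto simp: inner_sum_orthonormal[OF NN])
      also have "\<dots> = (\<Sum>j\<in>J. c j *\<^sub>R D (N j) p u) \<bullet> D X p w" by (simp add: inner_sum_left)
      also have "(\<Sum>j\<in>J. c j *\<^sub>R D (N j) p u) = (\<Sum>i\<in>UNIV. \<Sum>j\<in>J. (c j * (z $ i * a j i)) *\<^sub>R e i)"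
        unfolding DNu scaleR_sum_right by (subst sum.swap) simp
      also have "\<dots> = (\<Sum>i\<in>UNIV. (d $ i * z $ i * a j1 i) *\<^sub>R e i)"
      proof -
        have da: "d $ i * a j1 i = (\<Sum>j\<in>J. c j * a j i)" for i using nz[of i] d[of i] by simp
        have "(\<Sum>j\<in>J. c j * (z $ i * a j i)) = z $ i * (\<Sum>j\<in>J. c j * a j i)" for i
          by (simp add: sum_distrib_left mult_ac)
        then have "(\<Sum>j\<in>J. c j * (z $ i * a j i)) = d $ i * z $ i * a j1 i" for i
          by (simp add: da[symmetric] mult_ac)
        then show ?thesis by (simp add: scaleR_sum_left[symmetric])
      qed
      also have "\<dots> = D X p (S *v u)" unfolding S u \<Lambda> DQ by simp
      finally show ?thesis by simp
    qed
    then show "S \<in> shape_operators \<nu> J X N p" unfolding shape_operators_def using \<nu> by blast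
  qed
  moreover have "linear \<Lambda>"
    unfolding \<Lambda>_def
    by (rule linearI) (auto simp: matrix_matrix_mult_def vec_eq_iff sum_distrib_left sum_distrib_right sum.distrib[symmetric] algebra_simps if_distrib intro!: sum.cong)
  moreover have "inj \<Lambda>"
  proof (rule injI)
    fix d d' assume "\<Lambda> d = \<Lambda> d'"
    then have "Q *v (\<chi> i. d $ i * w $ i) = Q *v (\<chi> i. d' $ i * w $ i)" for w using \<Lambda> by metis
    from this[of "\<chi> i. 1"] have "Q *v d = Q *v d'" by simp
    then show "d = d'" using \<open>inj ((*v) Q)\<close> by (simp add: inj_def)
  qed
  ultimately show ?thesis by (simp add: dim_image_eq inj_on_subset)
qed

text \<open>As \<open>transpose A\<close> is a left inverse of \<open>A\<close>, the coefficients
  \<open>A *v z\<close> realize any prescribed diagonal, where \<open>z\<close> is the diagonal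
  multiplied by row \<open>j1\<close>.\<close>

lemma dim_full_shape:
  fixes A :: "real^'n::finite^'m::finite"
  assumes orth: "transpose A ** A = mat 1" and nz: "\<And>i. A $ j1 $ i \<noteq> 0"
  shows "dim {d :: real^'n. \<exists>c. \<forall>i. d $ i = (\<Sum>j\<in>UNIV. c j * A $ j $ i) / A $ j1 $ i} = CARD('n)"
proof -
  have "\<exists>c. \<forall>i. d $ i = (\<Sum>j\<in>UNIV. c j * A $ j $ i) / A $ j1 $ i" for d :: "real^'n"
  proof -
    define z where "z = (\<chi> i. d $ i * A $ j1 $ i)"
    have "transpose A *v (A *v z) = z"
      using orth by (simp only: matrix_vector_mul_assoc matrix_vector_mul_lid)
    then have "(\<Sum>j\<in>UNIV. (A *v z) $ j * A $ j $ i) = d $ i * A $ j1 $ i" for i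
      by (simp add: vec_eq_iff transpose_def matrix_vector_mult_def z_def mult.commute del: transpose_matrix_vector)
    then show ?thesis using nz by (intro exI[of _ "\<lambda>j. (A *v z) $ j"]) simp
  qed
  then show ?thesis by (simp add: dim_UNIV)
qed

text \<open>If \<open>r\<close> is the row \<open>j\<^sub>1\<close> of \<open>A\<close>, then \<open>A\<^sup>t\<close> annihilates \<open>e\<^bsub>j\<^sub>1\<^esub> - A r\<close>, whose \<open>j\<^sub>1\<close>-component is
  \<open>1 - |r|\<^sup>2\<close>. It serves to clear the coefficient with index \<open>j\<^sub>1\<close> when \<open>|r| \<noteq> 1\<close>, and it vanishes
  when \<open>|r| = 1\<close>.\<close>

lemma dim_sphere_shape:
  fixes A :: "real^'n::finite^'m::finite"
  assumes orth: "transpose A ** A = mat 1" and nz: "\<And>i. A $ j1 $ i \<noteq> 0"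
  shows "dim {d :: real^'n. \<exists>c. \<forall>i. d $ i = (\<Sum>j\<in>-{j1}. c j * A $ j $ i) / A $ j1 $ i} < CARD('n)
    \<longleftrightarrow> (\<Sum>i\<in>UNIV. (A $ j1 $ i)\<^sup>2) = 1" (is "dim ?L < _ \<longleftrightarrow> ?n = 1")
proof -
  define r where "r = A $ j1"
  have rr: "r \<bullet> r = ?n" by (simp add: r_def inner_vec_def power2_eq_square)
  have AtA: "transpose A *v (A *v z) = z" for z
    using orth by (simp only: matrix_vector_mul_assoc matrix_vector_mul_lid)
  have AtA_nth: "(\<Sum>j\<in>UNIV. (A *v z) $ j * A $ j $ i) = z $ i" for z i
    using AtA[of z]
    by (simp add: vec_eq_iff transpose_def matrix_vector_mult_def mult.commute del: transpose_matrix_vector)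
  have Ar: "(A *v z) $ j1 = r \<bullet> z" for z by (simp add: r_def matrix_vector_mult_def inner_vec_def)
  have split: "(\<Sum>j\<in>UNIV. f j) = f j1 + (\<Sum>j\<in>-{j1}. f j)" for f :: "'m \<Rightarrow> real"
    using sum.remove[of UNIV j1 f] by (simp add: Compl_eq_Diff_UNIV)
  show ?thesis
  proof
    assume n: "?n = 1"
    have inner: "(A *v z) \<bullet> (A *v z) = z \<bullet> z" for z
      using dot_lmul_matrix[of "A *v z" A z] AtA[of z] by (simp add: inner_commute)
    \<comment> \<open>\<open>A\<close> preserves norms and \<open>r\<close> has norm 1, but the
      \<open>j1\<close> component of \<open>A *v r\<close> alone is already
      \<open>r \<bullet> r = 1\<close>; nothing is left for the others.\<close>
    have "(A *v r) $ j = 0" if "j \<noteq> j1" for j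
    proof -
      have "(\<Sum>j\<in>-{j1}. ((A *v r) $ j)\<^sup>2) = 0"
        using inner[of r] split[of "\<lambda>j. ((A *v r) $ j)\<^sup>2"] Ar[of r] rr n
        by (simp add: inner_vec_def power2_eq_square)
      then show ?thesis using that by (simp add: sum_nonneg_eq_0_iff)
    qed
    then have row: "(\<Sum>i\<in>UNIV. A $ j $ i * A $ j1 $ i) = 0" if "j \<noteq> j1" for j
      using that by (simp add: r_def matrix_vector_mult_def)
    \<comment> \<open>Against these weights the division by row \<open>j1\<close> cancels, and what
      remains is the orthogonality of row \<open>j1\<close> to the other rows.\<close>
    define w where "w = (\<chi> i. (A $ j1 $ i)\<^sup>2)"
    have "w \<bullet> d = 0" if "d \<in> ?L" for d
    proof -
      from that obtain c where d: "\<And>i. d $ i = (\<Sum>j\<in>-{j1}. c j * A $ j $ i) / A $ j1 $ i" by blast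
      have "w \<bullet> d = (\<Sum>i\<in>UNIV. A $ j1 $ i * (\<Sum>j\<in>-{j1}. c j * A $ j $ i))"
        unfolding w_def inner_vec_def d using nz by (intro sum.cong) (auto simp: power2_eq_square)
      also have "\<dots> = (\<Sum>j\<in>-{j1}. c j * (\<Sum>i\<in>UNIV. A $ j $ i * A $ j1 $ i))"
        unfolding sum_distrib_left by (subst sum.swap) (simp add: mult_ac)
      also have "\<dots> = 0" by (intro sum.neutral) (simp add: row)
      finally show ?thesis .
    qed
    then have "?L \<subseteq> {d. w \<bullet> d = 0}" by blast
    then have "dim ?L \<le> dim {d. w \<bullet> d = 0}" by (rule dim_subset)
    moreover have "w \<noteq> 0" using nz by (auto simp: w_def vec_eq_iff)
    then have "dim {d. w \<bullet> d = 0} = CARD('n) - 1" by (simp add: dim_hyperplane)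
    moreover have "CARD('n) > 0" by simp
    ultimately show "dim ?L < CARD('n)" by linarith
  next
    assume dim: "dim ?L < CARD('n)"
    show "?n = 1"
    proof (rule ccontr)
      assume n: "?n \<noteq> 1"
      have "\<exists>c. \<forall>i. d $ i = (\<Sum>j\<in>-{j1}. c j * A $ j $ i) / A $ j1 $ i" for d :: "real^'n"
      proof -
        define z where "z = (\<chi> i. d $ i * A $ j1 $ i)"
        define t where "t = (A *v z) $ j1 / (1 - ?n)"
        define c where "c j = (A *v z) $ j - t * ((if j = j1 then 1 else 0) - (A *v r) $ j)" for j
        have "(\<Sum>j\<in>UNIV. c j * A $ j $ i) = (\<Sum>j\<in>UNIV. (A *v z) $ j * A $ j $ i)
            - t * ((\<Sum>j\<in>UNIV. (if j = j1 then 1 else 0) * A $ j $ i) - (\<Sum>j\<in>UNIV. (A *v r) $ j * A $ j $ i))" for i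
          unfolding c_def by (simp add: left_diff_distrib right_diff_distrib sum_subtractf sum_distrib_left mult_ac)
        then have "(\<Sum>j\<in>UNIV. c j * A $ j $ i) = d $ i * A $ j1 $ i" for i
          unfolding AtA_nth by (simp add: z_def r_def if_distrib[of "\<lambda>x. x * _"] cong: if_cong)
        moreover have "c j1 = 0" unfolding c_def using n Ar[of r] rr by (simp add: t_def)
        ultimately have "(\<Sum>j\<in>-{j1}. c j * A $ j $ i) = d $ i * A $ j1 $ i" for i using split by simp
        then show ?thesis using nz by (intro exI[of _ c]) simp
      qed
      then have "?L = UNIV" by blast
      then show False using dim by (simp add: dim_UNIV)
    qed
  qed
qed

text \<open>\<open>transpose A\<close> annihilates \<open>k\<close>. For a square matrix
  \<open>k\<close> lies in the range of \<open>A\<close>, on which \<open>transpose A\<close> is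
  injective. So \<open>k = 0\<close>, and its component \<open>j1\<close> is 1 minus the squared
  norm of the row.\<close>

lemma square_orthogonal_row_norm:
  fixes A :: "real^'n::finite^'m::finite"
  assumes orth: "transpose A ** A = mat 1" and card: "CARD('m) = CARD('n)"
  shows "(\<Sum>i\<in>UNIV. (A $ j1 $ i)\<^sup>2) = 1"
proof -
  define k where "k = axis j1 1 - A *v (A $ j1)"
  have AtA: "transpose A *v (A *v z) = z" for z
    using orth by (simp only: matrix_vector_mul_assoc matrix_vector_mul_lid)
  have "inj ((*v) A)" by (rule injI) (metis AtA)
  then have "dim (range ((*v) A)) = dim (UNIV :: (real^'m) set)"
    using dim_image_eq[OF matrix_vector_mul_linear, of A UNIV] card by (simp add: inj_on_subset)
  then have "span (range ((*v) A)) = UNIV" using dim_eq_full[of "range ((*v) A)"] by simp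
  moreover have "subspace (range ((*v) A))" using linear_subspace_image[OF matrix_vector_mul_linear subspace_UNIV] .
  ultimately have "range ((*v) A) = UNIV" by (metis span_eq_iff)
  then obtain z where z: "k = A *v z" by (metis UNIV_I imageE)
  have "transpose A *v axis j1 1 = A $ j1"
    by (simp add: vec_eq_iff transpose_def matrix_vector_mult_def axis_def if_distrib cong: if_cong del: transpose_matrix_vector)
  then have "transpose A *v k = 0"
    unfolding k_def by (simp add: matrix_vector_mult_diff_distrib AtA del: transpose_matrix_vector)
  then have "k = 0" using AtA[of z] z by simp
  then have "k $ j1 = 0" by simp
  then show ?thesis
    by (simp add: k_def matrix_vector_mult_def axis_def power2_eq_square)
qed

section \<open>Principal frames and curvature coordinates\<close>

lemma fundamental_formsI:
  fixes N :: "'m::finite \<Rightarrow> real^'n::finite \<Rightarrow> real^('m + 'n)"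
  assumes A: "smooth_on W A" and orth: "\<And>x. x \<in> W \<Longrightarrow> transpose (A x) ** A x = mat 1"
    and e: "\<And>x i k. x \<in> W \<Longrightarrow> e i x \<bullet> e k x = (if i = k then 1 else 0)"
    and DN: "\<And>x j u. x \<in> W \<Longrightarrow> D (N j) x u = (\<Sum>i\<in>UNIV. (A x $ j $ i * u $ i) *\<^sub>R e i x)"
    and DY: "\<And>x u. x \<in> W \<Longrightarrow> D Y x u = D (N j1) x u"
  shows "fundamental_forms j1 W Y N A"
  unfolding fundamental_forms_def
proof (intro conjI ballI allI A orth)
  fix x u w assume x: "x \<in> W"
  have DNe: "D (N j) x u \<bullet> e i x = A x $ j $ i * u $ i" for j u i
    unfolding DN[OF x] by (simp add: inner_sum_orthonormal[OF e[OF x]])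
  have DND: "D (N j) x u \<bullet> D (N j1) x w = (\<Sum>i\<in>UNIV. A x $ j1 $ i * A x $ j $ i * (u $ i * w $ i))" for j u w
    unfolding DN[OF x, of j1] by (simp add: inner_sum_right DNe mult_ac)
  show "first_form Y x u w = (\<Sum>i\<in>UNIV. (A x $ j1 $ i)\<^sup>2 * (u $ i * w $ i))"
    unfolding first_form_def DY[OF x] DND by (simp add: power2_eq_square)
  show "second_form (- {j1}) Y N x u w =
      (\<Sum>i\<in>UNIV. \<Sum>j\<in>- {j1}. (A x $ j1 $ i * A x $ j $ i * (u $ i * w $ i)) *\<^sub>R N j x)"
    unfolding second_form_def DY[OF x] DND scaleR_sum_left by (rule sum.swap)
qed

text \<open>Non-vanishing of row \<open>j1\<close> makes \<open>dX\<close> injective. Distinct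
  columns of \<open>A\<close> are orthogonal, so the curvature sums of the tangent bundle vanish;
  the \<open>N j\<close> have tangent derivatives, so they form a parallel frame and the normal
  bundle is flat.\<close>

lemma immersion_of_moving_frame:
  fixes N :: "'m::finite \<Rightarrow> real^'n::finite \<Rightarrow> real^('m + 'n)"
  assumes MF: "moving_frame W N e A F" and A: "smooth_on W A"
    and orth: "\<And>x. x \<in> W \<Longrightarrow> transpose (A x) ** A x = mat 1"
    and nz: "\<And>x i. x \<in> W \<Longrightarrow> A x $ j1 $ i \<noteq> 0"
  shows "flat_sphere_immersion j1 W (N j1) N" "fundamental_forms j1 W (N j1) N A"
proof -
  note W = moving_frameD(1)[OF MF] and N = moving_frameD(2)[OF MF]
    and on = orthonormal_pairD[OF moving_frameD(4)[OF MF]] and wein = moving_frameD(5)[OF MF]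
  have DN: "D (N j) x u = (\<Sum>i\<in>UNIV. (A x $ j $ i * u $ i) *\<^sub>R e i x)" if x: "x \<in> W" for j x u
    unfolding D_partials[OF smooth_on_differentiable[OF N x]] by (simp add: wein[OF x] mult.commute)
  have DNe: "D (N j) x u \<bullet> e i x = A x $ j $ i * u $ i" if x: "x \<in> W" for j x u i
    unfolding DN[OF x] by (simp add: inner_sum_orthonormal[OF on(2)[OF x]])
  have inj: "inj (D (N j1) x)" if x: "x \<in> W" for x
  proof (rule injI)
    fix u w assume "D (N j1) x u = D (N j1) x w"
    then have "A x $ j1 $ i * u $ i = A x $ j1 $ i * w $ i" for i by (metis DNe[OF x])
    then show "u = w" using nz[OF x] by (simp add: vec_eq_iff)
  qed
  interpret normal_framed_immersion W "N j1" N j1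
    by unfold_locales (auto simp: parallel_normals_def W N on wein inj)
  have AA: "(\<Sum>j\<in>UNIV. A x $ j $ i * A x $ j $ k) = 0" if "x \<in> W" "i \<noteq> k" for x i k
  proof -
    have "(\<Sum>j\<in>UNIV. A x $ j $ i * A x $ j $ k) = (transpose (A x) ** A x) $ i $ k"
      by (simp add: matrix_matrix_mult_def transpose_def)
    then show ?thesis using orth[OF that(1)] that(2) by (simp add: mat_def)
  qed
  have curv: "(\<Sum>j\<in>UNIV. (s \<bullet> partial i (N j) x) *\<^sub>R partial k (N j) x) = 0" if x: "x \<in> W" and ik: "i \<noteq> k" for s x i k
  proof -
    have "(\<Sum>j\<in>UNIV. (s \<bullet> partial i (N j) x) *\<^sub>R partial k (N j) x)
        = ((\<Sum>j\<in>UNIV. A x $ j $ i * A x $ j $ k) * (s \<bullet> e i x)) *\<^sub>R e k x"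
      unfolding sum_distrib_right scaleR_sum_left by (intro sum.cong) (simp_all add: wein[OF x] mult_ac)
    then show ?thesis by (simp add: AA[OF x ik])
  qed
  have "flat_bundle W (tangent_space (N j1))"
    unfolding flat_bundle_def
  proof (intro allI impI ballI)
    fix s x i k assume s: "smooth_section W (tangent_space (N j1)) s" and x: "x \<in> W"
    show "nabla (tangent_space (N j1)) i (nabla (tangent_space (N j1)) k s) x
        = nabla (tangent_space (N j1)) k (nabla (tangent_space (N j1)) i s) x"
      using tangent_curvature[OF s x, of k i] curv[OF x, of k i] curv[OF x, of i k] by (cases "i = k") auto
  qed
  moreover have "nondegenerate_normal_bundle W (N j1) N"
    unfolding nondegenerate_normal_bundle_def
  proof
    fix x assume x: "x \<in> W"
    have "dim (shape_operators (normal_space (N j1) x) UNIV (N j1) N x)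
        = dim {d :: real^'n. \<exists>c. \<forall>i. d $ i = (\<Sum>j\<in>UNIV. c j * A x $ j $ i) / A x $ j1 $ i}"
    proof (rule dim_shape_operators[where v = "\<lambda>i. axis i 1" and e = "\<lambda>i. e i x"])
      show "D (N j1) x (axis i 1) = A x $ j1 $ i *\<^sub>R e i x" "D (N j) x (axis i 1) = A x $ j $ i *\<^sub>R e i x" for i j
        unfolding partial_def[symmetric] by (rule wein[OF x])+
    qed (auto simp: X_diff N_diff inj on nz normal_sum x)
    also have "\<dots> = CARD('n)" by (rule dim_full_shape[OF orth[OF x] nz[OF x]])
    finally show "dim (shape_operators (normal_space (N j1) x) UNIV (N j1) N x) = CARD('n)" .
  qed
  moreover have "sphere_immersion W (N j1)"
    unfolding sphere_immersion_def using W N inj on(1)[of _ j1 j1] by (auto simp: norm_eq_1)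
  ultimately show "flat_sphere_immersion j1 W (N j1) N"
    unfolding flat_sphere_immersion_def using parallel_frame flat_sphere_normal by blast
  show "fundamental_forms j1 W (N j1) N A"
    by (rule fundamental_formsI[OF A orth on(2) DN]) auto
qed

text \<open>The system \<open>df = c \<eta>\<close>, \<open>dc = 0\<close> for a pair
  \<open>(f, c)\<close> is linear with coefficients \<open>\<eta> s\<close> times the nilpotent
  \<open>K\<close>. Compositions of coefficients vanish, so flatness reduces to closedness, and the
  initial value \<open>(0, 1)\<close> keeps \<open>c = 1\<close>.\<close>

lemma closed_form_exact:
  fixes \<eta> :: "'n::finite \<Rightarrow> real^'n \<Rightarrow> real"
  assumes \<Omega>: "open \<Omega>" "convex \<Omega>" "x0 \<in> \<Omega>" and \<eta>: "\<And>s. smooth_on \<Omega> (\<eta> s)"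
    and closed: "\<And>x r s. x \<in> \<Omega> \<Longrightarrow> partial r (\<eta> s) x = partial s (\<eta> r) x"
  obtains f where "smooth_on \<Omega> f" "\<And>x s. x \<in> \<Omega> \<Longrightarrow> partial s f x = \<eta> s x"
proof -
  define K :: "(real \<times> real) \<Rightarrow>\<^sub>L (real \<times> real)" where "K = Blinfun (\<lambda>z. (snd z, 0))"
  have K: "blinfun_apply K z = (snd z, 0)" for z
  proof -
    have "bounded_linear (\<lambda>z :: real \<times> real. (snd z, 0 :: real))"
      by (intro bounded_linear_Pair bounded_linear_snd bounded_linear_zero)
    then show ?thesis unfolding K_def by (simp add: bounded_linear_Blinfun_apply)
  qed
  have KK: "K o\<^sub>L K = 0" by (rule blinfun_eqI) (simp add: K zero_prod_def)
  define L where "L s x = \<eta> s x *\<^sub>R K" for s x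
  have L: "smooth_on \<Omega> (L s)" for s unfolding L_def[abs_def] by (intro smooth_intros \<Omega> \<eta>)
  have pL: "partial r (L s) x = partial r (\<eta> s) x *\<^sub>R K" if "x \<in> \<Omega>" for r s x
    unfolding L_def[abs_def]
    using partial_linear[OF bounded_linear_scaleR_left[of K] smooth_on_differentiable[OF \<eta> that]] .
  have LL: "L s x o\<^sub>L L r x = 0" for r s x
    unfolding L_def by (simp add: bounded_bilinear.scaleR_left[OF bounded_bilinear_blinfun_compose]
        bounded_bilinear.scaleR_right[OF bounded_bilinear_blinfun_compose] KK)
  obtain y where y: "smooth_on \<Omega> y" "y x0 = (0, 1)" and py: "\<And>x s. x \<in> \<Omega> \<Longrightarrow> partial s y x = L s x (y x)"
  proof -
    have "partial i (L j) x + (L j x o\<^sub>L L i x) = partial j (L i) x + (L i x o\<^sub>L L j x)" if "x \<in> \<Omega>" for x i j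
      unfolding LL pL[OF that] closed[OF that, of i j] ..
    from linear_total_system[OF \<Omega> L this, of "(0, 1)"] show ?thesis using that by blast
  qed
  have psnd: "partial s (\<lambda>x. snd (y x)) x = 0" if "x \<in> \<Omega>" for s x
    unfolding partial_linear[OF bounded_linear_snd smooth_on_differentiable[OF y(1) that]] py[OF that]
    by (simp add: L_def K blinfun.scaleR_left)
  have s: "smooth_on \<Omega> (\<lambda>x. snd (y x))" by (rule smooth_on_linear[OF bounded_linear_snd \<Omega>(1) y(1)])
  have "((\<lambda>x. snd (y x)) has_derivative (\<lambda>_. 0)) (at x within \<Omega>)" if x: "x \<in> \<Omega>" for x
  proof -
    have "D (\<lambda>x. snd (y x)) x = (\<lambda>_. 0)"
      using D_partials[OF smooth_on_differentiable[OF s x]] by (simp add: psnd[OF x] fun_eq_iff)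
    then show ?thesis
      using has_derivative_D[OF smooth_on_differentiable[OF s x]] has_derivative_at_withinI by metis
  qed
  from has_derivative_zero_constant[OF \<Omega>(2) this] obtain c where "\<And>x. x \<in> \<Omega> \<Longrightarrow> snd (y x) = c" by blast
  then have snd: "snd (y x) = 1" if "x \<in> \<Omega>" for x using that \<Omega>(3) y(2) by (metis snd_conv)
  show ?thesis
  proof
    show "smooth_on \<Omega> (\<lambda>x. fst (y x))" by (rule smooth_on_linear[OF bounded_linear_fst \<Omega>(1) y(1)])
    show "partial s (\<lambda>x. fst (y x)) x = \<eta> s x" if "x \<in> \<Omega>" for x s
      unfolding partial_linear[OF bounded_linear_fst smooth_on_differentiable[OF y(1) that]] py[OF that]
      by (simp add: L_def K blinfun.scaleR_left snd[OF that])
  qed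
qed

section \<open>Principal directions of a parallel normal frame\<close>

lemma inner_sums:
  fixes a :: "'r::finite \<Rightarrow> 'd::real_inner" and b :: "'s::finite \<Rightarrow> 'd"
  shows "(\<Sum>i\<in>UNIV. u $ i *\<^sub>R a i) \<bullet> (\<Sum>l\<in>UNIV. w $ l *\<^sub>R b l)
    = (\<Sum>i\<in>UNIV. \<Sum>l\<in>UNIV. (u $ i * w $ l) * (a i \<bullet> b l))"
  by (simp only: inner_sum_left) (simp add: inner_sum_right sum_distrib_left mult_ac)

lemma inner_matrix_vector_mult:
  fixes M :: "real^'s::finite^'r::finite"
  shows "x \<bullet> (M *v y) = (\<Sum>r\<in>UNIV. \<Sum>s\<in>UNIV. (x $ r * y $ s) * M $ r $ s)"
  by (simp add: inner_vec_def matrix_vector_mult_def sum_distrib_left mult_ac)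

context normal_framed_immersion
begin

text \<open>Since \<open>dN\<close> is orthogonal to all normals, the product of first derivatives
  equals, up to sign, a second derivative of \<open>N k\<close> paired with \<open>N j\<close>. With
  one index equal to \<open>j1\<close> this is the symmetry of a second fundamental form; otherwise
  it is the Ricci equation.\<close>

lemma dN_symmetric:
  assumes x: "x \<in> W"
  shows "D (N j) x u \<bullet> D (N k) x w = D (N j) x w \<bullet> D (N k) x u"
proof -
  have p: "partial i (N j) x \<bullet> partial l (N k) x = - (N j x \<bullet> partial i (partial l (N k)) x)" for i l
    by (rule partial_inner_constant[OF open_W x N_smooth smooth_on_partial[OF N_smooth], where c = 0])
      (simp add: dN_orth inner_commute[of "N j _"])
  have sym: "partial i (N j) x \<bullet> partial l (N k) x = partial l (N j) x \<bullet> partial i (N k) x" for i l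
    unfolding p partial_commute[OF open_W N_smooth x, of i l] ..
  have "D (N j) x u \<bullet> D (N k) x w = (\<Sum>i\<in>UNIV. \<Sum>l\<in>UNIV. (u $ i * w $ l) * (partial i (N j) x \<bullet> partial l (N k) x))" for u w
    unfolding D_partials[OF N_diff[OF x]] by (rule inner_sums)
  note ex = this
  have "D (N j) x u \<bullet> D (N k) x w = (\<Sum>i\<in>UNIV. \<Sum>l\<in>UNIV. (u $ i * w $ l) * (partial l (N j) x \<bullet> partial i (N k) x))"
    unfolding ex by (subst sym) (rule refl)
  also have "\<dots> = D (N j) x w \<bullet> D (N k) x u"
    unfolding ex by (subst sum.swap) (simp add: mult_ac)
  finally show ?thesis .
qed

text \<open>Transported to the tangent space through \<open>dX\<close>, the \<open>dN j\<close>
  become operators \<open>L j\<close>, with \<open>L j1\<close> the identity. The symmetry against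
  \<open>j1\<close> is self-adjointness; for general pairs it makes the commutators vanish.\<close>

lemma principal_frame:
  assumes x: "x \<in> W"
  obtains v and \<mu> :: "'m \<Rightarrow> 'n \<Rightarrow> real" where "\<And>i k. D X x (v i) \<bullet> D X x (v k) = (if i = k then 1 else 0)"
    "\<And>j i. D (N j) x (v i) = \<mu> j i *\<^sub>R D X x (v i)"
proof -
  have lin: "linear (D X x)" by (rule linear_D[OF X_diff[OF x]])
  obtain g where g: "linear g" "g \<circ> D X x = id"
    using linear_injective_left_inverse[OF lin inj[OF x]] by blast
  define L where "L j t = D (N j) x (g t)" for j t
  have L: "linear (L j)" for j
    unfolding L_def[abs_def] using linear_compose[OF g(1) linear_D[OF N_diff[OF x]]] by (simp add: o_def)
  have LX: "L j (D X x u) = D (N j) x u" for j u using g(2) by (simp add: L_def pointfree_idE)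
  let ?T = "tangent_space X x"
  have T: "\<And>t. t \<in> ?T \<Longrightarrow> \<exists>u. t = D X x u" by (auto simp: tangent_space_def)
  have dim: "dim ?T = CARD('n)"
    unfolding tangent_space_def using dim_image_eq[OF lin, of UNIV] inj[OF x] by (simp add: inj_on_subset)
  have inv: "L j t \<in> ?T" if "t \<in> ?T" for j t
    using T[OF that] by (auto simp: LX tangent_space[OF x] D_N_orth[OF x])
  have prod: "L j s \<bullet> L k t = L j t \<bullet> L k s" if "s \<in> ?T" "t \<in> ?T" for j k s t
    using T[OF that(1)] T[OF that(2)] dN_symmetric[OF x] by (auto simp: LX)
  have id: "L j1 t = t" if "t \<in> ?T" for t using T[OF that] LX D_X[OF x] by metis
  have sym: "L j s \<bullet> t = s \<bullet> L j t" if "s \<in> ?T" "t \<in> ?T" for j s t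
    using prod[OF that, of j j1] id that by (simp add: inner_commute)
  have comm: "L j (L k t) = L k (L j t)" if t: "t \<in> ?T" for j k t
  proof -
    let ?d = "L j (L k t) - L k (L j t)"
    have dT: "?d \<in> ?T" using inv t subspace_tangent[OF x] by (simp add: subspace_diff)
    \<comment> \<open>Moving one operator across each product writes the squared norm of the
      commutator as a difference that \<open>prod\<close> cancels.\<close>
    have "?d \<bullet> ?d = L k t \<bullet> L j ?d - L j t \<bullet> L k ?d"
      using sym inv t dT by (simp add: inner_diff_left)
    also have "\<dots> = 0" using prod[OF t dT, of k j] by (simp add: inner_commute)
    finally show ?thesis by simp
  qed
  obtain e :: "'n \<Rightarrow> real^('m + 'n)" and \<mu> where e: "\<And>i. e i \<in> ?T" "\<And>i k. e i \<bullet> e k = (if i = k then 1 else 0)"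
    "\<And>j i. L j (e i) = \<mu> j i *\<^sub>R e i"
    by (rule simultaneous_diagonalization[of ?T L, OF subspace_tangent[OF x] L dim inv sym comm]) blast+
  have "\<forall>i. \<exists>u. e i = D X x u" using e(1) T by blast
  then obtain v where v: "\<And>i. e i = D X x (v i)" by metis
  show ?thesis using that[of v \<mu>] e(2,3) unfolding v LX by blast
qed

text \<open>If two columns of eigenvalues agreed, every diagonal would have equal entries at
  \<open>i\<close> and \<open>k\<close>; the shape operators would then correspond to a subset of a
  hyperplane.\<close>

lemma nondegenerate_distinct:
  fixes \<mu> :: "'m \<Rightarrow> 'n \<Rightarrow> real"
  assumes x: "x \<in> W" and dim: "dim (shape_operators (normal_space X x) UNIV X N x) = CARD('n)"
    and on: "\<And>i k. D X x (v i) \<bullet> D X x (v k) = (if i = k then 1 else 0)"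
    and eig: "\<And>j i. D (N j) x (v i) = \<mu> j i *\<^sub>R D X x (v i)" and ik: "i \<noteq> k"
  shows "\<exists>j. \<mu> j i \<noteq> \<mu> j k"
proof (rule ccontr)
  assume "\<not> ?thesis"
  then have eq: "\<mu> j i = \<mu> j k" for j by blast
  have one: "\<mu> j1 i = 1" for i
  proof -
    have "D X x (v i) = \<mu> j1 i *\<^sub>R D X x (v i)" using eig[of j1 i] D_X[OF x] by simp
    then have "D X x (v i) \<bullet> D X x (v i) = \<mu> j1 i * (D X x (v i) \<bullet> D X x (v i))" by (metis inner_scaleR_left)
    then show ?thesis using on by simp
  qed
  let ?L = "{d :: real^'n. \<exists>c. \<forall>i. d $ i = (\<Sum>j\<in>UNIV. c j * \<mu> j i) / \<mu> j1 i}"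
  have "dim (shape_operators (normal_space X x) UNIV X N x) = dim ?L"
    by (rule dim_shape_operators[where v = v and e = "\<lambda>i. D X x (v i)"])
      (auto simp: X_diff N_diff inj on eig one normal_sum x N_orth)
  then have "CARD('n) = dim ?L" using dim by simp
  also have "?L \<subseteq> {d. (axis i 1 - axis k 1) \<bullet> d = 0}"
    using eq by (auto simp: inner_diff_left inner_axis' one)
  then have "dim ?L \<le> dim {d :: real^'n. (axis i 1 - axis k 1) \<bullet> d = 0}" by (rule dim_subset)
  also have "\<dots> = CARD('n) - 1"
    using ik by (subst dim_hyperplane) (auto simp: axis_eq_axis)
  finally have "CARD('n) \<le> CARD('n) - 1" .
  moreover have "CARD('n) > 0" by simp
  ultimately show False by linarith
qed

text \<open>Near a point, a generic linear combination \<open>K\<close> of the \<open>dN\<^sub>j\<close> with constant coefficients has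
  simple eigenvalues relative to \<open>dX\<close>. Its eigenvectors depend smoothly on the point, and they
  diagonalize all the \<open>dN\<^sub>j\<close>, since these commute with \<open>K\<close>.\<close>

lemma smooth_principal_frame:
  assumes p0: "p0 \<in> W" and dim: "dim (shape_operators (normal_space X p0) UNIV X N p0) = CARD('n)"
  obtains V v where "open V" "p0 \<in> V" "V \<subseteq> W" "\<And>i :: 'n. smooth_on V (v i)"
    "\<And>p i k. p \<in> V \<Longrightarrow> D X p (v i p) \<bullet> D X p (v k p) = (if i = k then 1 else 0)"
    "\<And>p i k j. p \<in> V \<Longrightarrow> i \<noteq> k \<Longrightarrow> D (N j) p (v i p) \<bullet> D X p (v k p) = 0"
proof -
  obtain v0 and \<mu> :: "'m \<Rightarrow> 'n \<Rightarrow> real" where on0: "\<And>i k. D X p0 (v0 i) \<bullet> D X p0 (v0 k) = (if i = k then 1 else 0)"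
    and eig0: "\<And>j i. D (N j) p0 (v0 i) = \<mu> j i *\<^sub>R D X p0 (v0 i)"
    using principal_frame[OF p0] by metis
  define m :: "'n \<Rightarrow> real^'m" where "m i = (\<chi> j. \<mu> j i)" for i
  have one: "m i $ j1 = 1" for i
  proof -
    have "D X p0 (v0 i) = \<mu> j1 i *\<^sub>R D X p0 (v0 i)" using eig0[of j1 i] D_X[OF p0] by simp
    then have "D X p0 (v0 i) \<bullet> D X p0 (v0 i) = \<mu> j1 i * (D X p0 (v0 i) \<bullet> D X p0 (v0 i))" by (metis inner_scaleR_left)
    then show ?thesis using on0 by (simp add: m_def)
  qed
  have distinct: "m i \<noteq> m k" if "i \<noteq> k" for i k
    using nondegenerate_distinct[OF p0 dim on0 eig0 that] by (auto simp: m_def vec_eq_iff)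
  \<comment> \<open>Avoiding the columns makes the eigenvalues of the combination non-zero, as the
    smooth eigenvector lemma demands; avoiding the differences makes them simple. The columns are
    non-zero by their entry 1 at \<open>j1\<close>.\<close>
  let ?S = "m ` UNIV \<union> (\<lambda>(i, k). m i - m k) ` {(i, k). i \<noteq> k}"
  have "finite ?S" by simp
  moreover have "0 \<notin> ?S"
  proof -
    have "m i \<noteq> 0" for i using one[of i] by (metis zero_index zero_neq_one)
    then show ?thesis using distinct by (auto simp: image_iff)
  qed
  ultimately obtain c where c: "\<And>s. s \<in> ?S \<Longrightarrow> c \<bullet> s \<noteq> 0" using avoid_hyperplanes by metis
  define \<kappa> where "\<kappa> i = c \<bullet> m i" for i
  have \<kappa>: "\<kappa> i \<noteq> 0" for i using c[of "m i"] by (auto simp: \<kappa>_def)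
  have \<kappa>d: "\<kappa> i \<noteq> \<kappa> k" if "i \<noteq> k" for i k
    using c[of "m i - m k"] that by (auto simp: \<kappa>_def inner_diff_right image_iff)
  define K where "K p u = (\<Sum>j\<in>UNIV. c $ j *\<^sub>R D (N j) p u)" for p u
  \<comment> \<open>Coordinate matrices of the combined form and of the metric, which turn the
    problem into a generalized eigenvalue problem for matrices.\<close>
  define B where "B p = (\<chi> r s. (\<Sum>j\<in>UNIV. c $ j *\<^sub>R partial r (N j) p) \<bullet> partial s X p)" for p
  define G where "G p = (\<chi> r s. partial r X p \<bullet> partial s X p)" for p
  have sB: "smooth_on W B" and sG: "smooth_on W G"
    unfolding B_def G_def by (intro smooth_intros open_W N_smooth X_smooth)+
  have G: "x \<bullet> (G p *v y) = D X p x \<bullet> D X p y" if p: "p \<in> W" for p x y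
    unfolding D_partials[OF X_diff[OF p]] G_def inner_matrix_vector_mult inner_sums by simp
  have B: "x \<bullet> (B p *v y) = K p x \<bullet> D X p y" if p: "p \<in> W" for p x y
  proof -
    have "K p x = (\<Sum>r\<in>UNIV. x $ r *\<^sub>R (\<Sum>j\<in>UNIV. c $ j *\<^sub>R partial r (N j) p))"
      unfolding K_def D_partials[OF N_diff[OF p]] scaleR_sum_right by (subst sum.swap) (simp add: mult.commute)
    then show ?thesis
      unfolding D_partials[OF X_diff[OF p]] B_def inner_matrix_vector_mult by (simp add: inner_sums)
  qed
  have Ksym: "K p x \<bullet> D (N j) p y = K p y \<bullet> D (N j) p x" if "p \<in> W" for p x y j
    unfolding K_def by (simp add: inner_sum_left dN_symmetric[OF that, of _ x _ y])
  have KX: "K p x \<bullet> D X p y = K p y \<bullet> D X p x" if "p \<in> W" for p x y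
    using Ksym[OF that, of x j1 y] by (simp add: D_X[OF that])
  have K0: "K p0 (v0 i) = \<kappa> i *\<^sub>R D X p0 (v0 i)" for i
    unfolding K_def eig0 \<kappa>_def inner_vec_def by (simp add: scaleR_sum_left m_def)
  have expand: "u = (\<Sum>k\<in>UNIV. (D X p0 u \<bullet> D X p0 (v0 k)) *\<^sub>R v0 k)" for u
  proof -
    interpret DX: linear "D X p0" by (rule linear_D[OF X_diff[OF p0]])
    have pair: "orthonormal_pair (\<lambda>j. N j p0) (\<lambda>i. D X p0 (v0 i))"
      unfolding orthonormal_pair_def using N_orth[OF p0] on0 D_N_orth[OF p0] by (auto simp: D_X[OF p0] inner_commute)
    have "D X p0 u \<bullet> N j p0 = 0" for j using D_N_orth[OF p0] by (simp add: D_X[OF p0])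
    then have "D X p0 u = (\<Sum>k\<in>UNIV. (D X p0 u \<bullet> D X p0 (v0 k)) *\<^sub>R D X p0 (v0 k))"
      using orthonormal_pair_expansion[OF pair, of "D X p0 u"] by simp
    also have "\<dots> = D X p0 (\<Sum>k\<in>UNIV. (D X p0 u \<bullet> D X p0 (v0 k)) *\<^sub>R v0 k)"
      by (simp add: DX.sum DX.scaleR)
    finally show ?thesis using inj[OF p0] by (rule injD[rotated])
  qed
  have "\<exists>V v. open V \<and> p0 \<in> V \<and> V \<subseteq> W \<and> smooth_on V v \<and> v p0 = v0 i \<and>
      (\<forall>p\<in>V. B p *v v p = (v p \<bullet> (B p *v v p)) *\<^sub>R (G p *v v p) \<and> v p \<bullet> (G p *v v p) = 1)" for i
  proof -
    have eigB: "B p0 *v v0 i = \<kappa> i *\<^sub>R (G p0 *v v0 i)"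
      by (rule vector_eq_ldot[THEN iffD1, rule_format])
        (simp add: B[OF p0] G[OF p0] KX[OF p0, of _ "v0 i"] K0 inner_commute)
    have unit: "v0 i \<bullet> (G p0 *v v0 i) = 1" by (simp add: G[OF p0] on0)
    have simple: "\<exists>t. w = t *\<^sub>R v0 i" if w: "B p0 *v w = \<kappa> i *\<^sub>R (G p0 *v w)" for w
    proof -
      have z: "D X p0 w \<bullet> D X p0 (v0 k) = 0" if "k \<noteq> i" for k
      proof -
        have "v0 k \<bullet> (B p0 *v w) = \<kappa> k * (D X p0 w \<bullet> D X p0 (v0 k))"
          by (simp add: B[OF p0] K0 inner_commute)
        moreover have "v0 k \<bullet> (B p0 *v w) = \<kappa> i * (D X p0 w \<bullet> D X p0 (v0 k))"
          unfolding w by (simp add: G[OF p0] inner_commute)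
        ultimately show ?thesis using \<kappa>d[OF that] by simp
      qed
      have "w = (\<Sum>k\<in>UNIV. (D X p0 w \<bullet> D X p0 (v0 k)) *\<^sub>R v0 k)" by (rule expand)
      also have "\<dots> = (\<Sum>k\<in>UNIV. if k = i then (D X p0 w \<bullet> D X p0 (v0 i)) *\<^sub>R v0 i else 0)"
        by (intro sum.cong) (auto simp: z)
      finally show ?thesis by auto
    qed
    have symB: "x \<bullet> (B p0 *v y) = y \<bullet> (B p0 *v x)" for x y
      by (simp add: B[OF p0] KX[OF p0, of x y])
    have symG: "x \<bullet> (G p0 *v y) = y \<bullet> (G p0 *v x)" for x y
      by (simp add: G[OF p0] inner_commute)
    show ?thesis
      by (rule smooth_generalized_eigenvector[OF open_W p0 sB sG symB symG eigB unit \<kappa> simple]) blast+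
  qed
  then obtain V v where V: "\<And>i. open (V i)" "\<And>i. p0 \<in> V i" "\<And>i. V i \<subseteq> W" "\<And>i. smooth_on (V i) (v i)" "\<And>i. v i p0 = v0 i"
    and Veig: "\<And>i p. p \<in> V i \<Longrightarrow> B p *v v i p = (v i p \<bullet> (B p *v v i p)) *\<^sub>R (G p *v v i p)"
    and Vunit: "\<And>i p. p \<in> V i \<Longrightarrow> v i p \<bullet> (G p *v v i p) = 1"
    by metis
  define V1 where "V1 = (\<Inter>i. V i)"
  have V1: "open V1" "p0 \<in> V1" "V1 \<subseteq> W"
    using V(1,2) V(3)[of undefined] by (auto simp: V1_def intro: open_INT)
  have sv: "smooth_on V1 (v i)" for i by (rule smooth_on_subset[OF V(4)]) (auto simp: V1_def)
  define h where "h i p = v i p \<bullet> (B p *v v i p)" for i p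
  have h: "continuous_on V1 (h i)" for i
    unfolding h_def by (intro smooth_on_continuous smooth_intros V1 sv smooth_on_subset[OF sB])
  \<comment> \<open>Here the eigenvalues \<open>h i\<close> of the combination remain pairwise
    distinct. The final intersection with \<open>V1\<close> matters when there is no pair of
    distinct indices, that is for n = 1.\<close>
  define V2 where "V2 = (\<Inter>q\<in>{(i, k). i \<noteq> k}. V1 \<inter> (\<lambda>p. h (fst q) p - h (snd q) p) -` (- {0})) \<inter> V1"
  have "open V2"
    unfolding V2_def by (intro open_Int open_INT V1 ballI continuous_open_preimage continuous_intros h) auto
  moreover have "p0 \<in> V2"
    using V1(2) \<kappa>d by (auto simp: V2_def h_def V(5) B[OF p0] K0 on0)
  moreover have V2W: "V2 \<subseteq> W" using V1 by (auto simp: V2_def)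
  moreover have "smooth_on V2 (v i)" for i by (rule smooth_on_subset[OF sv]) (auto simp: V2_def)
  moreover have off: "D X p (v i p) \<bullet> D X p (v k p) = 0 \<and> D (N j) p (v i p) \<bullet> D X p (v k p) = 0" if p: "p \<in> V2" and ik: "i \<noteq> k" for p i k j
  proof -
    have pW: "p \<in> W" using V2W p by blast
    have pV: "p \<in> V i" for i using p by (auto simp: V2_def V1_def)
    have "p \<in> V1 \<inter> (\<lambda>p. h (fst (i, k)) p - h (snd (i, k)) p) -` (- {0})" using p ik unfolding V2_def by blast
    then have hd: "h i p \<noteq> h k p" by simp
    have K: "K p (v i p) \<bullet> D X p y = h i p * (D X p (v i p) \<bullet> D X p y)" for i y
    proof -
      have "y \<bullet> (B p *v v i p) = h i p * (y \<bullet> (G p *v v i p))"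
        using arg_cong[OF Veig[OF pV[of i]], of "\<lambda>z. y \<bullet> z"] by (simp add: h_def)
      then show ?thesis unfolding B[OF pW] G[OF pW] KX[OF pW, of y] by (simp add: inner_commute)
    qed
    have Kv: "K p (v i p) \<bullet> D (N j) p y = h i p * (D X p (v i p) \<bullet> D (N j) p y)" for i j y
    proof -
      have "D (N j) p y \<in> tangent_space X p" by (simp add: tangent_space[OF pW] D_N_orth[OF pW])
      then obtain z where "D (N j) p y = D X p z" by (auto simp: tangent_space_def)
      then show ?thesis using K by simp
    qed
    have "h i p * (D X p (v i p) \<bullet> D X p (v k p)) = h k p * (D X p (v i p) \<bullet> D X p (v k p))"
      using K[of i "v k p"] K[of k "v i p"] KX[OF pW, of "v i p" "v k p"] by (auto simp: inner_commute)
    \<comment> \<open>The symmetry between \<open>K\<close> and \<open>dN j\<close>, evaluated on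
      two eigenvectors of \<open>K\<close>, gives one number multiplied by either of two distinct
      eigenvalues.\<close>
    moreover have "h k p * (D (N j) p (v i p) \<bullet> D X p (v k p)) = h i p * (D (N j) p (v i p) \<bullet> D X p (v k p))"
    proof -
      have "h k p * (D X p (v k p) \<bullet> D (N j) p (v i p)) = h i p * (D X p (v i p) \<bullet> D (N j) p (v k p))"
        using Kv[of k j "v i p"] Kv[of i j "v k p"] Ksym[OF pW, of "v k p" j "v i p"] by simp
      also have "D X p (v i p) \<bullet> D (N j) p (v k p) = D X p (v k p) \<bullet> D (N j) p (v i p)"
        using dN_symmetric[OF pW, of j1 "v i p" j "v k p"] by (simp add: D_X[OF pW])
      finally show ?thesis by (simp add: inner_commute)
    qed
    ultimately show ?thesis using hd by simp
  qed
  moreover have "D X p (v i p) \<bullet> D X p (v k p) = (if i = k then 1 else 0)" if p: "p \<in> V2" for p i k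
  proof (cases "i = k")
    case True
    have "p \<in> V k" "p \<in> W" using p V2W by (auto simp: V2_def V1_def)
    then show ?thesis using Vunit[of p k] True by (simp add: G)
  qed (use off[OF p] in simp)
  ultimately show ?thesis using that[of V2 v] by blast
qed

end

section \<open>Changes of coordinates and the criterion for sphericity\<close>

lemma D_compose:
  assumes "\<psi> differentiable (at x)" "f differentiable (at (\<psi> x))"
  shows "D (\<lambda>x. f (\<psi> x)) x u = D f (\<psi> x) (D \<psi> x u)"
  by (rule D_eq[OF has_derivative_compose[OF has_derivative_D[OF assms(1)] has_derivative_D[OF assms(2)]]])

lemma diffeomorphism_onD:
  assumes "diffeomorphism_on V W \<phi> \<psi>"
  shows "open V" "open W" "smooth_on V \<phi>" "smooth_on W \<psi>"
    "p \<in> V \<Longrightarrow> \<phi> p \<in> W" "p \<in> V \<Longrightarrow> \<psi> (\<phi> p) = p" "x \<in> W \<Longrightarrow> \<psi> x \<in> V" "x \<in> W \<Longrightarrow> \<phi> (\<psi> x) = x"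
  using assms unfolding diffeomorphism_on_def homeomorphism_def by auto

lemma diffeomorphism_on_D_inverse:
  assumes dif: "diffeomorphism_on V W \<phi> \<psi>" and x: "x \<in> W"
  shows "D \<phi> (\<psi> x) (D \<psi> x u) = u"
proof -
  note d = diffeomorphism_onD[OF dif]
  have "D (\<lambda>x. \<phi> (\<psi> x)) x u = D (\<lambda>x. x) x u" by (rule D_cong[OF d(2) x d(8)])
  also have "\<dots> = u" by (rule D_eq[OF has_derivative_ident])
  finally show ?thesis
    using D_compose[OF smooth_on_differentiable[OF d(4) x] smooth_on_differentiable[OF d(3) d(7)[OF x]]] by simp
qed

lemma axis_sum: "(\<Sum>i\<in>UNIV. c i * (axis k 1 $ i * axis k 1 $ i)) = (c k :: real)"
  by (simp add: axis_def if_distrib cong: if_cong)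

lemma fundamental_forms_first_axis:
  assumes "fundamental_forms j1 W Y N A" "x \<in> W"
  shows "first_form Y x (axis i 1) (axis i 1) = (A x $ j1 $ i)\<^sup>2"
  using assms unfolding fundamental_forms_def by (simp add: axis_sum)

lemma fundamental_forms_data:
  assumes FF: "fundamental_forms j1 W Y N A" and W: "open W"
  shows "curvature_form_data (- {j1}) W Y N (\<lambda>i x. A x $ j1 $ i) (\<lambda>j i x. A x $ j1 $ i * A x $ j $ i)"
proof -
  have A: "smooth_on W A" using FF unfolding fundamental_forms_def by blast
  show ?thesis
    using FF unfolding fundamental_forms_def curvature_form_data_def
    by (auto intro!: smooth_intros W A)
qed

text \<open>The squares of the coefficients are the values of the first fundamental form on the
  coordinate vectors, so they are the same for all data that witness sphericity.\<close>

lemma spherical_iff_row_norm: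
  fixes A :: "real^'n::finite \<Rightarrow> real^'n^'m::finite"
  assumes FF: "fundamental_forms j1 W Y N A" and W: "open W"
  shows "spherical_line_of_curvature_coords (- {j1}) W Y N \<longleftrightarrow> (\<forall>x\<in>W. (\<Sum>i\<in>UNIV. (A x $ j1 $ i)\<^sup>2) = 1)"
proof
  assume "spherical_line_of_curvature_coords (- {j1}) W Y N"
  then obtain a b where ab: "curvature_form_data (- {j1}) W Y N a b" and one: "\<And>x. x \<in> W \<Longrightarrow> (\<Sum>i\<in>UNIV. (a i x)\<^sup>2) = 1"
    unfolding spherical_line_of_curvature_coords_def by blast
  have "(A x $ j1 $ i)\<^sup>2 = (a i x)\<^sup>2" if x: "x \<in> W" for x i
  proof -
    have "first_form Y x (axis i 1) (axis i 1) = (a i x)\<^sup>2"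
      using ab x unfolding curvature_form_data_def by (simp add: axis_sum)
    then show ?thesis using fundamental_forms_first_axis[OF FF x, of i] by simp
  qed
  then show "\<forall>x\<in>W. (\<Sum>i\<in>UNIV. (A x $ j1 $ i)\<^sup>2) = 1" using one by simp
next
  assume "\<forall>x\<in>W. (\<Sum>i\<in>UNIV. (A x $ j1 $ i)\<^sup>2) = 1"
  then show "spherical_line_of_curvature_coords (- {j1}) W Y N"
    unfolding spherical_line_of_curvature_coords_def using fundamental_forms_data[OF FF W] by blast
qed

lemma cmatrix_frame_connection:
  fixes A :: "real^'n::finite^'m::finite"
  shows "cmatrix (frame_connection A F i) = lax_connection 1 A F i"
proof -
  have M: "cmatrix (A ** B) = cmatrix A ** cmatrix B" for A :: "real^'b::finite^'a::finite" and B :: "real^'c::finite^'b"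
    by (simp add: vec_eq_iff cmatrix_def matrix_matrix_mult_def)
  have C: "cmatrix (C_mat i) = C_mat i" for i :: 'n
    by (simp add: vec_eq_iff cmatrix_def C_mat_def)
  have T: "cmatrix (transpose A) = transpose (cmatrix A)" for A :: "real^'a::finite^'b::finite"
    by (simp add: vec_eq_iff cmatrix_def transpose_def)
  have blk: "cmatrix (block_matrix P Q R S) = block_matrix (cmatrix P) (cmatrix Q) (cmatrix R) (cmatrix S)"
    for P :: "real^'m^'m" and Q :: "real^'n^'m" and R S
    by (simp add: vec_eq_iff cmatrix_def block_matrix_def split: sum.split)
  have lin: "cmatrix (- A) = - cmatrix A" "cmatrix (A + B) = cmatrix A + cmatrix B" "cmatrix (0 :: real^'a^'b) = 0"
    for A B :: "real^'a::finite^'b::finite"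
    by (simp_all add: vec_eq_iff cmatrix_def)
  show ?thesis
    unfolding frame_connection_def lax_connection_def blk lin M C T by simp
qed

section \<open>Construction of curvature coordinates\<close>

context normal_framed_immersion
begin

lemma reparametrization:
  assumes dif: "diffeomorphism_on V W' \<phi> \<psi>" and VW: "V \<subseteq> W"
  shows "normal_framed_immersion W' (\<lambda>x. X (\<psi> x)) (\<lambda>j x. N j (\<psi> x)) j1"
proof
  note d = diffeomorphism_onD[OF dif]
  have in_W: "\<psi> x \<in> W" if "x \<in> W'" for x using d(7)[OF that] VW by blast
  have psi: "\<psi> differentiable (at x)" if "x \<in> W'" for x by (rule smooth_on_differentiable[OF d(4) that])
  show "parallel_normals W' (\<lambda>j x. N j (\<psi> x))"
    unfolding parallel_normals_def
  proof (intro conjI allI ballI d(2))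
    show "smooth_on W' (\<lambda>x. N j (\<psi> x))" for j
      by (rule smooth_on_compose[OF d(2) open_W d(4) N_smooth in_W])
    fix x assume x: "x \<in> W'"
    show "N j (\<psi> x) \<bullet> N k (\<psi> x) = (if j = k then 1 else 0)" for j k
      by (rule N_orth[OF in_W[OF x]])
    show "partial i (\<lambda>x. N j (\<psi> x)) x \<bullet> N k (\<psi> x) = 0" for i j k
      unfolding partial_def D_compose[OF psi[OF x] N_diff[OF in_W[OF x]]] by (rule D_N_orth[OF in_W[OF x]])
  qed
  show "N j1 (\<psi> x) = X (\<psi> x)" if "x \<in> W'" for x by (rule X[OF in_W[OF that]])
  show "inj (D (\<lambda>x. X (\<psi> x)) x)" if x: "x \<in> W'" for x
  proof (rule injI)
    fix u w assume "D (\<lambda>x. X (\<psi> x)) x u = D (\<lambda>x. X (\<psi> x)) x w"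
    then have "D X (\<psi> x) (D \<psi> x u) = D X (\<psi> x) (D \<psi> x w)"
      by (simp add: D_compose[OF psi[OF x] X_diff[OF in_W[OF x]]])
    then have "D \<psi> x u = D \<psi> x w" using inj[OF in_W[OF x]] by (simp add: inj_def)
    then show "u = w" using diffeomorphism_on_D_inverse[OF dif x] by metis
  qed
qed

lemma fundamental_forms_nonzero:
  assumes "fundamental_forms j1 W X N A" "x \<in> W"
  shows "A x $ j1 $ i \<noteq> 0"
proof
  assume "A x $ j1 $ i = 0"
  then have "D X x (axis i 1) = 0"
    using fundamental_forms_first_axis[OF assms, of i] by (simp add: first_form_def)
  moreover have "D X x 0 = 0" by (rule linear_0[OF linear_D[OF X_diff[OF assms(2)]]])
  ultimately show False using inj[OF assms(2)] by (metis axis_eq_0_iff injD zero_neq_one)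
qed

lemma adapted_moving_frame:
  assumes "fundamental_forms j1 W X N A"
  shows "moving_frame W N (\<lambda>i x. (1 / A x $ j1 $ i) *\<^sub>R partial i X x) A (rotation_coeffs j1 A)"
  using moving_frame_fundamental_forms[OF normals _ assms] fundamental_forms_nonzero[OF assms] X by simp

text \<open>The sections \<open>dX u\<close> with constant \<open>u\<close> test flatness in every
  tangent direction at \<open>x\<close>. Bilinear expansion passes from coordinate directions to
  arbitrary \<open>w\<close> and \<open>z\<close>.\<close>

lemma gauss_equation:
  assumes flat: "flat_bundle W (tangent_space X)" and x: "x \<in> W"
  shows "(\<Sum>j\<in>UNIV. (D X x u \<bullet> D (N j) x w) *\<^sub>R D (N j) x z) = (\<Sum>j\<in>UNIV. (D X x u \<bullet> D (N j) x z) *\<^sub>R D (N j) x w)"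
proof -
  define s where "s y = D X y u" for y
  have "smooth_on W s"
  proof (rule smooth_on_cong[OF open_W])
    show "smooth_on W (\<lambda>y. \<Sum>r\<in>UNIV. u $ r *\<^sub>R partial r X y)" by (intro smooth_intros open_W X_smooth)
  qed (simp add: s_def D_partials X_diff)
  then have s: "smooth_section W (tangent_space X) s"
    unfolding smooth_section_def by (simp add: s_def tangent_space_def)
  define \<Psi> where "\<Psi> i k = (\<Sum>j\<in>UNIV. (s x \<bullet> partial i (N j) x) *\<^sub>R partial k (N j) x)" for i k
  have \<Psi>: "\<Psi> i k = \<Psi> k i" for i k
  proof -
    have "nabla (tangent_space X) k (nabla (tangent_space X) i s) x = nabla (tangent_space X) i (nabla (tangent_space X) k s) x"
      using flat s x unfolding flat_bundle_def by blast
    then show ?thesis using tangent_curvature[OF s x, of k i] by (simp add: \<Psi>_def)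
  qed
  have ex: "(\<Sum>j\<in>UNIV. (s x \<bullet> D (N j) x w) *\<^sub>R D (N j) x z) = (\<Sum>i\<in>UNIV. \<Sum>k\<in>UNIV. (w $ i * z $ k) *\<^sub>R \<Psi> i k)" for w z
  proof -
    have "(\<Sum>j\<in>UNIV. (s x \<bullet> D (N j) x w) *\<^sub>R D (N j) x z)
        = (\<Sum>j\<in>UNIV. \<Sum>i\<in>UNIV. \<Sum>k\<in>UNIV. (w $ i * z $ k) *\<^sub>R ((s x \<bullet> partial i (N j) x) *\<^sub>R partial k (N j) x))"
      unfolding D_partials[OF N_diff[OF x]] inner_sum_right scaleR_sum_left
      by (intro sum.cong refl) (simp add: scaleR_sum_right mult_ac)
    also have "\<dots> = (\<Sum>i\<in>UNIV. \<Sum>j\<in>UNIV. \<Sum>k\<in>UNIV. (w $ i * z $ k) *\<^sub>R ((s x \<bullet> partial i (N j) x) *\<^sub>R partial k (N j) x))"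
      by (rule sum.swap)
    also have "\<dots> = (\<Sum>i\<in>UNIV. \<Sum>k\<in>UNIV. \<Sum>j\<in>UNIV. (w $ i * z $ k) *\<^sub>R ((s x \<bullet> partial i (N j) x) *\<^sub>R partial k (N j) x))"
      by (intro sum.cong refl sum.swap)
    finally show ?thesis by (simp add: \<Psi>_def scaleR_sum_right)
  qed
  have "(\<Sum>j\<in>UNIV. (s x \<bullet> D (N j) x w) *\<^sub>R D (N j) x z) = (\<Sum>i\<in>UNIV. \<Sum>k\<in>UNIV. (w $ i * z $ k) *\<^sub>R \<Psi> k i)"
    unfolding ex by (subst \<Psi>) (rule refl)
  also have "\<dots> = (\<Sum>k\<in>UNIV. \<Sum>i\<in>UNIV. (z $ k * w $ i) *\<^sub>R \<Psi> k i)"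
    by (subst sum.swap) (simp add: mult.commute)
  finally show ?thesis unfolding ex[symmetric] s_def .
qed

text \<open>The forms dual to the orthonormal principal frame need not be closed. Their multiples
  \<open>\<eta> i\<close>, scaled by the norms of the columns of \<open>\<mu>\<close>, are closed,
  and their integrals are the coordinates.\<close>

lemma curvature_coordinates:
  assumes p0: "p0 \<in> W" and dim: "dim (shape_operators (normal_space X p0) UNIV X N p0) = CARD('n)"
    and flat: "flat_bundle W (tangent_space X)"
  obtains V W' \<phi> \<psi> A where "p0 \<in> V" "V \<subseteq> W" "diffeomorphism_on V W' \<phi> \<psi>"
    "fundamental_forms j1 W' (\<lambda>x. X (\<psi> x)) (\<lambda>j x. N j (\<psi> x)) A"
proof -
  obtain V0 and v :: "'n \<Rightarrow> real^'n \<Rightarrow> real^'n" where V0: "open V0" "p0 \<in> V0" "V0 \<subseteq> W"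
    and v: "\<And>i. smooth_on V0 (v i)"
    and on: "\<And>p i k. p \<in> V0 \<Longrightarrow> D X p (v i p) \<bullet> D X p (v k p) = (if i = k then 1 else 0)"
    and off: "\<And>p i k j. p \<in> V0 \<Longrightarrow> i \<noteq> k \<Longrightarrow> D (N j) p (v i p) \<bullet> D X p (v k p) = 0"
    using smooth_principal_frame[OF p0 dim] by metis
  have VW: "p \<in> W" if "p \<in> V0" for p using V0 that by blast
  define e where "e i p = D X p (v i p)" for i p
  define \<mu> where "\<mu> j i p = D (N j) p (v i p) \<bullet> e i p" for j i p
  have N0: "smooth_on V0 (N j)" for j by (rule smooth_on_subset[OF N_smooth V0(3)])
  have X0: "smooth_on V0 X" by (rule smooth_on_subset[OF X_smooth V0(3)])
  have sD: "smooth_on V0 (\<lambda>p. D f p (v i p))" if f: "smooth_on V0 f" for f :: "real^'n \<Rightarrow> real^('m + 'n)" and i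
  proof (rule smooth_on_cong[OF V0(1)])
    show "smooth_on V0 (\<lambda>p. \<Sum>r\<in>UNIV. v i p $ r *\<^sub>R partial r f p)" by (intro smooth_intros V0 v f)
  qed (simp add: D_partials smooth_on_differentiable[OF f])
  have es: "smooth_on V0 (e i)" for i unfolding e_def[abs_def] by (rule sD[OF X0])
  have \<mu>s: "smooth_on V0 (\<mu> j i)" for j i unfolding \<mu>_def[abs_def] by (intro smooth_intros V0 es sD N0)
  have ee: "e i p \<bullet> e k p = (if i = k then 1 else 0)" if "p \<in> V0" for p i k
    unfolding e_def by (rule on[OF that])
  have Ne: "e i p \<bullet> N j p = 0" if "p \<in> V0" for p i j
    unfolding e_def D_X[OF VW[OF that]] by (rule D_N_orth[OF VW[OF that]])
  have expand: "t = (\<Sum>k\<in>UNIV. (t \<bullet> e k p) *\<^sub>R e k p)" if p: "p \<in> V0" and t: "\<And>j. t \<bullet> N j p = 0" for t p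
  proof -
    have "orthonormal_pair (\<lambda>j. N j p) (\<lambda>i. e i p)"
      unfolding orthonormal_pair_def using N_orth[OF VW[OF p]] ee[OF p] Ne[OF p] by (simp add: inner_commute)
    from orthonormal_pair_expansion[OF this, of t] show ?thesis by (simp add: t)
  qed
  have DNv: "D (N j) p (v i p) = \<mu> j i p *\<^sub>R e i p" if p: "p \<in> V0" for j i p
  proof -
    have "D (N j) p (v i p) = (\<Sum>k\<in>UNIV. (D (N j) p (v i p) \<bullet> e k p) *\<^sub>R e k p)"
      by (rule expand[OF p D_N_orth[OF VW[OF p]]])
    also have "\<dots> = (\<Sum>k\<in>UNIV. (if k = i then \<mu> j i p else 0) *\<^sub>R e k p)"
      using off[OF p] by (intro sum.cong) (auto simp: \<mu>_def e_def)
    finally show ?thesis by (simp add: sum_delta_scaleR)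
  qed
  have \<mu>1: "\<mu> j1 i p = 1" if p: "p \<in> V0" for i p
    unfolding \<mu>_def using ee[OF p, of i i] by (simp add: D_X[OF VW[OF p], symmetric] e_def)
  \<comment> \<open>Squared length of column \<open>i\<close>; the entry 1 in row \<open>j1\<close>
    bounds it from below, so its root can be inverted smoothly.\<close>
  define q where "q i p = (\<Sum>j\<in>UNIV. (\<mu> j i p)\<^sup>2)" for i p
  have q: "q i p \<ge> 1" if p: "p \<in> V0" for i p
    using member_le_sum[of j1 UNIV "\<lambda>j. (\<mu> j i p)\<^sup>2"] \<mu>1[OF p] by (simp add: q_def)
  have qs: "smooth_on V0 (q i)" for i
    unfolding q_def[abs_def] power2_eq_square by (intro smooth_intros V0 \<mu>s)
  define a where "a i p = 1 / sqrt (q i p)" for i p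
  have as: "smooth_on V0 (a i)" for i
    unfolding a_def[abs_def] using q[of _ i]
    by (intro smooth_on_divide smooth_on_sqrt smooth_on_const V0 qs) (fastforce simp: less_le_trans)+
  have aq: "a i p * a i p * q i p = 1" if "p \<in> V0" for i p
    using q[OF that, of i] by (simp add: a_def)
  define A where "A p = (\<chi> j i. a i p * \<mu> j i p)" for p
  have As: "smooth_on V0 A" unfolding A_def[abs_def] by (intro smooth_intros V0 as \<mu>s)
  have A: "A p $ j $ i = a i p * \<mu> j i p" for p j i by (simp add: A_def)
  have \<mu>\<mu>: "(\<Sum>j\<in>UNIV. \<mu> j i p * \<mu> j k p) = 0" if p: "p \<in> V0" and ik: "i \<noteq> k" for p i k
  proof -
    \<comment> \<open>In the Gauss equation on \<open>v i\<close>, \<open>v i\<close>,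
      \<open>v k\<close> the right side vanishes because \<open>e i\<close> and \<open>e k\<close>
      are orthogonal.\<close>
    have "(\<Sum>j\<in>UNIV. (D X p (v i p) \<bullet> D (N j) p (v i p)) *\<^sub>R D (N j) p (v k p)) = (\<Sum>j\<in>UNIV. (D X p (v i p) \<bullet> D (N j) p (v k p)) *\<^sub>R D (N j) p (v i p))"
      by (rule gauss_equation[OF flat VW[OF p]])
    then have "(\<Sum>j\<in>UNIV. (\<mu> j i p * \<mu> j k p) *\<^sub>R e k p) = 0"
      using ik ee[OF p] unfolding DNv[OF p] e_def[symmetric] by simp
    then have "(\<Sum>j\<in>UNIV. \<mu> j i p * \<mu> j k p) *\<^sub>R e k p \<bullet> e k p = 0" by (simp add: scaleR_sum_left[symmetric])
    then show ?thesis using ee[OF p, of k k] by simp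
  qed
  have AA: "(\<Sum>j\<in>UNIV. A p $ j $ i * A p $ j $ k) = (if i = k then 1 else 0)" if p: "p \<in> V0" for p i k
  proof -
    have "(\<Sum>j\<in>UNIV. A p $ j $ i * A p $ j $ k) = a i p * a k p * (\<Sum>j\<in>UNIV. \<mu> j i p * \<mu> j k p)"
      unfolding A by (simp add: sum_distrib_left mult_ac)
    then show ?thesis using \<mu>\<mu>[OF p] aq[OF p] by (auto simp: q_def power2_eq_square)
  qed
  have orth: "transpose (A p) ** A p = mat 1" if "p \<in> V0" for p
    using AA[OF that] by (simp add: matrix_matrix_mult_def transpose_def mat_def vec_eq_iff)
  \<comment> \<open>If each \<open>dN j\<close> is the sum of the \<open>\<eta> k\<close> times
    \<open>e k\<close> weighted by row \<open>j\<close> of \<open>A\<close>, then contraction with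
    column \<open>i\<close> and pairing with \<open>e i\<close> must return
    \<open>\<eta> i\<close>.\<close>
  define \<eta> where "\<eta> i s p = (\<Sum>j\<in>UNIV. A p $ j $ i * (partial s (N j) p \<bullet> e i p))" for i s p
  have \<eta>s: "smooth_on V0 (\<eta> i s)" for i s
    unfolding \<eta>_def[abs_def] by (intro smooth_intros V0 As N0 es)
  have dN: "partial s (N j) p = (\<Sum>k\<in>UNIV. (A p $ j $ k * \<eta> k s p) *\<^sub>R e k p)" if p: "p \<in> V0" for s j p
  proof -
    interpret DX: linear "D X p" by (rule linear_D[OF X_diff[OF VW[OF p]]])
    define \<omega> where "\<omega> k = partial s X p \<bullet> e k p" for k
    have "partial s X p = (\<Sum>k\<in>UNIV. \<omega> k *\<^sub>R e k p)"
      unfolding \<omega>_def by (rule expand[OF p]) (simp add: partial_X[OF VW[OF p]] dN_orth[OF VW[OF p]])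
    then have "D X p (axis s 1) = D X p (\<Sum>k\<in>UNIV. \<omega> k *\<^sub>R v k p)"
      by (simp add: partial_def e_def DX.sum DX.scaleR)
    then have ax: "axis s 1 = (\<Sum>k\<in>UNIV. \<omega> k *\<^sub>R v k p)" using inj[OF VW[OF p]] by (rule injD[rotated])
    have dN\<omega>: "partial s (N j) p = (\<Sum>k\<in>UNIV. (\<omega> k * \<mu> j k p) *\<^sub>R e k p)" for j
    proof -
      interpret DN: linear "D (N j) p" by (rule linear_D[OF N_diff[OF VW[OF p]]])
      show ?thesis unfolding partial_def ax by (simp add: DN.sum DN.scaleR DNv[OF p])
    qed
    have "A p $ j $ k * \<eta> k s p = \<omega> k * \<mu> j k p" for k
    proof -
      have "\<eta> k s p = \<omega> k * a k p * q k p"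
        unfolding \<eta>_def dN\<omega> inner_sum_orthonormal[OF ee[OF p]] A q_def
        by (simp add: sum_distrib_left power2_eq_square mult_ac)
      then have "A p $ j $ k * \<eta> k s p = \<omega> k * \<mu> j k p * (a k p * a k p * q k p)" by (simp add: A mult_ac)
      then show ?thesis by (simp add: aq[OF p])
    qed
    then show ?thesis unfolding dN\<omega> by simp
  qed
  have closed: "partial r (\<eta> i s) p = partial s (\<eta> i r) p" if p: "p \<in> V0" for p i r s
  proof -
    have sA: "smooth_on V0 (\<lambda>p. A p $ j $ k)" for j k by (intro smooth_intros V0 As)
    have eed: "e i p \<bullet> partial r (e i) p = 0" for r
      using partial_inner_constant[OF V0(1) p es es ee[of _ i i], of r] by (simp add: inner_commute)
    have AdA: "(\<Sum>j\<in>UNIV. A p $ j $ i * partial r (\<lambda>p. A p $ j $ i) p) = 0" for r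
    proof -
      have "partial r (\<lambda>p. \<Sum>j\<in>UNIV. A p $ j $ i * A p $ j $ i) p = 0"
        using partial_cong[OF V0(1) p, of "\<lambda>p. \<Sum>j\<in>UNIV. A p $ j $ i * A p $ j $ i" "\<lambda>_. 1" r] AA by simp
      moreover have "partial r (\<lambda>p. \<Sum>j\<in>UNIV. A p $ j $ i * A p $ j $ i) p
          = 2 * (\<Sum>j\<in>UNIV. A p $ j $ i * partial r (\<lambda>p. A p $ j $ i) p)"
        by (simp add: partial_sum partial_bilinear[OF bounded_bilinear_mult] smooth_on_differentiable[OF _ p] smooth_intros V0 sA
            sum_distrib_left mult.commute)
      ultimately show ?thesis by simp
    qed
    \<comment> \<open>Two of the three terms of the product rule drop out: orthonormality of the
      columns leaves only the product of \<open>e i\<close> with its own derivative, and a unit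
      column is orthogonal to its derivative. What remains contains a mixed second derivative of
      \<open>N j\<close>.\<close>
    have "partial r (\<eta> i s) p = (\<Sum>j\<in>UNIV. A p $ j $ i * (partial r (partial s (N j)) p \<bullet> e i p))" for r s
    proof -
      have "partial r (\<eta> i s) p = (\<Sum>j\<in>UNIV. A p $ j $ i * (partial s (N j) p \<bullet> partial r (e i) p + partial r (partial s (N j)) p \<bullet> e i p)
          + partial r (\<lambda>p. A p $ j $ i) p * (partial s (N j) p \<bullet> e i p))"
        unfolding \<eta>_def[abs_def]
        by (simp add: partial_sum partial_bilinear[OF bounded_bilinear_mult] partial_inner smooth_on_differentiable[OF _ p] smooth_intros V0 sA es N0)
      moreover have "(\<Sum>j\<in>UNIV. A p $ j $ i * (partial s (N j) p \<bullet> partial r (e i) p)) = 0"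
      proof -
        have "(\<Sum>j\<in>UNIV. A p $ j $ i * (partial s (N j) p \<bullet> partial r (e i) p))
            = (\<Sum>j\<in>UNIV. \<Sum>k\<in>UNIV. A p $ j $ i * A p $ j $ k * (\<eta> k s p * (e k p \<bullet> partial r (e i) p)))"
          unfolding dN[OF p] by (simp add: inner_sum_left sum_distrib_left mult_ac)
        also have "\<dots> = (\<Sum>k\<in>UNIV. (\<Sum>j\<in>UNIV. A p $ j $ i * A p $ j $ k) * (\<eta> k s p * (e k p \<bullet> partial r (e i) p)))"
          unfolding sum_distrib_right by (rule sum.swap)
        also have "\<dots> = 0" unfolding AA[OF p] by (intro sum.neutral) (auto simp: eed)
        finally show ?thesis .
      qed
      moreover have "(\<Sum>j\<in>UNIV. partial r (\<lambda>p. A p $ j $ i) p * (partial s (N j) p \<bullet> e i p)) = 0"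
      proof -
        have "(\<Sum>j\<in>UNIV. partial r (\<lambda>p. A p $ j $ i) p * (partial s (N j) p \<bullet> e i p))
            = \<eta> i s p * (\<Sum>j\<in>UNIV. A p $ j $ i * partial r (\<lambda>p. A p $ j $ i) p)"
          unfolding dN[OF p] inner_sum_orthonormal[OF ee[OF p]] by (simp add: sum_distrib_left mult_ac)
        then show ?thesis by (simp add: AdA)
      qed
      ultimately show ?thesis by (simp add: sum.distrib distrib_left)
    qed
    note eq = this
    show ?thesis
      unfolding eq by (intro sum.cong refl arg_cong2[where f = "(*)"] arg_cong2[where f = inner] partial_commute[OF V0(1) N0 p])
  qed
  \<comment> \<open>A ball, because the closed forms are integrated on a convex set.\<close>
  obtain \<epsilon> where \<epsilon>: "\<epsilon> > 0" "ball p0 \<epsilon> \<subseteq> V0" using V0(1,2) open_contains_ball by blast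
  let ?B = "ball p0 \<epsilon>"
  have BV: "p \<in> V0" if "p \<in> ?B" for p using that \<epsilon> by blast
  have "\<exists>f. smooth_on ?B f \<and> (\<forall>p\<in>?B. \<forall>s. partial s f p = \<eta> i s p)" for i
  proof (rule closed_form_exact[of ?B p0 "\<eta> i"])
    show "smooth_on ?B (\<eta> i s)" for s by (rule smooth_on_subset[OF \<eta>s \<epsilon>(2)])
    show "partial r (\<eta> i s) p = partial s (\<eta> i r) p" if "p \<in> ?B" for p r s by (rule closed[OF BV[OF that]])
  qed (use \<epsilon> in auto)
  then obtain f where f: "\<And>i. smooth_on ?B (f i)" and pf: "\<And>i p s. p \<in> ?B \<Longrightarrow> partial s (f i) p = \<eta> i s p"
    by metis
  define \<phi> where "\<phi> p = (\<chi> i. f i p)" for p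
  have \<phi>: "smooth_on ?B \<phi>" unfolding \<phi>_def[abs_def] by (intro smooth_intros f) simp
  have D\<phi>: "D \<phi> p u $ i = (\<Sum>s\<in>UNIV. u $ s * \<eta> i s p)" if p: "p \<in> ?B" for p u i
  proof -
    have "partial s \<phi> p $ i = \<eta> i s p" for s
      using partial_linear[OF bounded_linear_vec_nth smooth_on_differentiable[OF \<phi> p], of s i] pf[OF p, of s i]
      by (simp add: \<phi>_def)
    then show ?thesis by (simp add: D_partials[OF smooth_on_differentiable[OF \<phi> p]])
  qed
  have DN: "D (N j) p u = (\<Sum>k\<in>UNIV. (A p $ j $ k * D \<phi> p u $ k) *\<^sub>R e k p)" if p: "p \<in> ?B" for j p u
  proof -
    have "D (N j) p u = (\<Sum>s\<in>UNIV. \<Sum>k\<in>UNIV. (A p $ j $ k * (u $ s * \<eta> k s p)) *\<^sub>R e k p)"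
      unfolding D_partials[OF N_diff[OF VW[OF BV[OF p]]]] dN[OF BV[OF p]] by (simp add: scaleR_sum_right mult_ac)
    also have "\<dots> = (\<Sum>k\<in>UNIV. (A p $ j $ k * D \<phi> p u $ k) *\<^sub>R e k p)"
      unfolding D\<phi>[OF p] sum_distrib_left scaleR_sum_left by (rule sum.swap)
    finally show ?thesis .
  qed
  have p0B: "p0 \<in> ?B" using \<epsilon> by simp
  \<comment> \<open>By \<open>DN\<close> the map \<open>dX\<close> factors through the differential
    of \<open>\<phi>\<close>, which is therefore injective as well.\<close>
  have "inj (D \<phi> p0)"
  proof (rule injI)
    fix u w assume "D \<phi> p0 u = D \<phi> p0 w"
    then have "D X p0 u = D X p0 w" unfolding D_X[OF p0] DN[OF p0B] by simp
    then show "u = w" using inj[OF p0] by (simp add: inj_def)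
  qed
  then obtain V W' \<psi> where V: "p0 \<in> V" "V \<subseteq> ?B" and dif: "diffeomorphism_on V W' \<phi> \<psi>"
    using smooth_inverse_function[OF open_ball \<phi> p0B] by metis
  note d = diffeomorphism_onD[OF dif]
  have \<psi>B: "\<psi> x \<in> ?B" if "x \<in> W'" for x using d(7)[OF that] V by blast
  have \<psi>d: "\<psi> differentiable (at x)" if "x \<in> W'" for x by (rule smooth_on_differentiable[OF d(4) that])
  have "fundamental_forms j1 W' (\<lambda>x. X (\<psi> x)) (\<lambda>j x. N j (\<psi> x)) (\<lambda>x. A (\<psi> x))"
  proof (rule fundamental_formsI[where e = "\<lambda>i x. e i (\<psi> x)"])
    show "smooth_on W' (\<lambda>x. A (\<psi> x))"
      by (rule smooth_on_compose[OF d(2) V0(1) d(4) As]) (rule BV[OF \<psi>B])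
    fix x assume x: "x \<in> W'"
    note xB = \<psi>B[OF x] and xV = BV[OF \<psi>B[OF x]] and xW = VW[OF BV[OF \<psi>B[OF x]]]
    show "transpose (A (\<psi> x)) ** A (\<psi> x) = mat 1" by (rule orth[OF xV])
    show "e i (\<psi> x) \<bullet> e k (\<psi> x) = (if i = k then 1 else 0)" for i k by (rule ee[OF xV])
    show "D (\<lambda>x. N j (\<psi> x)) x u = (\<Sum>i\<in>UNIV. (A (\<psi> x) $ j $ i * u $ i) *\<^sub>R e i (\<psi> x))" for j u
      unfolding D_compose[OF \<psi>d[OF x] N_diff[OF xW]] DN[OF xB] diffeomorphism_on_D_inverse[OF dif x] ..
    show "D (\<lambda>x. X (\<psi> x)) x u = D (\<lambda>x. N j1 (\<psi> x)) x u" for u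
      unfolding D_compose[OF \<psi>d[OF x] N_diff[OF xW]] D_compose[OF \<psi>d[OF x] X_diff[OF xW]] by (rule D_X[OF xW])
  qed
  moreover have "V \<subseteq> W" using V BV VW by blast
  ultimately show ?thesis using that[OF V(1) _ dif] by blast
qed

text \<open>The principal basis at \<open>\<psi> x\<close> is the image of the coordinate vectors
  under the differential of \<open>\<psi>\<close>. In it the shape operators inside the sphere are
  the diagonals formed from the rows other than \<open>j1\<close>.\<close>

lemma sphere_shape_dim_iff:
  assumes dif: "diffeomorphism_on V W' \<phi> \<psi>" and VW: "V \<subseteq> W"
    and FF: "fundamental_forms j1 W' (\<lambda>x. X (\<psi> x)) (\<lambda>j x. N j (\<psi> x)) A" and x: "x \<in> W'"
  shows "dim (shape_operators (sphere_normal_space X (\<psi> x)) (- {j1}) X N (\<psi> x)) < CARD('n)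
    \<longleftrightarrow> (\<Sum>i\<in>UNIV. (A x $ j1 $ i)\<^sup>2) = 1"
proof -
  note d = diffeomorphism_onD[OF dif]
  interpret Y: normal_framed_immersion W' "\<lambda>x. X (\<psi> x)" "\<lambda>j x. N j (\<psi> x)" j1
    by (rule reparametrization[OF dif VW])
  have xW: "\<psi> x \<in> W" using d(7)[OF x] VW by blast
  note MF = Y.adapted_moving_frame[OF FF]
  note nz = Y.fundamental_forms_nonzero[OF FF x]
  have psi: "\<psi> differentiable (at x)" by (rule smooth_on_differentiable[OF d(4) x])
  let ?e = "\<lambda>i. (1 / A x $ j1 $ i) *\<^sub>R partial i (\<lambda>x. X (\<psi> x)) x"
  have DN: "D (N j) (\<psi> x) (D \<psi> x (axis i 1)) = A x $ j $ i *\<^sub>R ?e i" for j i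
    using moving_frameD(5)[OF MF x, of i j] unfolding partial_def[of _ "\<lambda>x. N j (\<psi> x)"] D_compose[OF psi N_diff[OF xW]] .
  have "dim (shape_operators (sphere_normal_space X (\<psi> x)) (- {j1}) X N (\<psi> x))
      = dim {d :: real^'n. \<exists>c. \<forall>i. d $ i = (\<Sum>j\<in>-{j1}. c j * A x $ j $ i) / A x $ j1 $ i}"
  proof (rule dim_shape_operators[where v = "\<lambda>i. D \<psi> x (axis i 1)" and e = ?e])
    show "?e i \<bullet> ?e k = (if i = k then 1 else 0)" for i k
      by (rule orthonormal_pairD(2)[OF moving_frameD(4)[OF MF x]])
    show "D X (\<psi> x) (D \<psi> x (axis i 1)) = A x $ j1 $ i *\<^sub>R ?e i" for i
      unfolding D_X[OF xW] by (rule DN)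
    show "(\<Sum>j\<in>-{j1}. c j *\<^sub>R N j (\<psi> x)) \<in> sphere_normal_space X (\<psi> x)" for c
      by (rule sphere_normal_sum[OF xW]) simp
  qed (use X_diff[OF xW] N_diff[OF xW] inj[OF xW] N_orth[OF xW] DN nz in auto)
  moreover have "transpose (A x) ** A x = mat 1" using FF x unfolding fundamental_forms_def by blast
  ultimately show ?thesis using dim_sphere_shape[of "A x" j1] nz by simp
qed

end

text \<open>The coordinates are local because the smooth eigenframe and the inverse function are.
  The frame equations concern every coordinate system in which the forms have the prescribed shape,
  since they are forced by that shape alone. Convexity serves to integrate the connection; the
  conclusions about a given \<open>g\<close> are differential identities and hold on any open
  set.\<close>

theorem theorem6p1:
  fixes j1 :: "'m::finite"
  assumes "CARD('m) \<ge> CARD('n::finite)"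
  shows
   "(\<forall>(U :: (real^'n) set) (X :: real^'n \<Rightarrow> real^('m + 'n)) N.
       flat_sphere_immersion j1 U X N \<longrightarrow>
       (\<forall>p0\<in>U. \<exists>V W \<phi> \<psi> A.
          p0 \<in> V \<and> V \<subseteq> U \<and> diffeomorphism_on V W \<phi> \<psi> \<and>
          line_of_curvature_coords (- {j1}) W (X \<circ> \<psi>) (\<lambda>j. N j \<circ> \<psi>) \<and>
          (CARD('m) = CARD('n) \<longrightarrow>
             spherical_line_of_curvature_coords (- {j1}) W (X \<circ> \<psi>) (\<lambda>j. N j \<circ> \<psi>)) \<and>
          (spherical_line_of_curvature_coords (- {j1}) W (X \<circ> \<psi>) (\<lambda>j. N j \<circ> \<psi>) \<longleftrightarrow>
             (\<forall>p\<in>V. dim (shape_operators (sphere_normal_space X p) (- {j1}) X N p) < CARD('n))) \<and>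
          fundamental_forms j1 W (X \<circ> \<psi>) (\<lambda>j. N j \<circ> \<psi>) A) \<and>
       (\<forall>V W \<phi> \<psi> A.
          V \<subseteq> U \<and> diffeomorphism_on V W \<phi> \<psi> \<and>
          fundamental_forms j1 W (X \<circ> \<psi>) (\<lambda>j. N j \<circ> \<psi>) A \<longrightarrow>
          G_system_I W A (rotation_coeffs j1 A) \<and>
          frame_solution W A (rotation_coeffs j1 A)
            (frame_matrix j1 (X \<circ> \<psi>) (\<lambda>j. N j \<circ> \<psi>) A) \<and>
          (\<forall>x\<in>W. \<forall>i. cmatrix (frame_connection (A x) (rotation_coeffs j1 A x) i) =
             lax_connection 1 (A x) (rotation_coeffs j1 A x) i))) \<and>
    (\<forall>(\<Omega> :: (real^'n) set) (A :: real^'n \<Rightarrow> real^'n^'m) F.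
       open \<Omega> \<and> G_system_I \<Omega> A F \<longrightarrow>
       (convex \<Omega> \<longrightarrow> (\<exists>g. frame_solution \<Omega> A F g)) \<and>
       (\<forall>g. frame_solution \<Omega> A F g \<and> (\<forall>x\<in>\<Omega>. \<forall>i. A x $ j1 $ i \<noteq> 0) \<longrightarrow>
          (let X = (\<lambda>x. column (Inl j1) (g x)); N = (\<lambda>j x. column (Inl j) (g x))
           in flat_sphere_immersion j1 \<Omega> X N \<and> fundamental_forms j1 \<Omega> X N A)))"
proof (intro conjI allI impI ballI)
  fix U :: "(real^'n) set" and X :: "real^'n \<Rightarrow> real^('m + 'n)" and N p0
  assume FI: "flat_sphere_immersion j1 U X N" and p0: "p0 \<in> U"
  interpret normal_framed_immersion U X N j1
    using FI unfolding flat_sphere_immersion_def by (intro normal_framed_immersionI) auto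
  have dim: "dim (shape_operators (normal_space X p0) UNIV X N p0) = CARD('n)"
    and flat: "flat_bundle U (tangent_space X)"
    using FI p0 unfolding flat_sphere_immersion_def nondegenerate_normal_bundle_def by auto
  obtain V W \<phi> \<psi> A where V: "p0 \<in> V" "V \<subseteq> U" and dif: "diffeomorphism_on V W \<phi> \<psi>"
    and FF: "fundamental_forms j1 W (\<lambda>x. X (\<psi> x)) (\<lambda>j x. N j (\<psi> x)) A"
    using curvature_coordinates[OF p0 dim flat] by metis
  note d = diffeomorphism_onD[OF dif]
  have orth: "transpose (A x) ** A x = mat 1" if "x \<in> W" for x
    using FF that unfolding fundamental_forms_def by blast
  note sph = spherical_iff_row_norm[OF FF d(2)]
  have square: "CARD('m) = CARD('n) \<longrightarrow> spherical_line_of_curvature_coords (- {j1}) W (\<lambda>x. X (\<psi> x)) (\<lambda>j x. N j (\<psi> x))"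
    unfolding sph using square_orthogonal_row_norm[OF orth] by blast
  have shape: "spherical_line_of_curvature_coords (- {j1}) W (\<lambda>x. X (\<psi> x)) (\<lambda>j x. N j (\<psi> x)) \<longleftrightarrow>
      (\<forall>p\<in>V. dim (shape_operators (sphere_normal_space X p) (- {j1}) X N p) < CARD('n))"
    unfolding sph using sphere_shape_dim_iff[OF dif V(2) FF] d(5-8) by metis
  have line: "line_of_curvature_coords (- {j1}) W (\<lambda>x. X (\<psi> x)) (\<lambda>j x. N j (\<psi> x))"
    unfolding line_of_curvature_coords_def using fundamental_forms_data[OF FF d(2)] by blast
  show "\<exists>V W \<phi> \<psi> A. p0 \<in> V \<and> V \<subseteq> U \<and> diffeomorphism_on V W \<phi> \<psi> \<and>
      line_of_curvature_coords (- {j1}) W (X \<circ> \<psi>) (\<lambda>j. N j \<circ> \<psi>) \<and>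
      (CARD('m) = CARD('n) \<longrightarrow>
         spherical_line_of_curvature_coords (- {j1}) W (X \<circ> \<psi>) (\<lambda>j. N j \<circ> \<psi>)) \<and>
      (spherical_line_of_curvature_coords (- {j1}) W (X \<circ> \<psi>) (\<lambda>j. N j \<circ> \<psi>) \<longleftrightarrow>
         (\<forall>p\<in>V. dim (shape_operators (sphere_normal_space X p) (- {j1}) X N p) < CARD('n))) \<and>
      fundamental_forms j1 W (X \<circ> \<psi>) (\<lambda>j. N j \<circ> \<psi>) A"
    unfolding o_def using V dif line square shape FF by blast
next
  fix U :: "(real^'n) set" and X :: "real^'n \<Rightarrow> real^('m + 'n)" and N and V W :: "(real^'n) set" and \<phi> \<psi> A
  assume FI: "flat_sphere_immersion j1 U X N"
    and asm: "V \<subseteq> U \<and> diffeomorphism_on V W \<phi> \<psi> \<and> fundamental_forms j1 W (X \<circ> \<psi>) (\<lambda>j. N j \<circ> \<psi>) A"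
  then have VU: "V \<subseteq> U" and dif: "diffeomorphism_on V W \<phi> \<psi>"
    and FF: "fundamental_forms j1 W (\<lambda>x. X (\<psi> x)) (\<lambda>j x. N j (\<psi> x)) A" by (auto simp: o_def)
  interpret normal_framed_immersion U X N j1
    using FI unfolding flat_sphere_immersion_def by (intro normal_framed_immersionI) auto
  interpret Y: normal_framed_immersion W "\<lambda>x. X (\<psi> x)" "\<lambda>j x. N j (\<psi> x)" j1
    by (rule reparametrization[OF dif VU])
  note MF = Y.adapted_moving_frame[OF FF] and nz = Y.fundamental_forms_nonzero[OF FF]
  have A: "smooth_on W A" and orth: "\<And>x. x \<in> W \<Longrightarrow> transpose (A x) ** A x = mat 1"
    using FF unfolding fundamental_forms_def by auto
  show "G_system_I W A (rotation_coeffs j1 A)"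
    by (rule G_system_moving_frame[OF MF A smooth_on_rotation_coeffs[OF Y.open_W A nz] orth])
      (simp_all add: rotation_coeffs_def)
  show "frame_solution W A (rotation_coeffs j1 A) (frame_matrix j1 (X \<circ> \<psi>) (\<lambda>j. N j \<circ> \<psi>) A)"
    by (rule frame_solution_of_moving_frame[OF MF])
      (simp_all add: frame_matrix_def column_def vec_eq_iff o_def)
  show "cmatrix (frame_connection (A x) (rotation_coeffs j1 A x) i) = lax_connection 1 (A x) (rotation_coeffs j1 A x) i" for x i
    by (rule cmatrix_frame_connection)
next
  fix \<Omega> :: "(real^'n) set" and A :: "real^'n \<Rightarrow> real^'n^'m" and F
  assume asm: "open \<Omega> \<and> G_system_I \<Omega> A F" and "convex \<Omega>"
  then show "\<exists>g. frame_solution \<Omega> A F g" using frame_solution_exists by blast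
next
  fix \<Omega> :: "(real^'n) set" and A :: "real^'n \<Rightarrow> real^'n^'m" and F g
  assume asm: "open \<Omega> \<and> G_system_I \<Omega> A F"
    and g: "frame_solution \<Omega> A F g \<and> (\<forall>x\<in>\<Omega>. \<forall>i. A x $ j1 $ i \<noteq> 0)"
  have A: "smooth_on \<Omega> A" and orth: "\<And>x. x \<in> \<Omega> \<Longrightarrow> transpose (A x) ** A x = mat 1"
    using asm unfolding G_system_I_def by auto
  have MF: "moving_frame \<Omega> (\<lambda>j x. column (Inl j) (g x)) (\<lambda>i x. column (Inr i) (g x)) A F"
    using asm g by (intro moving_frame_of_frame_solution) auto
  show "let X = (\<lambda>x. column (Inl j1) (g x)); N = (\<lambda>j x. column (Inl j) (g x))
      in flat_sphere_immersion j1 \<Omega> X N \<and> fundamental_forms j1 \<Omega> X N A"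
    unfolding Let_def using immersion_of_moving_frame[OF MF A orth, of j1] g by blast
qed

end
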